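(* Let $\theta=(a_1,a_2,a_3,a_4;\rho_1,\rho_2,d_1,d_2;2)$ be non-degenerate with $\deg(\theta)=-1$, and let $\theta'=(a_1-1,a_2-1,a_3,a_4;\rho_1,\rho_2,d_1+1,d_2+1;2)$. Let $dPV:M_\theta\to M_{\theta'}$ be the isomorphism given by modification of d-connections, let $q,p$ denote the coordinate functions on $M_\theta$ and on $M_{\theta'}$, and set $p':=p\circ dPV$, $q':=q\circ dPV:M_\theta\to\mathbb{P}^1$. Then (as identities between rational functions on $M_\theta$) $$\begin{cases} q'+q=a_3+a_4+\dfrac{\rho_1(d_1+a_3+a_4)}{p-\rho_1}+\dfrac{\rho_2(d_2+a_3+a_4)}{p-\rho_2},\\[2mm] p'\cdot p=\dfrac{(q'-a_1+1)(q'-a_2+1)}{(q'-a_3)(q'-a_4)}\cdot\rho_1\rho_2 . \end{cases}$$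
   Context: The ground field is $\mathbb{C}$; $z$ is the coordinate on $\mathbb{P}^1$. A d-connection on a vector bundle $L$ on $\mathbb{P}^1$ is a linear operator $A(z):L_z\to L_{z+1}$ between fibers depending rationally on $z\in\mathbb{C}$ (a rational map between $L$ and $s^*L$, $s(z)=z+1$). Isomorphisms of pairs $(L,A)$ are bundle isomorphisms compatible with the d-connections. A d-connection $A$ on a rank $2$ bundle $L$ is of type $\theta=(a_1,\dots,a_k;\rho_1,\rho_2,d_1,d_2;n)$ if: (1) the only zeroes and poles of $A(z)$ are a pole of order $n$ at infinity and simple zeroes at the $k$ distinct points $a_1,\dots,a_k\in\mathbb{C}$ (a point $a_i$ is a simple zero if $A(z)$ is regular at $a_i$ and $\det A(z)$ has a zero of order $1$ there); (2) on the formal neighborhood of $\infty\in\mathbb{P}^1$ there is a trivialization $R(z):\mathbb{C}^2\to L_z$ (essentially an invertible matrix-valued Taylor series in $z^{-1}$) with $$R(z+1)^{-1}A(z)R(z)=\begin{bmatrix}\rho_1(z^n+d_1z^{n-1})&0\\ 0&\rho_2(z^n+d_2z^{n-1})\end{bmatrix}.$$ $M_\theta$ denotes the coarse moduli space of d-connections of type $\theta$. $\deg(\theta):=-d_1-d_2-\sum_i a_i$. Here $\theta$ is called non-degenerate if: $k=2n$; $\deg(\theta)\in\mathbb{Z}$; $-d_j-\sum_{i\in I}a_i\notin\mathbb{Z}$ for every $I\subset\{1,\dots,k\}$ and $j=1,2$; $a_i-a_j\notin\mathbb{Z}$ for $i\neq j$; $\rho_1,\rho_2\neq0$ and $\rho_1\neq\rho_2$.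 The isomorphism $dPV$: for $(L,A)\in M_\theta$, the image $dPV(L,A)=(L',A')$ is the only d-connection of type $\theta'$ (up to isomorphism) that admits a rational isomorphism $R:L'\dashrightarrow L$ with $R(z+1)A'(z)=A(z)R(z)$. The coordinates $(q,p)$ (for non-degenerate $\theta$ with $n=2$, $\deg(\theta)=-1$): $\mathcal{O}(k)$ is the line bundle whose sections are functions on $\mathbb{P}^1$ with pole of order at most $k$ at $\infty$. For $(L,A)\in M_\theta$ the bundle $L$ is isomorphic to $\mathcal{O}\oplus\mathcal{O}(-1)$; choosing an isomorphism $S:\mathcal{O}\oplus\mathcal{O}(-1)\to L$, the d-connection has matrix $S(z+1)^{-1}A(z)S(z)=\begin{bmatrix}a_{11}&a_{12}\\ a_{21}&a_{22}\end{bmatrix}$ with polynomial entries, $\deg a_{11},\deg a_{22}\le2$, $\deg a_{12}\le3$, $\deg a_{21}\le1$. Then $q\in\mathbb{P}^1$ is the unique zero of $a_{21}\not\equiv0$ viewed as a section of $\mathcal{O}(1)$, and $p=a_{11}(q)/\big((q-a_3)(q-a_4)\big)$, where numerator and denominator are the values at $q$ of the sections $a_{11}$ and $(z-a_3)(z-a_4)$ of $\mathcal{O}(2)$. These do not depend on $S$ and define regular maps $q,p:M_\theta\to\mathbb{P}^1$ (where the ratio is indeterminate, $p$ is defined by extension), with $(q,p):M_\theta\to(\mathbb{P}^1)^2$ birational. On $M_{\theta'}$ they are defined in the same way using the parameters of $\theta'$. *)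

theory Defs
  imports
    "HOL-Analysis.Analysis"
    "HOL-Computational_Algebra.Fraction_Field"
    "HOL-Computational_Algebra.Formal_Laurent_Series"
begin

unbundle no fps_syntax

section \<open>Rational functions on the projective line\<close>

type_synonym ratfun = "complex poly fract"
type_synonym ratmat = "ratfun^2^2"

abbreviation of_pol :: "complex poly \<Rightarrow> ratfun" where
  "of_pol p \<equiv> Fract p 1"

abbreviation Zvar :: ratfun where
  "Zvar \<equiv> of_pol [:0, 1:]"

definition polys :: "ratfun set" where
  "polys = range of_pol"

definition local_ring :: "complex \<Rightarrow> ratfun set" where
  "local_ring x = {Fract p q | p q. poly q x \<noteq> 0}"

definition local_ring_inf :: "ratfun set" where
  "local_ring_inf = {Fract p q | p q. q \<noteq> 0 \<and> degree p \<le> degree q}"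

text \<open>\<open>r\<close> is regular at \<open>x\<close> and vanishes there to order exactly \<open>m\<close>; for \<open>m = 0\<close> it is a unit.\<close>

definition zero_of_order :: "ratfun \<Rightarrow> complex \<Rightarrow> nat \<Rightarrow> bool" where
  "zero_of_order r x m \<longleftrightarrow>
     (\<exists>p q. poly p x \<noteq> 0 \<and> poly q x \<noteq> 0 \<and> r = Fract ([:- x, 1:] ^ m * p) q)"

text \<open>An arbitrary representation as a quotient of polynomials; the functions below do not depend on
  the choice, as shown by \<open>shift_Fract\<close> and \<open>expand_inf_Fract\<close>.\<close>

definition num_den :: "ratfun \<Rightarrow> complex poly \<times> complex poly" where
  "num_den r = (SOME (p, q). q \<noteq> 0 \<and> r = Fract p q)"

lemma num_den_Fract:
  assumes "q \<noteq> 0"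
  obtains p' q' where "num_den (Fract p q) = (p', q')" "q' \<noteq> 0" "p * q' = p' * q"
proof -
  have "case num_den (Fract p q) of (p', q') \<Rightarrow> q' \<noteq> 0 \<and> Fract p q = Fract p' q'"
    unfolding num_den_def by (rule someI[where x = "(p, q)"]) (simp add: assms)
  then obtain p' q' where "num_den (Fract p q) = (p', q')" "q' \<noteq> 0" "Fract p q = Fract p' q'"
    by (auto split: prod.splits)
  with that assms show thesis by (simp add: eq_fract)
qed

text \<open>The substitution \<open>r(z) \<mapsto> r(z + 1)\<close>.\<close>

definition shift :: "ratfun \<Rightarrow> ratfun" where
  "shift r = (case num_den r of (p, q) \<Rightarrow> Fract (pcompose p [:1, 1:]) (pcompose q [:1, 1:]))"

lemma shift_Fract:
  assumes "q \<noteq> 0"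
  shows "shift (Fract p q) = Fract (pcompose p [:1, 1:]) (pcompose q [:1, 1:])"
proof -
  obtain p' q' where *: "num_den (Fract p q) = (p', q')" "q' \<noteq> 0" "p * q' = p' * q"
    using num_den_Fract[OF assms] by blast
  have "pcompose p [:1, 1:] * pcompose q' [:1, 1:] = pcompose p' [:1, 1:] * pcompose q [:1, 1:]"
    using *(3) by (metis pcompose_mult)
  then show ?thesis
    using * assms by (simp add: shift_def eq_fract pcompose_eq_0_iff)
qed

text \<open>Laurent expansion at infinity in the local parameter \<open>w = 1 / z\<close>: \<^const>\<open>fls_X\<close> stands
  for \<open>w\<close> and \<^const>\<open>fls_X_inv\<close> for \<open>z\<close>.\<close>

definition expand_poly_inf :: "complex poly \<Rightarrow> complex fls" where
  "expand_poly_inf p = poly (map_poly fls_const p) fls_X_inv"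

definition expand_inf :: "ratfun \<Rightarrow> complex fls" where
  "expand_inf r = (case num_den r of (p, q) \<Rightarrow> expand_poly_inf p / expand_poly_inf q)"

lemma expand_poly_inf_pCons:
  "expand_poly_inf (pCons a p) = fls_const a + fls_X_inv * expand_poly_inf p"
  by (cases "p = 0 \<and> a = 0") (auto simp: expand_poly_inf_def map_poly_pCons)

lemma expand_poly_inf_0: "expand_poly_inf 0 = 0"
  by (simp add: expand_poly_inf_def)

lemma expand_poly_inf_add: "expand_poly_inf (p + q) = expand_poly_inf p + expand_poly_inf q"
  by (induction p q rule: poly_induct2)
    (simp_all add: expand_poly_inf_0 expand_poly_inf_pCons algebra_simps flip: fls_plus_const)

lemma expand_poly_inf_smult: "expand_poly_inf (smult a p) = fls_const a * expand_poly_inf p"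
  by (induction p)
    (simp_all add: expand_poly_inf_0 expand_poly_inf_pCons algebra_simps flip: fls_const_mult_const)

lemma expand_poly_inf_mult: "expand_poly_inf (p * q) = expand_poly_inf p * expand_poly_inf q"
  by (induction p)
    (simp_all add: expand_poly_inf_0 expand_poly_inf_pCons expand_poly_inf_add
      expand_poly_inf_smult algebra_simps)

lemma expand_poly_inf_nth:
  "fls_nth (expand_poly_inf p) n = (if n \<le> 0 then coeff p (nat (- n)) else 0)"
proof (induction p arbitrary: n)
  case (pCons a p)
  have "nat (- n) = Suc (nat (- n - 1))" if "n < 0"
    using that by simp
  then show ?case
    using pCons.IH[of "n + 1"]
    by (auto simp: expand_poly_inf_pCons fls_X_inv_times_conv_shift coeff_pCons split: nat.split)
qed (simp add: expand_poly_inf_0)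

lemma expand_poly_inf_eq_0_iff: "expand_poly_inf p = 0 \<longleftrightarrow> p = 0"
proof
  assume "expand_poly_inf p = 0"
  then have "coeff p n = 0" for n
    using expand_poly_inf_nth[of p "- int n"] by simp
  then show "p = 0" by (simp add: poly_eq_iff)
qed (simp add: expand_poly_inf_0)

lemma expand_inf_Fract:
  assumes "q \<noteq> 0"
  shows "expand_inf (Fract p q) = expand_poly_inf p / expand_poly_inf q"
proof -
  obtain p' q' where *: "num_den (Fract p q) = (p', q')" "q' \<noteq> 0" "p * q' = p' * q"
    using num_den_Fract[OF assms] by blast
  have "expand_poly_inf p * expand_poly_inf q' = expand_poly_inf p' * expand_poly_inf q"
    using *(3) by (metis expand_poly_inf_mult)
  then show ?thesis
    using * assms by (simp add: expand_inf_def expand_poly_inf_eq_0_iff frac_eq_eq)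
qed

text \<open>On power series in \<open>w = 1 / z\<close>, the substitution \<open>z \<mapsto> z + 1\<close> reads \<open>w \<mapsto> w / (1 + w)\<close>.\<close>

definition shift_fps :: "complex fps \<Rightarrow> complex fps" where
  "shift_fps f = fps_compose f (fps_X * inverse (1 + fps_X))"


section \<open>Rank two bundles on the projective line\<close>

text \<open>A rank two bundle is given as a locally free subsheaf of the constant sheaf with fibre
  \<open>\<complex>(z)\<^sup>2\<close>, that is, by its module of sections over the affine line (free over \<open>\<complex>[z]\<close>, a principal
  ideal domain) and its stalk at infinity; both span \<open>\<complex>(z)\<^sup>2\<close>. Every bundle arises so, by
  trivializing it at the generic point.\<close>

type_synonym vbundle = "(ratfun^2) set \<times> (ratfun^2) set"

definition column_module :: "ratfun set \<Rightarrow> ratmat \<Rightarrow> (ratfun^2) set" where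
  "column_module O' G = {G *v v | v. \<forall>i. v $ i \<in> O'}"

definition affine_frame :: "vbundle \<Rightarrow> ratmat \<Rightarrow> bool" where
  "affine_frame L G \<longleftrightarrow> invertible G \<and> fst L = column_module polys G"

definition inf_frame :: "vbundle \<Rightarrow> ratmat \<Rightarrow> bool" where
  "inf_frame L H \<longleftrightarrow> invertible H \<and> snd L = column_module local_ring_inf H"

definition is_bundle :: "vbundle \<Rightarrow> bool" where
  "is_bundle L \<longleftrightarrow> (\<exists>G. affine_frame L G) \<and> (\<exists>H. inf_frame L H)"

definition bundle_iso :: "ratmat \<Rightarrow> vbundle \<Rightarrow> vbundle \<Rightarrow> bool" where
  "bundle_iso S L L' \<longleftrightarrow>
     invertible S \<and> (*v) S ` fst L = fst L' \<and> (*v) S ` snd L = snd L'"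

text \<open>Stalk at infinity of the line bundle \<open>\<O>(k)\<close>, whose sections may have a pole of order at
  most \<open>k\<close> at infinity.\<close>

definition line_stalk_inf :: "int \<Rightarrow> ratfun set" where
  "line_stalk_inf k = {f. f * Zvar powi (- k) \<in> local_ring_inf}"

definition split_bundle :: "int \<Rightarrow> int \<Rightarrow> vbundle" where
  "split_bundle k l =
     ({v. \<forall>i. v $ i \<in> polys}, {v. v $ 1 \<in> line_stalk_inf k \<and> v $ 2 \<in> line_stalk_inf l})"


section \<open>d-connections and their moduli\<close>

text \<open>The matrix \<open>A\<close> describes \<open>A(z) : L\<^sub>z \<rightarrow> L\<^sub>z\<^sub>+\<^sub>1\<close> with respect to the standard basis of the generic
  fibre \<open>\<complex>(z)\<^sup>2\<close>; with respect to another basis \<open>G\<close> it becomes \<open>G(z + 1)\<inverse> A(z) G(z)\<close>.\<close>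

type_synonym dconn = "vbundle \<times> ratmat"

definition gauge :: "ratmat \<Rightarrow> ratmat \<Rightarrow> ratmat" where
  "gauge G A = matrix_inv (map_matrix shift G) ** A ** G"

record dtype =
  zeros :: "complex list"
  rho1 :: complex
  rho2 :: complex
  dd1 :: complex
  dd2 :: complex
  pord :: nat

definition deg_type :: "dtype \<Rightarrow> complex" where
  "deg_type \<theta> = - dd1 \<theta> - dd2 \<theta> - sum_list (zeros \<theta>)"

definition nondegenerate :: "dtype \<Rightarrow> bool" where
  "nondegenerate \<theta> \<longleftrightarrow>
     length (zeros \<theta>) = 2 * pord \<theta> \<and>
     deg_type \<theta> \<in> \<int> \<and>
     (\<forall>I \<subseteq> {..<length (zeros \<theta>)}.
        - dd1 \<theta> - (\<Sum>i\<in>I. zeros \<theta> ! i) \<notin> \<int> \<and> - dd2 \<theta> - (\<Sum>i\<in>I. zeros \<theta> ! i) \<notin> \<int>) \<and>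
     (\<forall>i < length (zeros \<theta>). \<forall>j < length (zeros \<theta>).
        i \<noteq> j \<longrightarrow> zeros \<theta> ! i - zeros \<theta> ! j \<notin> \<int>) \<and>
     rho1 \<theta> \<noteq> 0 \<and> rho2 \<theta> \<noteq> 0 \<and> rho1 \<theta> \<noteq> rho2 \<theta>"

text \<open>\<open>B\<close> is the matrix of the d-connection in a frame over the affine line: it is regular
  everywhere, its determinant vanishes to first order at the prescribed points and nowhere else.\<close>

definition affine_type :: "dtype \<Rightarrow> ratmat \<Rightarrow> bool" where
  "affine_type \<theta> B \<longleftrightarrow>
     (\<forall>x. (\<forall>i j. B $ i $ j \<in> local_ring x) \<and>
          zero_of_order (det B) x (if x \<in> set (zeros \<theta>) then 1 else 0))"

definition pole_inf :: "nat \<Rightarrow> ratmat \<Rightarrow> bool" where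
  "pole_inf n B \<longleftrightarrow>
     (\<forall>i j. B $ i $ j \<in> line_stalk_inf (int n)) \<and>
     \<not> (\<forall>i j. B $ i $ j \<in> line_stalk_inf (int n - 1))"

definition formal_diag :: "dtype \<Rightarrow> complex fls^2^2" where
  "formal_diag \<theta> =
     (let e = (\<lambda>r d. fls_const r *
                 (fls_X_inv ^ pord \<theta> + fls_const d * fls_X_inv powi (int (pord \<theta>) - 1)))
      in vector [vector [e (rho1 \<theta>) (dd1 \<theta>), 0], vector [0, e (rho2 \<theta>) (dd2 \<theta>)]])"

text \<open>\<open>B\<close> is the matrix of the d-connection in a frame at infinity; a formal trivialization is then
  an invertible matrix of power series in \<open>1 / z\<close>.\<close>

definition formal_type_inf :: "dtype \<Rightarrow> ratmat \<Rightarrow> bool" where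
  "formal_type_inf \<theta> B \<longleftrightarrow>
     (\<exists>R :: complex fps^2^2. fps_nth (det R) 0 \<noteq> 0 \<and>
        matrix_inv (map_matrix (fps_to_fls \<circ> shift_fps) R) ** map_matrix expand_inf B **
          map_matrix fps_to_fls R = formal_diag \<theta>)"

text \<open>The conditions below do not depend on the choice of the frames \<open>G\<close> and \<open>H\<close>.\<close>

definition of_type :: "dtype \<Rightarrow> dconn \<Rightarrow> bool" where
  "of_type \<theta> X \<longleftrightarrow>
     (case X of (L, A) \<Rightarrow>
        is_bundle L \<and> distinct (zeros \<theta>) \<and>
        (\<exists>G. affine_frame L G \<and> affine_type \<theta> (gauge G A)) \<and>
        (\<exists>H. inf_frame L H \<and> pole_inf (pord \<theta>) (gauge H A) \<and> formal_type_inf \<theta> (gauge H A)))"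

definition dconn_iso :: "dconn \<Rightarrow> dconn \<Rightarrow> bool" where
  "dconn_iso X Y \<longleftrightarrow>
     (\<exists>S. bundle_iso S (fst X) (fst Y) \<and> map_matrix shift S ** snd X = snd Y ** S)"

definition iso_rel :: "dtype \<Rightarrow> (dconn \<times> dconn) set" where
  "iso_rel \<theta> = {(X, Y). of_type \<theta> X \<and> of_type \<theta> Y \<and> dconn_iso X Y}"

definition moduli :: "dtype \<Rightarrow> dconn set set" where
  "moduli \<theta> = {X. of_type \<theta> X} // iso_rel \<theta>"

text \<open>A rational isomorphism of bundles is an isomorphism of their generic fibres, so the bundles
  themselves do not enter.\<close>

definition rational_iso :: "ratmat \<Rightarrow> dconn \<Rightarrow> dconn \<Rightarrow> bool" where
  "rational_iso R X' X \<longleftrightarrow> invertible R \<and> map_matrix shift R ** snd X' = snd X ** R"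

definition dPV :: "dtype \<Rightarrow> dtype \<Rightarrow> dconn set \<Rightarrow> dconn set" where
  "dPV \<theta> \<theta>' c = (THE c'. c' \<in> moduli \<theta>' \<and> (\<exists>X\<in>c. \<exists>X'\<in>c'. \<exists>R. rational_iso R X' X))"


section \<open>The Zariski topology on the moduli space\<close>

text \<open>For the types considered, every underlying bundle is isomorphic to \<open>\<O> \<oplus> \<O>(-1)\<close>. The d-connections
  on \<open>\<O> \<oplus> \<O>(-1)\<close> form a locally closed subset of the space of the coefficients of their four
  (polynomial) matrix entries, and the moduli space is its quotient by the automorphisms of the
  bundle.\<close>

definition std_bundle :: vbundle where
  "std_bundle = split_bundle 0 (- 1)"

definition atlas :: "dtype \<Rightarrow> (complex poly^2^2) set" where
  "atlas \<theta> = {B. degree (B $ 1 $ 1) \<le> 2 \<and> degree (B $ 1 $ 2) \<le> 3 \<and>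
                 degree (B $ 2 $ 1) \<le> 1 \<and> degree (B $ 2 $ 2) \<le> 2 \<and>
                 of_type \<theta> (std_bundle, map_matrix of_pol B)}"

inductive_set coeff_functions :: "(complex poly^2^2 \<Rightarrow> complex) set" where
  const: "(\<lambda>B. c) \<in> coeff_functions"
| coeff: "(\<lambda>B. coeff (B $ i $ j) k) \<in> coeff_functions"
| add: "f \<in> coeff_functions \<Longrightarrow> g \<in> coeff_functions \<Longrightarrow> (\<lambda>B. f B + g B) \<in> coeff_functions"
| mult: "f \<in> coeff_functions \<Longrightarrow> g \<in> coeff_functions \<Longrightarrow> (\<lambda>B. f B * g B) \<in> coeff_functions"

definition atlas_top :: "dtype \<Rightarrow> (complex poly^2^2) topology" where
  "atlas_top \<theta> =
     subtopology (topology_generated_by {{B. f B \<noteq> 0} | f. f \<in> coeff_functions}) (atlas \<theta>)"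

definition atlas_class :: "dtype \<Rightarrow> complex poly^2^2 \<Rightarrow> dconn set" where
  "atlas_class \<theta> B = iso_rel \<theta> `` {(std_bundle, map_matrix of_pol B)}"

definition moduli_top :: "dtype \<Rightarrow> dconn set topology" where
  "moduli_top \<theta> = topology (\<lambda>U. U \<subseteq> moduli \<theta> \<and>
     openin (atlas_top \<theta>) {B \<in> atlas \<theta>. atlas_class \<theta> B \<in> U})"

lemma openin_moduli_top:
  "openin (moduli_top \<theta>) U \<longleftrightarrow>
     U \<subseteq> moduli \<theta> \<and> openin (atlas_top \<theta>) {B \<in> atlas \<theta>. atlas_class \<theta> B \<in> U}"
proof -
  let ?pre = "\<lambda>U. {B \<in> atlas \<theta>. atlas_class \<theta> B \<in> U}"
  have inter: "?pre (S \<inter> T) = ?pre S \<inter> ?pre T" for S T by auto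
  have union: "?pre (\<Union>K) = \<Union>(?pre ` K)" for K by auto
  have "istopology (\<lambda>U. U \<subseteq> moduli \<theta> \<and> openin (atlas_top \<theta>) (?pre U))"
    unfolding istopology_def
  proof (intro conjI allI impI)
    fix S T
    assume S: "S \<subseteq> moduli \<theta> \<and> openin (atlas_top \<theta>) (?pre S)"
      and T: "T \<subseteq> moduli \<theta> \<and> openin (atlas_top \<theta>) (?pre T)"
    show "S \<inter> T \<subseteq> moduli \<theta>" using S by auto
    show "openin (atlas_top \<theta>) (?pre (S \<inter> T))"
      unfolding inter using S T by (intro openin_Int) auto
  next
    fix K
    assume K: "\<forall>S\<in>K. S \<subseteq> moduli \<theta> \<and> openin (atlas_top \<theta>) (?pre S)"
    show "\<Union>K \<subseteq> moduli \<theta>" using K by auto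
    show "openin (atlas_top \<theta>) (?pre (\<Union>K))"
      unfolding union using K by (intro openin_Union) auto
  qed
  then show ?thesis
    unfolding moduli_top_def by (simp add: topology_inverse')
qed


section \<open>The coordinates on the moduli space\<close>

datatype proj_point = Fin complex | Infty

text \<open>Value of a section \<open>s\<close> of \<open>\<O>(k)\<close> (a polynomial of degree at most \<open>k\<close>); at infinity the fibre is
  trivialized by the section \<open>z ^ k\<close>.\<close>

fun section_value :: "nat \<Rightarrow> complex poly \<Rightarrow> proj_point \<Rightarrow> complex" where
  "section_value k s (Fin x) = poly s x"
| "section_value k s Infty = coeff s k"

text \<open>The ratio of two elements of a line, undefined if both vanish.\<close>

fun is_ratio :: "proj_point \<Rightarrow> complex \<Rightarrow> complex \<Rightarrow> bool" where
  "is_ratio (Fin y) u v \<longleftrightarrow> v \<noteq> 0 \<and> y = u / v"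
| "is_ratio Infty u v \<longleftrightarrow> u \<noteq> 0 \<and> v = 0"

text \<open>The matrix of a representative of the class \<open>c\<close>, with respect to some isomorphism of
  \<open>\<O> \<oplus> \<O>(-1)\<close> with the underlying bundle.\<close>

definition class_matrix :: "dconn set \<Rightarrow> complex poly^2^2 \<Rightarrow> bool" where
  "class_matrix c B \<longleftrightarrow>
     (\<exists>(L, A) \<in> c. \<exists>S. bundle_iso S std_bundle L \<and> gauge S A = map_matrix of_pol B)"

definition q_coord :: "dconn set \<Rightarrow> proj_point" where
  "q_coord c =
     (THE x. \<exists>B. class_matrix c B \<and> B $ 2 $ 1 \<noteq> 0 \<and> section_value 1 (B $ 2 $ 1) x = 0)"

text \<open>This determines \<open>p\<close> as a rational function. At the points where numerator and denominator both
  vanish the value of \<^term>\<open>p_coord \<theta> c\<close> is unspecified (no value satisfies the description); the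
  regular extension of \<open>p\<close> to these points is not needed.\<close>

definition p_coord :: "dtype \<Rightarrow> dconn set \<Rightarrow> proj_point" where
  "p_coord \<theta> c =
     (THE y. \<exists>B. class_matrix c B \<and>
        is_ratio y (section_value 2 (B $ 1 $ 1) (q_coord c))
          (section_value 2 ([:- (zeros \<theta> ! 2), 1:] * [:- (zeros \<theta> ! 3), 1:]) (q_coord c)))"

end

theory Submission
  imports Defs "HOL-Computational_Algebra.Fundamental_Theorem_Algebra"
begin

text \<open>The formal type at infinity depends only on the two leading coefficients of the trace and the
  determinant of the matrix of the d-connection. With Birkhoff's splitting theorem and
  nondegeneracy this identifies \<open>M\<^sub>\<theta>\<close> with explicit polynomial matrices modulo the automorphisms of
  \<open>\<O> \<oplus> \<O>(-1)\<close>. For finite \<open>q\<close> a class is represented by \<open>[[u, b\<^sub>1\<^sub>2], [z - q, b\<^sub>2\<^sub>2]]\<close> with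
  \<open>u b\<^sub>2\<^sub>2(q) = \<rho>\<^sub>1 \<rho>\<^sub>2 \<Prod> (q - a\<^sub>i)\<close>, and the modification at \<open>a\<^sub>1, a\<^sub>2\<close> can be written down explicitly.
  A rational isomorphism between two d-connections of the same type is an isomorphism, so this
  modification is the value of \<open>dPV\<close>. Density of the set where the formulas make sense follows by
  approximating in the classical topology.\<close>

text \<open>\<open>dPV\<close>, \<open>q_coord\<close> and \<open>p_coord\<close> are definite
  descriptions, so uniqueness has to be settled before any formula can be evaluated; this is why the
  automorphisms of the bundle and the rational isomorphisms between d-connections of one type are
  determined completely. Two coefficients suffice at infinity because w / (1 + w) = w - w^2 + ...:
  the shift fixes the coefficients of order 0 and 1, and it sends w^n to w^n - n w^(n+1) + ...,
  where the factor n is invertible for n > 0 and lets formal eigenvectors be computed recursively.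
  The same effect forces an intertwiner of order N at infinity to satisfy N = 0. Nondegeneracy
  enters twice: the condition on the d_j keeps the lower left entry from vanishing, which leaves O +
  O(-1) as the only bundle, and the condition on differences of zeros stops the poles of a rational
  isomorphism. The curves used for density must stay in the atlas exactly and not only to first
  order; they are therefore written down on the surface u y = P(q), or solved for explicitly near q
  = infinity.\<close>

no_notation fps_nth (infixl \<open>$\<close> 75)

abbreviation lsi :: "int \<Rightarrow> ratfun set" where
  "lsi \<equiv> line_stalk_inf"

subsection \<open>Rational functions and the shift\<close>

lemma Fract_nz_cases:
  obtains p q where "r = Fract p q" "q \<noteq> 0"
  by (cases r rule: Fract_cases) auto

lemma of_pol_eq_iff [simp]: "of_pol p = of_pol q \<longleftrightarrow> p = q"
  by (simp add: eq_fract)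

lemma Fract_eq_0_iff: "q \<noteq> 0 \<Longrightarrow> Fract p q = 0 \<longleftrightarrow> p = 0"
  by (simp add: Zero_fract_def eq_fract)

lemma of_pol_eq_0_iff [simp]: "of_pol p = 0 \<longleftrightarrow> p = 0"
  by (simp add: Fract_eq_0_iff)

lemma of_pol_1 [simp]: "of_pol 1 = 1"
  by (simp add: One_fract_def)

lemma of_pol_eq_1_iff [simp]: "of_pol p = 1 \<longleftrightarrow> p = 1"
  by (metis of_pol_1 of_pol_eq_iff)

lemma of_pol_0 [simp]: "of_pol 0 = 0"
  by simp

lemma Fract_eq_divide: "q \<noteq> 0 \<Longrightarrow> Fract p q = of_pol p / of_pol q"
  by simp

lemma shift_of_pol [simp]: "shift (of_pol p) = of_pol (pcompose p [:1, 1:])"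
  by (simp add: shift_Fract pcompose_1)

lemma pcompose_shift_eq_0_iff [simp]: "pcompose p [:1, 1:] = 0 \<longleftrightarrow> p = (0 :: complex poly)"
  by (simp add: pcompose_eq_0_iff)

lemma shift_add [simp]: "shift (r + s) = shift r + shift s"
  by (cases r rule: Fract_nz_cases, cases s rule: Fract_nz_cases)
    (simp add: shift_Fract pcompose_add pcompose_mult)

lemma shift_mult [simp]: "shift (r * s) = shift r * shift s"
  by (cases r rule: Fract_nz_cases, cases s rule: Fract_nz_cases)
    (simp add: shift_Fract pcompose_mult)

lemma shift_uminus [simp]: "shift (- r) = - shift r"
  by (cases r rule: Fract_nz_cases) (simp add: shift_Fract pcompose_uminus)

lemma shift_diff [simp]: "shift (r - s) = shift r - shift s"
  using shift_add[of r "- s"] by (simp del: shift_add)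

lemma shift_0 [simp]: "shift 0 = 0"
  using shift_of_pol[of 0] by (simp del: shift_of_pol)

lemma shift_1 [simp]: "shift 1 = 1"
  using shift_of_pol[of 1] by (simp add: pcompose_1 del: shift_of_pol)

lemma shift_inverse [simp]: "shift (inverse r) = inverse (shift r)"
  by (metis inverse_eq_iff_eq inverse_zero nonzero_inverse_eq_divide nonzero_eq_divide_eq
      left_inverse shift_0 shift_1 shift_mult inverse_unique mult.commute)

lemma shift_divide [simp]: "shift (r / s) = shift r / shift s"
  by (simp add: divide_inverse)

lemma shift_eq_0_iff [simp]: "shift r = 0 \<longleftrightarrow> r = 0"
proof
  assume "shift r = 0"
  then have "shift (r * inverse r) = 0" by simp
  then show "r = 0" by (metis right_inverse shift_1 zero_neq_one)
qed simp

subsection \<open>Polynomials and local rings\<close>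

lemma of_pol_in_polys [simp]: "of_pol p \<in> polys"
  by (simp add: polys_def)

lemma polysE: "r \<in> polys \<Longrightarrow> (\<And>p. r = of_pol p \<Longrightarrow> P) \<Longrightarrow> P"
  by (auto simp: polys_def)

lemma polys_0 [simp]: "0 \<in> polys" and polys_1 [simp]: "1 \<in> polys"
  by (metis of_pol_in_polys of_pol_0, metis of_pol_in_polys of_pol_1)

lemma polys_add: "r \<in> polys \<Longrightarrow> s \<in> polys \<Longrightarrow> r + s \<in> polys"
  and polys_mult: "r \<in> polys \<Longrightarrow> s \<in> polys \<Longrightarrow> r * s \<in> polys"
  and polys_uminus: "r \<in> polys \<Longrightarrow> - r \<in> polys"
  by (auto simp: polys_def)

lemma shift_in_polys: "r \<in> polys \<Longrightarrow> shift r \<in> polys"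
  by (auto simp: polys_def)

lemma polys_unit:
  assumes "r \<in> polys" "s \<in> polys" "r * s = 1"
  obtains c where "c \<noteq> 0" "r = of_pol [:c:]"
proof -
  from assms obtain p q where pq: "r = of_pol p" "s = of_pol q" by (auto simp: polys_def)
  with assms(3) have "p * q = 1" by simp
  then have "p dvd 1" by (metis dvd_triv_left)
  then obtain c where c: "p = [:c:]" "c dvd 1" by (auto simp: is_unit_poly_iff)
  then have "c \<noteq> 0" by auto
  with that pq c show thesis by blast
qed

lemma local_ring_Fract: "poly q x \<noteq> 0 \<Longrightarrow> Fract p q \<in> local_ring x"
  by (auto simp: local_ring_def)

lemma local_ringE:
  assumes "r \<in> local_ring x"
  obtains p q where "r = Fract p q" "poly q x \<noteq> 0" "q \<noteq> 0"
  using assms by (force simp: local_ring_def)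

lemma local_ring_of_pol [simp]: "of_pol p \<in> local_ring x"
  by (rule local_ring_Fract) simp

lemma polys_in_local_ring: "r \<in> polys \<Longrightarrow> r \<in> local_ring x"
  by (auto simp: polys_def)

lemma local_ring_0 [simp]: "0 \<in> local_ring x"
  using local_ring_of_pol[of 0 x] by simp

lemma local_ring_add: "r \<in> local_ring x \<Longrightarrow> s \<in> local_ring x \<Longrightarrow> r + s \<in> local_ring x"
  by (elim local_ringE) (auto intro!: local_ring_Fract)

lemma local_ring_mult: "r \<in> local_ring x \<Longrightarrow> s \<in> local_ring x \<Longrightarrow> r * s \<in> local_ring x"
  by (elim local_ringE) (auto intro!: local_ring_Fract)

lemma local_ring_inverse_of_pol: "poly p x \<noteq> 0 \<Longrightarrow> inverse (of_pol p) \<in> local_ring x"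
  by (auto intro!: local_ring_Fract)

lemma local_ring_shift_iff: "shift r \<in> local_ring x \<longleftrightarrow> r \<in> local_ring (x + 1)"
proof
  assume "r \<in> local_ring (x + 1)"
  then obtain p q where "r = Fract p q" "poly q (x + 1) \<noteq> 0" "q \<noteq> 0" by (elim local_ringE)
  then show "shift r \<in> local_ring x"
    by (auto simp: shift_Fract poly_pcompose add.commute intro!: local_ring_Fract)
next
  assume "shift r \<in> local_ring x"
  then obtain p q where pq: "shift r = Fract p q" "poly q x \<noteq> 0" "q \<noteq> 0" by (elim local_ringE)
  obtain p' q' where r: "r = Fract p' q'" "q' \<noteq> 0" by (rule Fract_nz_cases)
  \<comment> \<open>Composing the cross-multiplied identity with z - 1, the inverse substitution,
    recovers r from its shift.\<close>
  have inv: "pcompose (pcompose s [:-1, 1:]) [:1, 1:] = s \<and> pcompose (pcompose s [:1, 1:]) [:-1, 1:] = s"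
    for s :: "complex poly"
    by (simp flip: pcompose_assoc add: pcompose_pCons)
  have "pcompose p' [:1,1:] * q = p * pcompose q' [:1,1:]"
    using pq r by (simp add: shift_Fract eq_fract)
  then have "pcompose (pcompose p' [:1,1:] * q) [:-1,1:] = pcompose (p * pcompose q' [:1,1:]) [:-1,1:]"
    by simp
  then have eq: "p' * pcompose q [:-1,1:] = pcompose p [:-1,1:] * q'"
    by (simp add: pcompose_mult inv)
  have "pcompose q [:-1,1:] \<noteq> 0"
    using pq(3) inv[of q] by force
  with eq r have "r = Fract (pcompose p [:-1,1:]) (pcompose q [:-1,1:])"
    by (simp add: eq_fract)
  moreover have "poly (pcompose q [:-1,1:]) (x + 1) \<noteq> 0"
    using pq(2) by (simp add: poly_pcompose)
  ultimately show "r \<in> local_ring (x + 1)" by (auto intro: local_ring_Fract)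
qed

lemma finite_not_local_ring: "finite {x. r \<notin> local_ring x}"
proof -
  obtain p q where r: "r = Fract p q" "q \<noteq> 0" by (rule Fract_nz_cases)
  have "{x. r \<notin> local_ring x} \<subseteq> {x. poly q x = 0}"
    using r by (auto intro: local_ring_Fract)
  then show ?thesis using poly_roots_finite[OF r(2)] finite_subset by blast
qed

text \<open>In a representation with denominator of least degree, a root of the denominator would
  also be a root of the numerator by regularity there, and could be cancelled. So the denominator
  has no root and is constant.\<close>

lemma polys_if_regular:
  assumes "\<And>x. r \<in> local_ring x"
  shows "r \<in> polys"
proof -
  obtain pq where "r = Fract (fst pq) (snd pq) \<and> snd pq \<noteq> 0"
    by (metis Fract_nz_cases fst_conv snd_conv)
  then have "\<exists>x. (r = Fract (fst x) (snd x) \<and> snd x \<noteq> 0) \<and>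
      (\<forall>y. r = Fract (fst y) (snd y) \<and> snd y \<noteq> 0 \<longrightarrow> degree (snd x) \<le> degree (snd y))"
    by (rule ex_has_least_nat)
  then obtain p q where r: "r = Fract p q" "q \<noteq> 0"
    and least: "\<And>p' q'. r = Fract p' q' \<Longrightarrow> q' \<noteq> 0 \<Longrightarrow> degree q \<le> degree q'"
    by (metis fst_conv snd_conv)
  have "poly q x \<noteq> 0" for x
  proof
    assume 0: "poly q x = 0"
    obtain p' q' where *: "r = Fract p' q'" "poly q' x \<noteq> 0" "q' \<noteq> 0"
      using assms[of x] by (elim local_ringE)
    then have "p * q' = p' * q" using r by (simp add: eq_fract)
    then have "poly p x * poly q' x = poly p' x * poly q x" by (metis poly_mult)
    then have "poly p x = 0" using 0 * by simp
    with 0 obtain u v where uv: "p = [:- x, 1:] * u" "q = [:- x, 1:] * v"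
      by (metis poly_eq_0_iff_dvd dvdE)
    then have "v \<noteq> 0" using r by auto
    have "[:- x, 1:] \<noteq> 0" by simp
    then have "Fract ([:- x, 1:] * u) ([:- x, 1:] * v) = Fract u v" by (rule mult_fract_cancel)
    then have "r = Fract u v" using r(1) uv by metis
    then have "degree q \<le> degree v" using least[of u v] \<open>v \<noteq> 0\<close> by simp
    moreover have "degree q = Suc (degree v)"
      unfolding uv(2) using \<open>v \<noteq> 0\<close> by (subst degree_mult_eq) auto
    ultimately show False by simp
  qed
  then have "degree q = 0" using fundamental_theorem_of_algebra constant_degree by blast
  then obtain c where "q = [:c:]" using degree_eq_zeroE by blast
  with r have "r = of_pol (smult (inverse c) p)" by (simp add: eq_fract)
  then show ?thesis by simp
qed

subsection \<open>The filtration at infinity\<close>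

lemma local_ring_inf_Fract:
  assumes "q \<noteq> 0"
  shows "Fract p q \<in> local_ring_inf \<longleftrightarrow> p = 0 \<or> degree p \<le> degree q"
proof
  assume "Fract p q \<in> local_ring_inf"
  then obtain p' q' where *: "Fract p q = Fract p' q'" "q' \<noteq> 0" "degree p' \<le> degree q'"
    by (auto simp: local_ring_inf_def)
  then have eq: "p * q' = p' * q" using assms by (simp add: eq_fract)
  show "p = 0 \<or> degree p \<le> degree q"
  proof (cases "p = 0")
    case False
    then have "p' \<noteq> 0" using eq * by auto
    then have "degree p + degree q' = degree p' + degree q"
      using False assms * eq by (metis degree_mult_eq)
    with * show ?thesis by simp
  qed simp
next
  assume "p = 0 \<or> degree p \<le> degree q"
  then have "degree p \<le> degree q" by auto
  with assms show "Fract p q \<in> local_ring_inf" unfolding local_ring_inf_def by blast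
qed

lemma Zvar_nonzero [simp]: "Zvar \<noteq> 0"
  by simp

lemma Zvar_power: "Zvar ^ n = of_pol (monom 1 n)"
  by (induction n) (simp_all add: monom_Suc)

text \<open>Order at infinity as a comparison of degrees. The case p = 0 is separate because the
  zero polynomial has degree 0 but lies in every \<open>lsi k\<close>.\<close>

lemma lsi_Fract:
  assumes "q \<noteq> 0"
  shows "Fract p q \<in> lsi k \<longleftrightarrow> p = 0 \<or> int (degree p) \<le> int (degree q) + k"
proof (cases "k \<ge> 0")
  case True
  then obtain n where k: "k = int n" using nonneg_int_cases by blast
  have "Fract p q * Zvar powi (- k) = Fract p (q * monom 1 n)"
    using k by (simp add: power_int_minus Zvar_power del: minus_fract)
  then show ?thesis
    unfolding line_stalk_inf_def using assms k
    by (simp add: local_ring_inf_Fract degree_mult_eq degree_monom_eq) linarith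
next
  case False
  then obtain n where k: "k = - int n" by (metis linear nonneg_int_cases add.inverse_inverse neg_le_0_iff_le)
  have "Fract p q * Zvar powi (- k) = Fract (p * monom 1 n) q"
    using k by (simp add: Zvar_power)
  moreover have "0 \<in> local_ring_inf"
    using local_ring_inf_Fract[of 1 0] by (simp flip: Zero_fract_def)
  ultimately show ?thesis
    unfolding line_stalk_inf_def using assms k
    by (cases "p = 0") (auto simp add: local_ring_inf_Fract degree_mult_eq degree_monom_eq)
qed

lemma lsi_of_pol: "of_pol p \<in> lsi k \<longleftrightarrow> p = 0 \<or> int (degree p) \<le> k"
  by (simp add: lsi_Fract)

lemma lsi_0_eq: "lsi 0 = local_ring_inf"
  by (simp add: line_stalk_inf_def)

lemma lsi_zero [simp]: "0 \<in> lsi k"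
  using lsi_of_pol[of 0 k] by simp

lemma lsi_one [simp]: "1 \<in> lsi 0"
  using lsi_of_pol[of 1 0] by simp

lemma lsi_add: assumes "r \<in> lsi k" "s \<in> lsi k" shows "r + s \<in> lsi k"
proof -
  obtain p q where r: "r = Fract p q" "q \<noteq> 0" by (rule Fract_nz_cases)
  obtain p' q' where s: "s = Fract p' q'" "q' \<noteq> 0" by (rule Fract_nz_cases)
  have 1: "p = 0 \<or> int (degree p) \<le> int (degree q) + k" "p' = 0 \<or> int (degree p') \<le> int (degree q') + k"
    using assms r s by (simp_all add: lsi_Fract)
  then have 2: "p * q' = 0 \<or> int (degree (p * q')) \<le> int (degree (q * q')) + k"
    "p' * q = 0 \<or> int (degree (p' * q)) \<le> int (degree (q * q')) + k"
    using r s by (cases "p = 0"; cases "p' = 0"; simp add: degree_mult_eq)+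
  have "p * q' + p' * q = 0 \<or> int (degree (p * q' + p' * q)) \<le> int (degree (q * q')) + k"
    using 2 degree_add_le_max[of "p * q'" "p' * q"] by (cases "p * q' = 0"; cases "p' * q = 0") auto
  then show ?thesis using r s by (simp add: lsi_Fract)
qed

lemma lsi_uminus: "r \<in> lsi k \<Longrightarrow> - r \<in> lsi k"
  by (cases r rule: Fract_nz_cases) (simp add: lsi_Fract)

lemma lsi_diff: "r \<in> lsi k \<Longrightarrow> s \<in> lsi k \<Longrightarrow> r - s \<in> lsi k"
  using lsi_add[of r k "- s"] lsi_uminus by simp

lemma lsi_mult: assumes "r \<in> lsi k" "s \<in> lsi l" shows "r * s \<in> lsi (k + l)"
proof -
  obtain p q where r: "r = Fract p q" "q \<noteq> 0" by (rule Fract_nz_cases)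
  obtain p' q' where s: "s = Fract p' q'" "q' \<noteq> 0" by (rule Fract_nz_cases)
  show ?thesis using assms r s
    by (cases "p = 0"; cases "p' = 0") (simp_all add: lsi_Fract degree_mult_eq)
qed

lemma lsi_mult': "r \<in> lsi k \<Longrightarrow> s \<in> lsi l \<Longrightarrow> m = k + l \<Longrightarrow> r * s \<in> lsi m"
  using lsi_mult by blast

lemma lsi_mono: "r \<in> lsi k \<Longrightarrow> k \<le> l \<Longrightarrow> r \<in> lsi l"
  by (cases r rule: Fract_nz_cases) (auto simp: lsi_Fract)

lemma lsi_Zvar_powi: "Zvar powi k \<in> lsi k"
proof -
  have "Zvar powi k * Zvar powi (- k) = 1"
    by (simp add: power_int_minus del: mult_fract inverse_fract)
  then show ?thesis using lsi_one by (simp only: line_stalk_inf_def mem_Collect_eq) simp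
qed

lemma lsi_const [simp]: "of_pol [:c:] \<in> lsi 0"
  by (simp add: lsi_of_pol)

lemma lsi_const_neg: "of_pol [:c:] \<in> lsi (-1) \<longleftrightarrow> c = 0"
  by (simp add: lsi_of_pol)

lemma lsi_Zvar_mult: "r * Zvar powi l \<in> lsi k \<longleftrightarrow> r \<in> lsi (k - l)"
proof
  assume "r * Zvar powi l \<in> lsi k"
  then have "r * Zvar powi l * Zvar powi (- l) \<in> lsi (k + - l)"
    by (rule lsi_mult[OF _ lsi_Zvar_powi])
  moreover have "r * Zvar powi l * Zvar powi (- l) = r"
    by (simp add: mult.assoc flip: power_int_add)
  ultimately show "r \<in> lsi (k - l)" by simp
next
  assume "r \<in> lsi (k - l)"
  then show "r * Zvar powi l \<in> lsi k" using lsi_mult[OF _ lsi_Zvar_powi[of l]] by fastforce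
qed

lemma lsi_exists: obtains n :: nat where "r \<in> lsi (int n)"
proof -
  obtain p q where "r = Fract p q" "q \<noteq> 0" by (rule Fract_nz_cases)
  then have "r \<in> lsi (int (degree p))" by (simp add: lsi_Fract)
  then show thesis by (rule that)
qed

text \<open>Makes descent on the order at infinity terminate: for the determinant in
  \<open>birkhoff\<close>, for a nonzero entry in \<open>intertwiner_regular_inf\<close>.\<close>

lemma lsi_lower_bound: assumes "r \<noteq> 0" obtains k where "\<And>l. r \<in> lsi l \<Longrightarrow> k \<le> l"
proof -
  obtain p q where r: "r = Fract p q" "q \<noteq> 0" by (rule Fract_nz_cases)
  then have "p \<noteq> 0" using assms by (auto simp: Fract_eq_0_iff)
  then have "r \<in> lsi l \<Longrightarrow> int (degree p) - int (degree q) \<le> l" for l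
    using r by (simp add: lsi_Fract)
  then show thesis by (rule that)
qed

lemma lsi_inverse:
  assumes "r \<in> lsi k" "r \<notin> lsi (k - 1)"
  shows "inverse r \<in> lsi (- k)"
proof -
  obtain p q where r: "r = Fract p q" "q \<noteq> 0" by (rule Fract_nz_cases)
  then have "p \<noteq> 0" using assms(2) Fract_eq_0_iff lsi_zero by metis
  then show ?thesis using r assms by (auto simp: lsi_Fract)
qed

lemma lsi_shift_iff [simp]: "shift r \<in> lsi k \<longleftrightarrow> r \<in> lsi k"
  by (cases r rule: Fract_nz_cases) (simp add: shift_Fract lsi_Fract degree_pcompose)

lemma lsi_leading:
  assumes "r \<in> lsi 0"
  obtains c where "r - of_pol [:c:] \<in> lsi (-1)"
proof -
  obtain p q where r: "r = Fract p q" "q \<noteq> 0" by (rule Fract_nz_cases)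
  define n where "n = degree q"
  define c where "c = coeff p n / lead_coeff q"
  have "degree p \<le> n" using assms r by (auto simp: lsi_Fract n_def)
  then have deg: "degree (p - smult c q) \<le> n"
    by (intro degree_diff_le) (auto simp: n_def degree_smult_le)
  have "coeff (p - smult c q) n = 0" using r by (simp add: c_def n_def)
  with deg have "p - smult c q = 0 \<or> degree (p - smult c q) < n"
    by (metis leading_coeff_0_iff le_neq_implies_less)
  moreover have "r - of_pol [:c:] = Fract (p - smult c q) q" using r by simp
  ultimately have "r - of_pol [:c:] \<in> lsi (-1)" using r by (auto simp: lsi_Fract n_def)
  then show thesis by (rule that)
qed

lemma degree_pcompose_shift_diff:
  fixes p :: "complex poly"
  shows "pcompose p [:1, 1:] - p = 0 \<or> degree (pcompose p [:1, 1:] - p) < degree p"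
proof -
  have "degree (pcompose p [:1, 1:] - p) \<le> degree p"
    by (intro degree_diff_le) (auto simp: degree_pcompose)
  moreover have "coeff (pcompose p [:1, 1:] - p) (degree p) = 0"
    using lead_coeff_comp[of "[:1,1:] :: complex poly" p] by (simp add: degree_pcompose)
  ultimately show ?thesis by (metis leading_coeff_0_iff le_neq_implies_less)
qed

text \<open>A polynomial and its shift have the same leading term, so their difference drops a
  degree. Quotients follow from the quotient rule for differences, which is
  \<open>quot\<close>.\<close>

lemma lsi_shift_diff:
  assumes "r \<in> lsi k"
  shows "shift r - r \<in> lsi (k - 1)"
proof -
  have quot: "(Q * (P' - P) - P * (Q' - Q)) * inverse (Q * Q') = P' / Q' - P / Q"
    if "Q \<noteq> 0" "Q' \<noteq> 0" for P P' Q Q' :: ratfun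
    using that by (simp add: divide_simps) (simp add: algebra_simps)
  obtain p q where r: "r = Fract p q" "q \<noteq> 0" by (rule Fract_nz_cases)
  have diff: "of_pol (pcompose p [:1,1:]) - of_pol p \<in> lsi (int (degree p) - 1)" for p :: "complex poly"
  proof -
    have "of_pol (pcompose p [:1,1:] - p) \<in> lsi (int (degree p) - 1)"
      unfolding lsi_of_pol using degree_pcompose_shift_diff[of p] by auto
    then show ?thesis by simp
  qed
  show ?thesis
  proof (cases "p = 0")
    case False
    let ?Q = "of_pol q" and ?P = "of_pol p"
    have nz: "?Q \<noteq> 0" "shift ?Q \<noteq> 0" using r by auto
    have k: "int (degree p) - int (degree q) \<le> k" using assms r False by (simp add: lsi_Fract)
    have inv: "inverse (?Q * shift ?Q) \<in> lsi (- 2 * int (degree q))"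
      using r by (simp add: lsi_Fract degree_mult_eq degree_pcompose)
    have "?Q * (shift ?P - ?P) - ?P * (shift ?Q - ?Q) \<in> lsi (int (degree q) + (int (degree p) - 1))"
    proof (intro lsi_diff)
      show "?Q * (shift ?P - ?P) \<in> lsi (int (degree q) + (int (degree p) - 1))"
        using diff[of p] by (intro lsi_mult) (simp_all add: lsi_of_pol del: diff_fract)
      show "?P * (shift ?Q - ?Q) \<in> lsi (int (degree q) + (int (degree p) - 1))"
        using diff[of q] by (intro lsi_mult'[of _ "degree p" _ "int (degree q) - 1"]) (simp_all add: lsi_of_pol del: diff_fract)
    qed
    then have "(?Q * (shift ?P - ?P) - ?P * (shift ?Q - ?Q)) * inverse (?Q * shift ?Q)
        \<in> lsi (int (degree q) + (int (degree p) - 1) + - 2 * int (degree q))"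
      using inv by (rule lsi_mult)
    then have "(?Q * (shift ?P - ?P) - ?P * (shift ?Q - ?Q)) * inverse (?Q * shift ?Q) \<in> lsi (k - 1)"
      by (rule lsi_mono) (use k in simp)
    moreover have "(?Q * (shift ?P - ?P) - ?P * (shift ?Q - ?Q)) * inverse (?Q * shift ?Q)
        = shift (?P / ?Q) - ?P / ?Q"
      unfolding shift_divide using nz by (rule quot)
    ultimately show ?thesis unfolding r(1) Fract_eq_divide[OF r(2), of p] by metis
  qed (use r in \<open>simp add: fract_collapse\<close>)
qed

text \<open>The shift is tangent to the identity to second order at infinity, since \<open>w \<mapsto> w / (1 + w)\<close> is.\<close>

lemma lsi_shift_diff_0:
  assumes "r \<in> lsi 0"
  shows "shift r - r \<in> lsi (- 2)"
proof -
  obtain c where "r - of_pol [:c:] \<in> lsi (-1)" using lsi_leading[OF assms] .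
  then have "shift (r - of_pol [:c:]) - (r - of_pol [:c:]) \<in> lsi (-1 - 1)" by (rule lsi_shift_diff)
  then show ?thesis by (simp add: pcompose_pCons del: diff_fract)
qed

subsection \<open>Expansion at infinity\<close>

lemma expand_poly_inf_1 [simp]: "expand_poly_inf 1 = 1"
  by (simp add: one_pCons expand_poly_inf_pCons expand_poly_inf_0)

lemma expand_inf_add [simp]: "expand_inf (r + s) = expand_inf r + expand_inf s"
  by (cases r rule: Fract_nz_cases, cases s rule: Fract_nz_cases)
    (simp add: expand_inf_Fract expand_poly_inf_add expand_poly_inf_mult expand_poly_inf_eq_0_iff
      add_frac_eq)

lemma expand_inf_mult [simp]: "expand_inf (r * s) = expand_inf r * expand_inf s"
  by (cases r rule: Fract_nz_cases, cases s rule: Fract_nz_cases)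
    (simp add: expand_inf_Fract expand_poly_inf_mult)

lemma expand_inf_of_pol: "expand_inf (of_pol p) = expand_poly_inf p"
  by (simp add: expand_inf_Fract)

lemma expand_inf_uminus [simp]: "expand_inf (- r) = - expand_inf r"
proof -
  have "expand_inf (of_pol (-1)) = -1"
    unfolding expand_inf_of_pol by (simp add: one_pCons expand_poly_inf_pCons expand_poly_inf_0 fls_const_uminus flip: fls_const_1)
  then show ?thesis using expand_inf_mult[of "of_pol (-1)" r]
    by (simp flip: One_fract_def minus_fract del: expand_inf_mult)
qed

lemma expand_inf_diff [simp]: "expand_inf (r - s) = expand_inf r - expand_inf s"
  using expand_inf_add[of r "- s"] by (simp del: expand_inf_add)

lemma expand_inf_const: "expand_inf (of_pol [:c:]) = fls_const c"
  by (simp add: expand_inf_of_pol expand_poly_inf_pCons expand_poly_inf_0)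

lemma expand_inf_0 [simp]: "expand_inf 0 = 0"
  using expand_inf_const[of 0] by simp

lemma expand_inf_1 [simp]: "expand_inf 1 = 1"
  using expand_inf_const[of 1] by (simp flip: One_fract_def one_pCons)

lemma expand_inf_Zvar: "expand_inf Zvar = fls_X_inv"
  by (simp add: expand_inf_of_pol expand_poly_inf_pCons expand_poly_inf_0)

lemma fls_subdegree_expand_poly_inf:
  assumes "p \<noteq> 0" shows "fls_subdegree (expand_poly_inf p) = - int (degree p)"
  by (rule fls_subdegree_eqI) (use assms in \<open>auto simp: expand_poly_inf_nth coeff_eq_0\<close>)

lemma lsi_expand: "r \<in> lsi k \<longleftrightarrow> expand_inf r = 0 \<or> - k \<le> fls_subdegree (expand_inf r)"
proof -
  obtain p q where r: "r = Fract p q" "q \<noteq> 0" by (rule Fract_nz_cases)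
  then have "p \<noteq> 0 \<Longrightarrow> fls_subdegree (expand_inf r) = int (degree q) - int (degree p)"
    by (simp add: expand_inf_Fract fls_subdegree_expand_poly_inf expand_poly_inf_eq_0_iff fls_divide_subdegree)
  moreover have "expand_inf r = 0 \<longleftrightarrow> p = 0"
    using r by (simp add: expand_inf_Fract expand_poly_inf_eq_0_iff)
  ultimately show ?thesis using r by (auto simp: lsi_Fract)
qed

lemma lsi_expand_nth: "r \<in> lsi k \<longleftrightarrow> (\<forall>n < - k. fls_nth (expand_inf r) n = 0)"
  unfolding lsi_expand
  by (metis fls_eq0_below_subdegree fls_subdegree_geI fls_zero_nth less_le_trans)

subsection \<open>Two by two matrices\<close>

definition mk2 :: "'a::zero \<Rightarrow> 'a \<Rightarrow> 'a \<Rightarrow> 'a \<Rightarrow> 'a^2^2" where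
  "mk2 a b c d = vector [vector [a, b], vector [c, d]]"

lemma mk2_nth [simp]:
  "mk2 a b c d $ 1 $ 1 = a" "mk2 a b c d $ 1 $ 2 = b" "mk2 a b c d $ 2 $ 1 = c" "mk2 a b c d $ 2 $ 2 = d"
  by (simp_all add: mk2_def)

lemma mat2_eq_iff:
  "A = B \<longleftrightarrow> A $ 1 $ 1 = B $ 1 $ 1 \<and> A $ 1 $ 2 = B $ 1 $ 2 \<and> A $ 2 $ 1 = B $ 2 $ 1 \<and> A $ 2 $ 2 = (B $ 2 $ 2 :: 'a)"
  for A B :: "'a^2^2"
  by (auto simp: vec_eq_iff forall_2)

lemma mult2_nth:
  "(A ** B) $ i $ j = A $ i $ 1 * B $ 1 $ j + A $ i $ 2 * B $ 2 $ j"
  for A B :: "'a::semiring_1^2^2"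
  by (simp add: matrix_matrix_mult_def sum_2)

lemma mat1_2 [simp]:
  "(mat 1 :: 'a::semiring_1^2^2) $ 1 $ 1 = 1" "(mat 1 :: 'a^2^2) $ 1 $ 2 = 0"
  "(mat 1 :: 'a^2^2) $ 2 $ 1 = 0" "(mat 1 :: 'a^2^2) $ 2 $ 2 = 1"
  by (simp_all add: mat_def)

text \<open>Replaces the inverse over power series: R times its adjugate is det R times the
  identity, which is enough to compare traces.\<close>

definition adj2 :: "'a::comm_ring_1^2^2 \<Rightarrow> 'a^2^2" where
  "adj2 A = mk2 (A $ 2 $ 2) (- A $ 1 $ 2) (- A $ 2 $ 1) (A $ 1 $ 1)"

lemma adj2_nth [simp]:
  "adj2 A $ 1 $ 1 = A $ 2 $ 2" "adj2 A $ 1 $ 2 = - A $ 1 $ 2"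
  "adj2 A $ 2 $ 1 = - A $ 2 $ 1" "adj2 A $ 2 $ 2 = A $ 1 $ 1"
  by (simp_all add: adj2_def)

lemma matrix_inv_mult:
  fixes A :: "'a::field^'n^'n"
  assumes "invertible A"
  shows "matrix_inv A ** A = mat 1" "A ** matrix_inv A = mat 1"
  using someI_ex[OF assms[unfolded invertible_def]] by (auto simp: matrix_inv_def)

lemma invertible_matrix_inv:
  fixes A :: "'a::field^'n^'n"
  assumes "invertible A"
  shows "invertible (matrix_inv A)"
  using matrix_inv_mult[OF assms] unfolding invertible_def by blast

lemma matrix_inv_unique:
  fixes A B :: "'a::field^'n^'n"
  assumes "A ** B = mat 1"
  shows "matrix_inv A = B" "invertible A"
proof -
  have BA: "B ** A = mat 1" using assms matrix_left_right_inverse by blast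
  then show inv: "invertible A" using assms unfolding invertible_def by blast
  show "matrix_inv A = B"
    by (metis assms matrix_inv_mult(1)[OF inv] matrix_mul_assoc matrix_mul_lid matrix_mul_rid)
qed

lemma matrix_cancel_right:
  fixes A B C :: "'a::field^'n^'n"
  assumes "invertible A"
  shows "B ** A = C ** A \<longleftrightarrow> B = C"
  by (metis assms matrix_inv_mult(2) matrix_mul_assoc matrix_mul_rid)

lemma matrix_inv_left_eq_iff:
  fixes A B C :: "'a::field^'n^'n"
  assumes "invertible A"
  shows "matrix_inv A ** B = C \<longleftrightarrow> B = A ** C"
  by (metis assms matrix_inv_mult matrix_mul_assoc matrix_mul_lid)

lemma matrix_inv_2:
  fixes A :: "'a::field^2^2"
  assumes "invertible A"
  shows "matrix_inv A = mk2 (A $ 2 $ 2 / det A) (- A $ 1 $ 2 / det A) (- A $ 2 $ 1 / det A) (A $ 1 $ 1 / det A)"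
proof (rule matrix_inv_unique)
  have "det A \<noteq> 0" using assms by (simp add: invertible_det_nz)
  then show "A ** mk2 (A $ 2 $ 2 / det A) (- A $ 1 $ 2 / det A) (- A $ 2 $ 1 / det A) (A $ 1 $ 1 / det A) = mat 1"
    by (simp add: mat2_eq_iff mult2_nth det_2 divide_simps) (simp add: algebra_simps)?
qed

lemma map_matrix_mult2:
  fixes A B :: "'a::semiring_1^2^2"
  assumes "\<And>x y. f (x + y) = f x + f y" "\<And>x y. f (x * y) = f x * f y"
  shows "map_matrix f (A ** B) = map_matrix f A ** map_matrix f B"
  by (simp add: mat2_eq_iff mult2_nth assms)

lemma shift_matrix_mult [simp]:
  fixes A B :: ratmat
  shows "map_matrix shift (A ** B) = map_matrix shift A ** map_matrix shift B"
  by (rule map_matrix_mult2) simp_all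

lemma det_shift_matrix [simp]:
  fixes A :: ratmat
  shows "det (map_matrix shift A) = shift (det A)"
  by (simp add: det_2)

lemma invertible_shift_matrix [simp]:
  fixes A :: ratmat
  shows "invertible (map_matrix shift A) \<longleftrightarrow> invertible A"
  by (simp add: invertible_det_nz)

lemma shift_mat_1 [simp]: "map_matrix shift (mat 1 :: ratmat) = mat 1"
  by (simp add: mat2_eq_iff)

lemma shift_matrix_inv [simp]:
  fixes A :: ratmat
  assumes "invertible A"
  shows "map_matrix shift (matrix_inv A) = matrix_inv (map_matrix shift A)"
  by (metis assms matrix_inv_mult(2) matrix_inv_unique(1) shift_mat_1 shift_matrix_mult)

text \<open>Removes the inverse: gauge equations become intertwining relations between matrix
  products, the form used in all calculations.\<close>

lemma gauge_eq_iff: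
  assumes "invertible G"
  shows "gauge G A = B \<longleftrightarrow> A ** G = map_matrix shift G ** B"
  using matrix_inv_left_eq_iff[of "map_matrix shift G" "A ** G" B] assms
  by (simp add: gauge_def matrix_mul_assoc)

lemma gauge_intertwines:
  assumes "invertible G"
  shows "A ** G = map_matrix shift G ** gauge G A"
  using assms gauge_eq_iff by blast

lemma gauge_mult:
  assumes "invertible G" "invertible K"
  shows "gauge (G ** K) A = gauge K (gauge G A)"
proof -
  have "A ** (G ** K) = map_matrix shift G ** (gauge G A ** K)"
    by (simp add: matrix_mul_assoc gauge_intertwines[OF assms(1), of A])
  also have "\<dots> = map_matrix shift (G ** K) ** gauge K (gauge G A)"
    by (simp add: gauge_intertwines[OF assms(2), of "gauge G A"] matrix_mul_assoc)
  finally have "A ** (G ** K) = map_matrix shift (G ** K) ** gauge K (gauge G A)" .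
  then show ?thesis using assms by (simp add: gauge_eq_iff invertible_mult)
qed

lemma gauge_one [simp]: "gauge (mat 1) A = A"
  by (subst gauge_eq_iff) (simp_all add: invertible_def exI[of _ "mat 1"])

lemma det_gauge:
  assumes "invertible G"
  shows "det (gauge G A) * shift (det G) = det A * det G"
  using arg_cong[OF gauge_intertwines[OF assms, of A], of det] by (simp add: det_mul mult.commute)

subsection \<open>Power series and the shift\<close>

text \<open>w^i becomes w^i (1 + w)^(-i), so the shift is triangular on coefficients.\<close>

lemma shift_fps_nth:
  "fps_nth (shift_fps f) n = (\<Sum>i=0..n. fps_nth f i * fps_nth (inverse (1 + fps_X) ^ i) (n - i))"
  unfolding shift_fps_def fps_compose_nth
  by (intro sum.cong) (auto simp: power_mult_distrib fps_X_power_mult_nth)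

text \<open>The coefficient - i of w in (1 + w)^(-i) is the source of the factor n in the recursion
  below.\<close>

lemma geom_fps_power_nth:
  "fps_nth (inverse (1 + fps_X :: complex fps) ^ i) 0 = 1"
  "fps_nth (inverse (1 + fps_X :: complex fps) ^ i) 1 = - of_nat i"
proof -
  show 0: "fps_nth (inverse (1 + fps_X :: complex fps) ^ i) 0 = 1" for i
    by (simp add: fps_nth_power_0)
  have 1: "fps_nth (inverse (1 + fps_X :: complex fps)) 1 = - 1"
  proof -
    have "fps_nth (inverse (1 + fps_X :: complex fps) * (1 + fps_X)) 1 = 0"
      by (subst inverse_mult_eq_1) simp_all
    then show ?thesis using 0[of 1] by (simp add: fps_mult_nth_1 eq_neg_iff_add_eq_0 add.commute)
  qed
  show "fps_nth (inverse (1 + fps_X :: complex fps) ^ i) 1 = - of_nat i"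
    by (induction i) (use 0 1 0[of 1] in \<open>simp_all add: fps_mult_nth_1\<close>)
qed

lemma shift_fps_nth_0 [simp]: "fps_nth (shift_fps f) 0 = fps_nth f 0"
  by (simp add: shift_fps_nth)

lemma shift_fps_nth_1 [simp]: "fps_nth (shift_fps f) (Suc 0) = fps_nth f (Suc 0)"
  by (simp add: shift_fps_nth geom_fps_power_nth(1))

lemma shift_fps_add: "shift_fps (f + g) = shift_fps f + shift_fps g"
  by (simp add: shift_fps_def fps_compose_add_distrib)

lemma shift_fps_mult: "shift_fps (f * g) = shift_fps f * shift_fps g"
  by (simp add: shift_fps_def fps_compose_mult_distrib)

lemma shift_fps_const [simp]: "shift_fps (fps_const c) = fps_const c"
  by (simp add: shift_fps_def)

subsection \<open>Formal diagonalization\<close>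

text \<open>Course-of-values recursion; \<open>cut\<close> hides the values from index n on, so F
  may refer to the sequence as a whole.\<close>

lemma strong_recursion_exists: "\<exists>f. \<forall>n::nat. f n = F n (cut f less_than n)"
  using wfrec[OF wf_less_than, of "\<lambda>g n. F n g"] by blast

text \<open>Separates, in the n-th step of the recursion, the part already known from the terms that
  are linear in the new coefficient.\<close>

definition truncated :: "nat \<Rightarrow> complex fps \<Rightarrow> complex fps" where
  "truncated n f = Abs_fps (\<lambda>i. if i < n then fps_nth f i else 0)"

lemma truncated_nth [simp]: "fps_nth (truncated n f) i = (if i < n then fps_nth f i else 0)"
  by (simp add: truncated_def)

lemma sum_truncated:
  "(\<Sum>i=0..n. fps_nth f i * k i) = (\<Sum>i=0..n. fps_nth (truncated n f) i * k i) + fps_nth f n * k n"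
  "(\<Sum>i=0..Suc n. fps_nth f i * k i) = (\<Sum>i=0..Suc n. fps_nth (truncated n f) i * k i)
     + fps_nth f n * k n + fps_nth f (Suc n) * k (Suc n)"
proof -
  have *: "(\<Sum>i=0..<n. fps_nth f i * k i) = (\<Sum>i=0..<n. fps_nth (truncated n f) i * k i)"
    by (intro sum.cong) auto
  have iv: "{0..n} = insert n {0..<n}" "{0..Suc n} = insert (Suc n) (insert n {0..<n})" by auto
  show "(\<Sum>i=0..n. fps_nth f i * k i) = (\<Sum>i=0..n. fps_nth (truncated n f) i * k i) + fps_nth f n * k n"
    unfolding iv using * by simp
  show "(\<Sum>i=0..Suc n. fps_nth f i * k i) = (\<Sum>i=0..Suc n. fps_nth (truncated n f) i * k i)
     + fps_nth f n * k n + fps_nth f (Suc n) * k (Suc n)"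
    unfolding iv using * by simp
qed

lemma mult_truncated:
  "fps_nth (a * f) n = fps_nth (a * truncated n f) n + fps_nth a 0 * fps_nth f n"
  "fps_nth (a * f) (Suc n) = fps_nth (a * truncated n f) (Suc n)
     + fps_nth a (Suc 0) * fps_nth f n + fps_nth a 0 * fps_nth f (Suc n)"
  using sum_truncated(1)[of f "\<lambda>i. fps_nth a (n - i)" n]
    sum_truncated(2)[of f "\<lambda>i. fps_nth a (Suc n - i)" n]
  unfolding fps_mult_nth mult.commute[of a] by (simp_all add: mult.commute del: truncated_nth)

text \<open>The order n + 1 is recorded as well: there w^n contributes - n, which is what determines
  the new coefficient of x.\<close>

lemma shift_truncated:
  "fps_nth (shift_fps f) n = fps_nth (shift_fps (truncated n f)) n + fps_nth f n"
  "fps_nth (shift_fps f) (Suc n) = fps_nth (shift_fps (truncated n f)) (Suc n)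
     - of_nat n * fps_nth f n + fps_nth f (Suc n)"
  unfolding shift_fps_nth sum_truncated(1)[of f _ n] sum_truncated(2)[of f _ n]
  using geom_fps_power_nth[of n] geom_fps_power_nth(1)[of "Suc n"]
  by (simp_all del: truncated_nth power_Suc)

text \<open>In order n the second equation determines y_n, since \<rho> differs from the other
  eigenvalue. In order n + 1 of the first equation x_(n+1) cancels, the terms with d cancel as well,
  and \<rho> n x_n remains from the shift. Hence x_n is determined for n > 0, one order later than
  y_n.\<close>

lemma formal_eigenvector_exists:
  fixes a b c e :: "complex fps"
  assumes a: "fps_nth a 0 = \<rho>" "fps_nth a (Suc 0) = \<rho> * d" and b: "fps_nth b 0 = 0" and c: "fps_nth c 0 = 0"
    and e: "fps_nth e 0 \<noteq> \<rho>" and \<rho>: "\<rho> \<noteq> 0"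
  obtains x y where "fps_nth x 0 = 1" "fps_nth y 0 = 0"
    "a * x + b * y = fps_const \<rho> * (1 + fps_const d * fps_X) * shift_fps x"
    "c * x + e * y = fps_const \<rho> * (1 + fps_const d * fps_X) * shift_fps y"
proof -
  define l :: "complex fps" where "l = fps_const \<rho> * (1 + fps_const d * fps_X)"
  have l: "fps_nth l 0 = \<rho>" "fps_nth l (Suc 0) = \<rho> * d" by (simp_all add: l_def)
  define E1 where "E1 = (\<lambda>x y. a * x + b * y - l * shift_fps x)"
  define E2 where "E2 = (\<lambda>x y. c * x + e * y - l * shift_fps y)"
  \<comment> \<open>\<open>yn\<close> comes first because the equation for the coefficient of x
    contains it. The value 1 at n = 0 is the free normalization of the eigenvector.\<close>
  define F where "F = (\<lambda>n (g :: nat \<Rightarrow> complex \<times> complex).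
      let x = truncated n (Abs_fps (\<lambda>k. fst (g k))); y = truncated n (Abs_fps (\<lambda>k. snd (g k)));
          yn = fps_nth (E2 x y) n / (\<rho> - fps_nth e 0)
      in (if n = 0 then 1 else - (fps_nth b (Suc 0) * yn + fps_nth (E1 x y) (Suc n)) / (\<rho> * of_nat n), yn))"
  obtain f where f: "\<And>n. f n = F n (cut f less_than n)" using strong_recursion_exists[of F] by blast
  define x where "x = Abs_fps (\<lambda>k. fst (f k))"
  define y where "y = Abs_fps (\<lambda>k. snd (f k))"
  have cut: "truncated n (Abs_fps (\<lambda>k. fst (cut f less_than n k))) = truncated n x"
    "truncated n (Abs_fps (\<lambda>k. snd (cut f less_than n k))) = truncated n y" for n
    by (auto simp: fps_eq_iff x_def y_def cut_def)
  have yn: "fps_nth y n = fps_nth (E2 (truncated n x) (truncated n y)) n / (\<rho> - fps_nth e 0)" for n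
    using f[of n] by (subst y_def) (simp add: F_def Let_def cut)
  have xn: "fps_nth x n = (if n = 0 then 1 else - (fps_nth b (Suc 0) * fps_nth y n
      + fps_nth (E1 (truncated n x) (truncated n y)) (Suc n)) / (\<rho> * of_nat n))" for n
    using f[of n] yn[of n] by (subst x_def) (simp add: F_def Let_def cut)
  have t0: "truncated 0 g = 0" for g by (simp add: fps_eq_iff)
  have y0: "fps_nth y 0 = 0" using yn[of 0] by (simp add: t0 E2_def)
  have E2n: "fps_nth (E2 x y) n = fps_nth (E2 (truncated n x) (truncated n y)) n
      + (fps_nth e 0 - \<rho>) * fps_nth y n" for n
  proof -
    have "fps_nth (l * shift_fps y) n = fps_nth (l * shift_fps (truncated n y)) n + \<rho> * fps_nth y n"
    proof -
      \<comment> \<open>By triangularity the coefficients of the shift below n depend only on those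
        of y below n.\<close>
      have "truncated n (shift_fps y) = truncated n (shift_fps (truncated n y))"
        by (auto simp: fps_eq_iff shift_fps_nth intro!: sum.cong)
      then show ?thesis
        using mult_truncated(1)[of l "shift_fps y" n] mult_truncated(1)[of l "shift_fps (truncated n y)" n]
          shift_truncated(1)[of y n] l by (simp add: algebra_simps)
    qed
    then show ?thesis
      using mult_truncated(1)[of c x n] mult_truncated(1)[of e y n] c
      by (simp add: E2_def algebra_simps)
  qed
  have E1n: "fps_nth (E1 x y) (Suc n) = fps_nth (E1 (truncated n x) (truncated n y)) (Suc n)
      + fps_nth b (Suc 0) * fps_nth y n + \<rho> * of_nat n * fps_nth x n" for n
  proof -
    have "fps_nth (l * shift_fps x) (Suc n) = fps_nth (l * shift_fps (truncated n x)) (Suc n)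
       + \<rho> * d * fps_nth x n + \<rho> * (fps_nth x (Suc n) - of_nat n * fps_nth x n)"
    proof -
      have "truncated n (shift_fps x) = truncated n (shift_fps (truncated n x))"
        by (auto simp: fps_eq_iff shift_fps_nth intro!: sum.cong)
      then show ?thesis
        using mult_truncated(2)[of l "shift_fps x" n] mult_truncated(2)[of l "shift_fps (truncated n x)" n]
          shift_truncated[of x n] l by (simp add: algebra_simps)
    qed
    then show ?thesis
      using mult_truncated(2)[of a x n] mult_truncated(2)[of b y n] a b
      by (simp add: E1_def algebra_simps)
  qed
  have "fps_nth (E2 x y) n = 0" for n
    using e by (simp add: E2n yn[of n] field_simps)
  then have 2: "E2 x y = 0" by (simp add: fps_eq_iff)
  have E10: "E1 0 0 = 0" by (simp add: E1_def shift_fps_def)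
  have "fps_nth (E1 x y) (Suc n) = 0" for n
  proof (cases "n = 0")
    case True
    \<comment> \<open>Order one puts no condition on x_0: a and l agree up to that order, and y has
      no constant term.\<close>
    then show ?thesis using E1n[of 0] by (simp add: y0 t0 E10)
  next
    case False
    then have "\<rho> * of_nat n * fps_nth x n = - (fps_nth b (Suc 0) * fps_nth y n
        + fps_nth (E1 (truncated n x) (truncated n y)) (Suc n))"
      using xn[of n] \<rho> by simp
    then show ?thesis using E1n[of n] by simp
  qed
  moreover have "fps_nth (E1 x y) 0 = 0" using a l b by (simp add: E1_def)
  ultimately have 1: "E1 x y = 0" by (metis fps_ext fps_zero_nth not0_implies_Suc)
  have "fps_nth x 0 = 1" using xn[of 0] by simp
  from that[OF this y0] 1 2 show thesis by (simp add: E1_def E2_def l_def)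
qed

text \<open>A diagonal entry of \<open>formal_diag\<close> divided by its pole factor z^n, written
  in w = 1/z.\<close>

abbreviation formal_line :: "complex \<Rightarrow> complex \<Rightarrow> complex fps" where
  "formal_line \<rho> d \<equiv> fps_const \<rho> * (1 + fps_const d * fps_X)"

abbreviation formal_diag2 :: "complex \<Rightarrow> complex \<Rightarrow> complex \<Rightarrow> complex \<Rightarrow> complex fps^2^2" where
  "formal_diag2 \<rho>1 d1 \<rho>2 d2 \<equiv> mk2 (formal_line \<rho>1 d1) 0 0 (formal_line \<rho>2 d2)"

text \<open>For an off-diagonal entry b or c different from 0, (b, \<rho> - a) or (\<rho> - e, c) is
  an eigenvector for each eigenvalue \<rho>. A diagonal M needs at most an exchange of the basis
  vectors.\<close>

lemma eigenbasis_exists: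
  fixes M :: "complex^2^2"
  assumes tr: "M $ 1 $ 1 + M $ 2 $ 2 = \<rho>1 + \<rho>2" and det: "det M = \<rho>1 * \<rho>2" and ne: "\<rho>1 \<noteq> \<rho>2"
  obtains P where "det P \<noteq> 0" "M ** P = P ** mk2 \<rho>1 0 0 \<rho>2"
proof -
  obtain a b c e where M: "M = mk2 a b c e" by (metis mat2_eq_iff mk2_nth)
  have e: "e = \<rho>1 + \<rho>2 - a" using tr by (simp add: M algebra_simps)
  have bc: "b * c = a * e - \<rho>1 * \<rho>2" using det by (simp add: M det_2 algebra_simps)
  have ch: "a * (\<rho>1 + \<rho>2 - a) = b * c + \<rho>1 * \<rho>2" using bc e by simp
  show thesis
  proof (cases "b = 0")
    case False
    show thesis
    proof (rule that)
      show "det (mk2 b b (\<rho>1 - a) (\<rho>2 - a)) \<noteq> 0" using False ne by (simp add: det_2 algebra_simps)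
      show "M ** mk2 b b (\<rho>1 - a) (\<rho>2 - a) = mk2 b b (\<rho>1 - a) (\<rho>2 - a) ** mk2 \<rho>1 0 0 \<rho>2"
        using ch by (simp add: M mat2_eq_iff mult2_nth e) (simp add: algebra_simps)
    qed
  next
    case b: True
    have "(a - \<rho>1) * (a - \<rho>2) = b * c + \<rho>1 * \<rho>2 - a * (\<rho>1 + \<rho>2 - a)"
      using b by (simp add: algebra_simps)
    also have "\<dots> = 0" unfolding ch by (rule diff_self)
    finally have root: "(a - \<rho>1) * (a - \<rho>2) = 0" .
    show thesis
    proof (cases "c = 0")
      case False
      show thesis
      proof (rule that)
        show "det (mk2 (\<rho>1 - e) (\<rho>2 - e) c c) \<noteq> 0" using False ne by (simp add: det_2 algebra_simps)
        show "M ** mk2 (\<rho>1 - e) (\<rho>2 - e) c c = mk2 (\<rho>1 - e) (\<rho>2 - e) c c ** mk2 \<rho>1 0 0 \<rho>2"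
          using root b by (auto simp add: M mat2_eq_iff mult2_nth e algebra_simps)
      qed
    next
      case c: True
      consider "a = \<rho>1" "e = \<rho>2" | "a = \<rho>2" "e = \<rho>1" using e root by auto
      then show thesis
      proof cases
        case 1
        show thesis by (rule that[of "mat 1"]) (use 1 b c in \<open>simp_all add: M mat2_eq_iff mult2_nth\<close>)
      next
        case 2
        show thesis
          by (rule that[of "mk2 0 1 1 0"]) (use 2 b c in \<open>simp_all add: M mat2_eq_iff mult2_nth det_2\<close>)
      qed
    qed
  qed
qed

text \<open>Orders 0 and 1 of trace and determinant of \<open>formal_diag2\<close>. Shifted
  conjugation does not preserve the higher orders, since the shift moves the coefficient of
  w^2.\<close>

definition formal_invariants :: "complex \<Rightarrow> complex \<Rightarrow> complex \<Rightarrow> complex \<Rightarrow> complex fps^2^2 \<Rightarrow> bool" where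
  "formal_invariants \<rho>1 d1 \<rho>2 d2 M \<longleftrightarrow>
     fps_nth (M $ 1 $ 1 + M $ 2 $ 2) 0 = \<rho>1 + \<rho>2 \<and>
     fps_nth (M $ 1 $ 1 + M $ 2 $ 2) (Suc 0) = \<rho>1 * d1 + \<rho>2 * d2 \<and>
     fps_nth (det M) 0 = \<rho>1 * \<rho>2 \<and>
     fps_nth (det M) (Suc 0) = \<rho>1 * \<rho>2 * (d1 + d2)"

text \<open>R and its shift agree up to order one, so up to that order the relation is an ordinary
  conjugation.\<close>

lemma formal_invariants_if_diagonalizable:
  fixes M R :: "complex fps^2^2"
  assumes R: "fps_nth (det R) 0 \<noteq> 0"
    and MR: "M ** R = map_matrix shift_fps R ** formal_diag2 \<rho>1 d1 \<rho>2 d2"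
  shows "formal_invariants \<rho>1 d1 \<rho>2 d2 M"
proof -
  let ?D = "formal_diag2 \<rho>1 d1 \<rho>2 d2"
  let ?r0 = "fps_nth (det R) 0" and ?r1 = "fps_nth (det R) (Suc 0)"
  have sdet: "fps_nth (det (map_matrix shift_fps R)) 0 = ?r0"
    "fps_nth (det (map_matrix shift_fps R)) (Suc 0) = ?r1"
    by (simp_all add: det_2 fps_mult_nth_1[simplified])
  have "det M * det R = det (map_matrix shift_fps R) * det ?D"
    using arg_cong[OF MR, of det] by (simp add: det_mul)
  then have "fps_nth (det M * det R) n = fps_nth (det (map_matrix shift_fps R) * det ?D) n" for n by simp
  from this[of 0] this[of "Suc 0"] have d0: "fps_nth (det M) 0 = \<rho>1 * \<rho>2"
    and d1: "fps_nth (det M) (Suc 0) = \<rho>1 * \<rho>2 * (d1 + d2)"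
    using R sdet by (simp_all add: fps_mult_nth_1[simplified] det_2[of ?D]) (simp add: algebra_simps)
  \<comment> \<open>The trace of M R adj(R) is det R times the trace of M; this isolates the trace
    without inverting R.\<close>
  have "det R * (M $ 1 $ 1 + M $ 2 $ 2) = (M ** R ** adj2 R) $ 1 $ 1 + (M ** R ** adj2 R) $ 2 $ 2"
    by (simp add: mult2_nth det_2 algebra_simps)
  also have "\<dots> = (map_matrix shift_fps R ** ?D ** adj2 R) $ 1 $ 1 + (map_matrix shift_fps R ** ?D ** adj2 R) $ 2 $ 2"
    by (simp add: MR)
  finally have "fps_nth (det R * (M $ 1 $ 1 + M $ 2 $ 2)) n =
    fps_nth ((map_matrix shift_fps R ** ?D ** adj2 R) $ 1 $ 1 + (map_matrix shift_fps R ** ?D ** adj2 R) $ 2 $ 2) n" for n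
    by simp
  moreover have "fps_nth ((map_matrix shift_fps R ** ?D ** adj2 R) $ 1 $ 1 + (map_matrix shift_fps R ** ?D ** adj2 R) $ 2 $ 2) 0 = ?r0 * (\<rho>1 + \<rho>2)"
    by (simp add: mult2_nth det_2) (simp add: algebra_simps)
  moreover have "fps_nth ((map_matrix shift_fps R ** ?D ** adj2 R) $ 1 $ 1 + (map_matrix shift_fps R ** ?D ** adj2 R) $ 2 $ 2) (Suc 0)
    = ?r1 * (\<rho>1 + \<rho>2) + ?r0 * (\<rho>1 * d1 + \<rho>2 * d2)"
    by (simp add: mult2_nth det_2 fps_mult_nth_1[simplified]) (simp add: algebra_simps)
  ultimately have "?r0 * fps_nth (M $ 1 $ 1 + M $ 2 $ 2) 0 = ?r0 * (\<rho>1 + \<rho>2)"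
    "?r0 * fps_nth (M $ 1 $ 1 + M $ 2 $ 2) (Suc 0) + ?r1 * fps_nth (M $ 1 $ 1 + M $ 2 $ 2) 0
       = ?r1 * (\<rho>1 + \<rho>2) + ?r0 * (\<rho>1 * d1 + \<rho>2 * d2)"
    by (metis fps_mult_nth_0, metis fps_mult_nth_1 One_nat_def)
  with R have "fps_nth (M $ 1 $ 1 + M $ 2 $ 2) 0 = \<rho>1 + \<rho>2"
    "fps_nth (M $ 1 $ 1 + M $ 2 $ 2) (Suc 0) = \<rho>1 * d1 + \<rho>2 * d2"
    by auto
  with d0 d1 show ?thesis by (simp add: formal_invariants_def)
qed

text \<open>A constant change of basis diagonalizes the leading term. Off-diagonal entries then
  start at order one and do not enter the determinant in order one, so trace and determinant give
  two linear equations for the diagonal coefficients of order one. Their solution is unique because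
  \<rho>1 and \<rho>2 differ.\<close>

lemma formal_invariants_eigenbasis:
  fixes M :: "complex fps^2^2"
  assumes inv: "formal_invariants \<rho>1 d1 \<rho>2 d2 M" and ne: "\<rho>1 \<noteq> \<rho>2"
  obtains P :: "complex^2^2" and N where "det P \<noteq> 0"
    "M ** map_matrix fps_const P = map_matrix fps_const P ** N"
    "fps_nth (N $ 1 $ 1) 0 = \<rho>1" "fps_nth (N $ 1 $ 2) 0 = 0"
    "fps_nth (N $ 2 $ 1) 0 = 0" "fps_nth (N $ 2 $ 2) 0 = \<rho>2"
    "fps_nth (N $ 1 $ 1) (Suc 0) = \<rho>1 * d1" "fps_nth (N $ 2 $ 2) (Suc 0) = \<rho>2 * d2"
proof -
  let ?M0 = "map_matrix (\<lambda>f. fps_nth f 0) M"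
  obtain P where P: "det P \<noteq> 0" "?M0 ** P = P ** mk2 \<rho>1 0 0 \<rho>2"
    using eigenbasis_exists[of ?M0 \<rho>1 \<rho>2] inv ne by (auto simp: formal_invariants_def det_2)
  let ?P = "map_matrix fps_const P" and ?Q = "map_matrix fps_const (matrix_inv P)"
  have invP: "invertible P" using P by (simp add: invertible_det_nz)
  have PQ: "?P ** ?Q = mat 1" "?Q ** ?P = mat 1"
    using matrix_inv_mult[OF invP] by (simp_all add: mat2_eq_iff mult2_nth)
  define N where "N = ?Q ** M ** ?P"
  have MP: "M ** ?P = ?P ** N"
    unfolding N_def using PQ by (metis matrix_mul_assoc matrix_mul_lid)
  have N0: "map_matrix (\<lambda>f. fps_nth f 0) N = mk2 \<rho>1 0 0 \<rho>2"
  proof -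
    have "map_matrix (\<lambda>f. fps_nth f 0) N = matrix_inv P ** ?M0 ** P"
      by (simp add: mat2_eq_iff mult2_nth N_def)
    also have "\<dots> = mk2 \<rho>1 0 0 \<rho>2"
      using P(2) invP by (metis matrix_inv_mult(1) matrix_mul_assoc matrix_mul_lid)
    finally show ?thesis .
  qed
  then have n0: "fps_nth (N $ 1 $ 1) 0 = \<rho>1" "fps_nth (N $ 1 $ 2) 0 = 0"
    "fps_nth (N $ 2 $ 1) 0 = 0" "fps_nth (N $ 2 $ 2) 0 = \<rho>2"
    by (simp_all add: mat2_eq_iff)
  have "det M * det ?P = det N * det ?P" using arg_cong[OF MP, of det] by (simp add: det_mul mult.commute)
  moreover have "det ?P = fps_const (det P)" by (simp add: det_2)
  ultimately have detN: "det N = det M" using P(1) by simp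
  have "N $ 1 $ 1 + N $ 2 $ 2 = (M ** ?P ** ?Q) $ 1 $ 1 + (M ** ?P ** ?Q) $ 2 $ 2"
    unfolding N_def by (simp add: mult2_nth algebra_simps)
  also have "M ** ?P ** ?Q = M" using PQ by (metis matrix_mul_assoc matrix_mul_rid)
  finally have trN: "N $ 1 $ 1 + N $ 2 $ 2 = M $ 1 $ 1 + M $ 2 $ 2" .
  let ?x = "fps_nth (N $ 1 $ 1) (Suc 0)" and ?y = "fps_nth (N $ 2 $ 2) (Suc 0)"
  have s: "?x + ?y = \<rho>1 * d1 + \<rho>2 * d2"
    using inv trN by (metis formal_invariants_def fps_add_nth)
  have "fps_nth (det N) (Suc 0) = \<rho>1 * \<rho>2 * (d1 + d2)"
    using inv detN by (simp add: formal_invariants_def)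
  then have t: "?x * \<rho>2 + \<rho>1 * ?y = \<rho>1 * \<rho>2 * (d1 + d2)"
    using n0 by (simp add: det_2 fps_mult_nth_1[simplified] add.commute)
  have y: "?y = \<rho>1 * d1 + \<rho>2 * d2 - ?x" using s by (simp add: algebra_simps)
  have "(\<rho>2 - \<rho>1) * ?x = (\<rho>2 - \<rho>1) * (\<rho>1 * d1)"
    using t unfolding y by (simp add: algebra_simps)
  then have x: "?x = \<rho>1 * d1" using ne by simp
  with s have "?y = \<rho>2 * d2" by simp
  with that[OF P(1) MP n0 x] show thesis by blast
qed

lemma diagonalizable_if_formal_invariants:
  fixes M :: "complex fps^2^2"
  assumes inv: "formal_invariants \<rho>1 d1 \<rho>2 d2 M" and ne: "\<rho>1 \<noteq> \<rho>2" "\<rho>1 \<noteq> 0" "\<rho>2 \<noteq> 0"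
  obtains R where "fps_nth (det R) 0 \<noteq> 0"
    "M ** R = map_matrix shift_fps R ** formal_diag2 \<rho>1 d1 \<rho>2 d2"
proof -
  obtain P :: "complex^2^2" and N where P: "det P \<noteq> 0"
    and MP: "M ** map_matrix fps_const P = map_matrix fps_const P ** N"
    and N: "fps_nth (N $ 1 $ 1) 0 = \<rho>1" "fps_nth (N $ 1 $ 2) 0 = 0"
    "fps_nth (N $ 2 $ 1) 0 = 0" "fps_nth (N $ 2 $ 2) 0 = \<rho>2"
    "fps_nth (N $ 1 $ 1) (Suc 0) = \<rho>1 * d1" "fps_nth (N $ 2 $ 2) (Suc 0) = \<rho>2 * d2"
    using formal_invariants_eigenbasis[OF inv ne(1)] by metis
  obtain x y where xy: "fps_nth x 0 = 1" "fps_nth y 0 = 0"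
    "N $ 1 $ 1 * x + N $ 1 $ 2 * y = formal_line \<rho>1 d1 * shift_fps x"
    "N $ 2 $ 1 * x + N $ 2 $ 2 * y = formal_line \<rho>1 d1 * shift_fps y"
    using formal_eigenvector_exists[of "N $ 1 $ 1" \<rho>1 d1 "N $ 1 $ 2" "N $ 2 $ 1" "N $ 2 $ 2"] N ne by metis
  \<comment> \<open>The second eigenvector is the first construction with the two coordinates
    exchanged.\<close>
  obtain y' x' where xy': "fps_nth y' 0 = 1" "fps_nth x' 0 = 0"
    "N $ 2 $ 2 * y' + N $ 2 $ 1 * x' = formal_line \<rho>2 d2 * shift_fps y'"
    "N $ 1 $ 2 * y' + N $ 1 $ 1 * x' = formal_line \<rho>2 d2 * shift_fps x'"
    using formal_eigenvector_exists[of "N $ 2 $ 2" \<rho>2 d2 "N $ 2 $ 1" "N $ 1 $ 2" "N $ 1 $ 1"] N ne by metis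
  let ?V = "mk2 x x' y y'"
  have NV: "N ** ?V = map_matrix shift_fps ?V ** formal_diag2 \<rho>1 d1 \<rho>2 d2"
    using xy xy' by (simp add: mat2_eq_iff mult2_nth algebra_simps)
  let ?P = "map_matrix fps_const P"
  have shP: "map_matrix shift_fps (?P ** ?V) = ?P ** map_matrix shift_fps ?V"
    by (simp add: mat2_eq_iff mult2_nth shift_fps_add shift_fps_mult)
  show thesis
  proof (rule that)
    show "fps_nth (det (?P ** ?V)) 0 \<noteq> 0"
      using P xy xy' unfolding det_mul by (simp add: det_2)
    show "M ** (?P ** ?V) = map_matrix shift_fps (?P ** ?V) ** formal_diag2 \<rho>1 d1 \<rho>2 d2"
      unfolding shP by (metis MP NV matrix_mul_assoc)
  qed
qed

subsection \<open>Formal type in terms of trace and determinant\<close>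

text \<open>An opaque name for z^k, so that fraction arithmetic does not unfold it.\<close>

definition Zp :: "int \<Rightarrow> ratfun" where
  "Zp k = Zvar powi k"

lemma Zp_mult: "Zp k * Zp l = Zp (k + l)"
  by (simp add: Zp_def power_int_add)

lemma Zp_mult_assoc: "Zp k * (Zp l * r) = Zp (k + l) * r"
  by (simp add: Zp_mult flip: mult.assoc)

lemma Zp_0 [simp]: "Zp 0 = 1"
  by (simp add: Zp_def)

lemma Zp_nonzero [simp]: "Zp k \<noteq> 0"
  by (simp add: Zp_def)

lemma Zp_in_lsi: "Zp k \<in> lsi l \<longleftrightarrow> k \<le> l"
proof -
  have "1 * Zvar powi k \<in> lsi l \<longleftrightarrow> of_pol 1 \<in> lsi (l - k)" by (simp only: lsi_Zvar_mult of_pol_1)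
  moreover have "of_pol 1 \<in> lsi (l - k) \<longleftrightarrow> k \<le> l" unfolding lsi_of_pol by simp
  ultimately show ?thesis by (simp add: Zp_def)
qed

lemma lsi_Zp_mult: "r * Zp l \<in> lsi k \<longleftrightarrow> r \<in> lsi (k - l)"
  by (simp only: Zp_def lsi_Zvar_mult)

lemma lsi_mult_Zp: "Zp l * r \<in> lsi k \<longleftrightarrow> r \<in> lsi (k - l)"
  by (simp only: lsi_Zp_mult mult.commute[of "Zp l"])

lemma of_pol_monom: "of_pol (monom c n) = of_pol [:c:] * Zp (int n)"
  by (simp add: Zp_def Zvar_power smult_monom)

lemma of_pol_pCons: "of_pol (pCons c p) = of_pol [:c:] + Zp 1 * of_pol p"
  by (simp add: Zp_def)

lemma expand_inf_inverse: "expand_inf (inverse r) = inverse (expand_inf r)"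
proof (cases "r = 0")
  case False
  then have "expand_inf (r * inverse r) = 1" by (simp del: expand_inf_mult)
  then show ?thesis by (simp add: inverse_unique)
qed simp

lemma expand_inf_Zp: "expand_inf (Zp k) = fls_X_inv powi k"
proof -
  have pow: "expand_inf (r ^ n) = expand_inf r ^ n" for r n by (induction n) simp_all
  show ?thesis
    unfolding Zp_def power_int_def by (simp add: pow expand_inf_Zvar expand_inf_inverse del: inverse_fract)
qed

text \<open>The Taylor series in w. \<open>fls_regpart\<close> discards a polar part, so
  multiplicativity holds only on \<open>lsi 0\<close>.\<close>

definition inf_coeff :: "ratfun \<Rightarrow> complex fps" where
  "inf_coeff r = fls_regpart (expand_inf r)"

lemma fps_to_fls_inf_coeff:
  assumes "r \<in> lsi 0" shows "fps_to_fls (inf_coeff r) = expand_inf r"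
  using assms by (auto simp: inf_coeff_def lsi_expand)

lemma inf_coeff_add [simp]: "inf_coeff (r + s) = inf_coeff r + inf_coeff s"
  and inf_coeff_diff [simp]: "inf_coeff (r - s) = inf_coeff r - inf_coeff s"
  and inf_coeff_uminus [simp]: "inf_coeff (- r) = - inf_coeff r"
  by (simp_all add: inf_coeff_def)

lemma inf_coeff_0 [simp]: "inf_coeff 0 = 0"
  by (simp add: inf_coeff_def)

lemma inf_coeff_mult:
  assumes "r \<in> lsi 0" "s \<in> lsi 0"
  shows "inf_coeff (r * s) = inf_coeff r * inf_coeff s"
proof -
  have "fps_to_fls (inf_coeff (r * s)) = fps_to_fls (inf_coeff r * inf_coeff s)"
    using assms lsi_mult[OF assms] by (simp add: fps_to_fls_inf_coeff fls_times_fps_to_fls)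
  then show ?thesis by simp
qed

lemma inf_coeff_const [simp]: "inf_coeff (of_pol [:c:]) = fps_const c"
  by (simp add: inf_coeff_def expand_inf_const)

lemma inf_coeff_Zp_minus_1: "inf_coeff (Zp (- 1)) = fps_X"
  by (simp add: inf_coeff_def expand_inf_Zp fls_inverse_X_inv)

lemma inf_coeff_lsi:
  assumes "r \<in> lsi 0"
  shows "r \<in> lsi (- int n) \<longleftrightarrow> (\<forall>k<n. fps_nth (inf_coeff r) k = 0)"
proof -
  have neg: "fls_nth (expand_inf r) k = 0" if "k < 0" for k
    using assms that by (simp add: lsi_expand_nth)
  show ?thesis
  proof
    assume "r \<in> lsi (- int n)"
    then show "\<forall>k<n. fps_nth (inf_coeff r) k = 0" by (simp add: lsi_expand_nth inf_coeff_def)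
  next
    assume *: "\<forall>k<n. fps_nth (inf_coeff r) k = 0"
    have "fls_nth (expand_inf r) k = 0" if "k < int n" for k
      using neg[of k] *[rule_format, of "nat k"] that by (cases "k < 0") (simp_all add: inf_coeff_def)
    then show "r \<in> lsi (- int n)" by (simp add: lsi_expand_nth)
  qed
qed

lemma inf_coeff_2:
  assumes "r \<in> lsi 0"
  shows "r - (of_pol [:c:] + of_pol [:d:] * Zp (- 1)) \<in> lsi (- 2) \<longleftrightarrow>
    fps_nth (inf_coeff r) 0 = c \<and> fps_nth (inf_coeff r) (Suc 0) = d"
proof -
  have Z: "Zp (- 1) \<in> lsi 0" by (simp add: Zp_in_lsi)
  have dZ: "of_pol [:d:] * Zp (- 1) \<in> lsi 0"
    using lsi_mult[OF lsi_const Z] by simp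
  have "inf_coeff (r - (of_pol [:c:] + of_pol [:d:] * Zp (- 1))) = inf_coeff r - (fps_const c + fps_const d * fps_X)"
    using Z by (simp add: inf_coeff_mult inf_coeff_Zp_minus_1)
  moreover have "r - (of_pol [:c:] + of_pol [:d:] * Zp (- 1)) \<in> lsi 0"
    using assms dZ by (intro lsi_diff lsi_add lsi_const)
  ultimately show ?thesis
    using inf_coeff_lsi[of _ 2] by (auto simp: less_2_cases_iff)
qed

definition inf_series :: "ratmat \<Rightarrow> complex fps^2^2" where
  "inf_series B = map_matrix (\<lambda>r. inf_coeff (r * Zp (- 2))) B"

lemma inf_series_nth [simp]: "inf_series B $ i $ j = inf_coeff (B $ i $ j * Zp (- 2))"
  by (simp add: inf_series_def)

text \<open>Clearing the inverse and cancelling z^2 on both sides turn the equation of Laurent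
  series into one of power series.\<close>

lemma formal_type_inf_iff:
  assumes B: "\<And>i j. B $ i $ j \<in> lsi 2" and n: "pord \<theta> = 2"
  shows "formal_type_inf \<theta> B \<longleftrightarrow> (\<exists>R. fps_nth (det R) 0 \<noteq> 0 \<and>
    inf_series B ** R = map_matrix shift_fps R ** formal_diag2 (rho1 \<theta>) (dd1 \<theta>) (rho2 \<theta>) (dd2 \<theta>))"
proof -
  have X2: "fls_X_inv powi (- 2) * (fls_X_inv ^ 2 :: complex fls) = 1"
    by (simp add: power_int_def flip: power_mult_distrib)
  have X1: "(fls_X_inv :: complex fls) ^ 2 * fls_X = fls_X_inv"
    by (simp add: power2_eq_square mult.assoc flip: fls_inverse_X_inv)
  have BX: "expand_inf (B $ i $ j) = fls_X_inv ^ 2 * fps_to_fls (inf_series B $ i $ j)" for i j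
  proof -
    have "B $ i $ j * Zp (- 2) \<in> lsi 0" using B by (simp add: lsi_Zp_mult)
    then have "fps_to_fls (inf_series B $ i $ j) = expand_inf (B $ i $ j) * fls_X_inv powi (- 2)"
      by (simp only: inf_series_nth fps_to_fls_inf_coeff expand_inf_mult expand_inf_Zp)
    then show ?thesis using X2 by (simp add: mult.left_commute[of "fls_X_inv ^ 2"] mult.commute[of "fls_X_inv ^ 2"])
  qed
  have line: "fls_const r * (fls_X_inv ^ 2 + fls_const d * fls_X_inv) = fls_X_inv ^ 2 * fps_to_fls (formal_line r d)" for r d
    using X1 by (simp add: fls_times_fps_to_fls algebra_simps)
  have D: "formal_diag \<theta> $ i $ j = fls_X_inv ^ 2 * fps_to_fls
      (formal_diag2 (rho1 \<theta>) (dd1 \<theta>) (rho2 \<theta>) (dd2 \<theta>) $ i $ j)" for i j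
    using exhaust_2[of i] exhaust_2[of j] line n by (auto simp: formal_diag_def Let_def)
  have "matrix_inv (map_matrix (fps_to_fls \<circ> shift_fps) R) ** map_matrix expand_inf B **
          map_matrix fps_to_fls R = formal_diag \<theta> \<longleftrightarrow>
        inf_series B ** R = map_matrix shift_fps R ** formal_diag2 (rho1 \<theta>) (dd1 \<theta>) (rho2 \<theta>) (dd2 \<theta>)"
    (is "?L \<longleftrightarrow> ?R") if R: "fps_nth (det R) 0 \<noteq> 0" for R
  proof -
    let ?X = "map_matrix (fps_to_fls \<circ> shift_fps) R"
    have "det ?X = fps_to_fls (det (map_matrix shift_fps R))"
      by (simp add: det_2 fls_times_fps_to_fls)
    moreover have "fps_nth (det (map_matrix shift_fps R)) 0 \<noteq> 0"
      using R by (simp add: det_2)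
    ultimately have "invertible ?X" by (auto simp: invertible_det_nz)
    then have "?L \<longleftrightarrow> map_matrix expand_inf B ** map_matrix fps_to_fls R = ?X ** formal_diag \<theta>"
      using matrix_inv_left_eq_iff[of ?X "map_matrix expand_inf B ** map_matrix fps_to_fls R" "formal_diag \<theta>"]
      by (simp add: matrix_mul_assoc)
    also have "\<dots> \<longleftrightarrow> (\<forall>i j. fls_X_inv ^ 2 * fps_to_fls ((inf_series B ** R) $ i $ j) =
       fls_X_inv ^ 2 * fps_to_fls ((map_matrix shift_fps R ** formal_diag2 (rho1 \<theta>) (dd1 \<theta>) (rho2 \<theta>) (dd2 \<theta>)) $ i $ j))"
      unfolding vec_eq_iff mult2_nth nth_map_matrix BX D
      by (simp add: fls_times_fps_to_fls mult_ac distrib_left del: inf_series_nth)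
    also have "\<dots> \<longleftrightarrow> ?R" by (simp add: vec_eq_iff)
    finally show ?thesis .
  qed
  then show ?thesis unfolding formal_type_inf_def by blast
qed

text \<open>\<open>formal_invariants\<close> without expansions: the trace has order 2 and the
  determinant order 4, and two coefficients of each are prescribed, whence the remainders in
  \<open>lsi 0\<close> and \<open>lsi 2\<close>.\<close>

definition inf_invariants :: "dtype \<Rightarrow> ratmat \<Rightarrow> bool" where
  "inf_invariants \<theta> B \<longleftrightarrow> (\<forall>i j. B $ i $ j \<in> lsi 2) \<and>
     B $ 1 $ 1 + B $ 2 $ 2 - of_pol [:0, rho1 \<theta> * dd1 \<theta> + rho2 \<theta> * dd2 \<theta>, rho1 \<theta> + rho2 \<theta>:] \<in> lsi 0 \<and>
     det B - of_pol [:0, 0, 0, rho1 \<theta> * rho2 \<theta> * (dd1 \<theta> + dd2 \<theta>), rho1 \<theta> * rho2 \<theta>:] \<in> lsi 2"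

lemma det_inf_series:
  assumes B: "\<And>i j. B $ i $ j \<in> lsi 2"
  shows "det (inf_series B) = inf_coeff (det B * Zp (- 4))"
proof -
  have B': "B $ i $ j * Zp (- 2) \<in> lsi 0" for i j using B by (simp add: lsi_Zp_mult)
  have "det B * Zp (- 4) = (B $ 1 $ 1 * Zp (- 2)) * (B $ 2 $ 2 * Zp (- 2)) - (B $ 1 $ 2 * Zp (- 2)) * (B $ 2 $ 1 * Zp (- 2))"
    by (simp add: det_2 left_diff_distrib mult.assoc mult.left_commute[of "Zp (- 2)"] Zp_mult)
  then show ?thesis by (simp add: inf_coeff_mult B' det_2)
qed

lemma inf_invariants_iff:
  "inf_invariants \<theta> B \<longleftrightarrow> (\<forall>i j. B $ i $ j \<in> lsi 2) \<and>
     formal_invariants (rho1 \<theta>) (dd1 \<theta>) (rho2 \<theta>) (dd2 \<theta>) (inf_series B)"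
proof (cases "\<forall>i j. B $ i $ j \<in> lsi 2")
  case True
  let ?t = "B $ 1 $ 1 + B $ 2 $ 2"
  have B: "B $ i $ j \<in> lsi 2" for i j using True by blast
  have t: "?t * Zp (- 2) \<in> lsi 0" using B by (simp add: lsi_Zp_mult lsi_add)
  have "det B \<in> lsi 4"
    unfolding det_2 using B by (intro lsi_diff lsi_mult'[of _ 2 _ 2]) auto
  then have d: "det B * Zp (- 4) \<in> lsi 0" by (simp add: lsi_Zp_mult)
  have Z: "of_pol [:0, c, d:] = (of_pol [:d:] + of_pol [:c:] * Zp (- 1)) * Zp 2" for c d
    by (simp add: of_pol_pCons[of _ "pCons _ _"] of_pol_pCons[of 0 0] ring_distribs mult.assoc Zp_mult
        mult.left_commute[of "Zp 1"] mult.commute[of "Zp 1"] del: add_fract mult_fract)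
  have Z': "of_pol [:0, 0, 0, c, d:] = (of_pol [:d:] + of_pol [:c:] * Zp (- 1)) * Zp 4" for c d
    by (simp add: of_pol_pCons[of _ "pCons _ _"] ring_distribs mult.assoc Zp_mult
        mult.left_commute[of "Zp 1"] mult.commute[of "Zp 1"] del: add_fract mult_fract)
  have "?t - of_pol [:0, c, d:] \<in> lsi 0 \<longleftrightarrow>
     ?t * Zp (- 2) - (of_pol [:d:] + of_pol [:c:] * Zp (- 1)) \<in> lsi (- 2)" for c d
  proof -
    have "?t - of_pol [:0, c, d:] = (?t * Zp (- 2) - (of_pol [:d:] + of_pol [:c:] * Zp (- 1))) * Zp 2"
      unfolding Z by (simp add: left_diff_distrib mult.assoc Zp_mult del: add_fract mult_fract)
    then show ?thesis by (simp only: lsi_Zp_mult) simp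
  qed
  then have T: "?t - of_pol [:0, c, d:] \<in> lsi 0 \<longleftrightarrow>
     fps_nth (inf_coeff (?t * Zp (- 2))) 0 = d \<and> fps_nth (inf_coeff (?t * Zp (- 2))) (Suc 0) = c" for c d
    using inf_coeff_2[OF t] by simp
  have "det B - of_pol [:0, 0, 0, c, d:] \<in> lsi 2 \<longleftrightarrow>
     det B * Zp (- 4) - (of_pol [:d:] + of_pol [:c:] * Zp (- 1)) \<in> lsi (- 2)" for c d
  proof -
    have "det B - of_pol [:0, 0, 0, c, d:] = (det B * Zp (- 4) - (of_pol [:d:] + of_pol [:c:] * Zp (- 1))) * Zp 4"
      unfolding Z' by (simp add: left_diff_distrib mult.assoc Zp_mult del: add_fract mult_fract)
    then show ?thesis by (simp only: lsi_Zp_mult) simp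
  qed
  then have D: "det B - of_pol [:0, 0, 0, c, d:] \<in> lsi 2 \<longleftrightarrow>
     fps_nth (inf_coeff (det B * Zp (- 4))) 0 = d \<and> fps_nth (inf_coeff (det B * Zp (- 4))) (Suc 0) = c" for c d
    using inf_coeff_2[OF d] by simp
  have det: "inf_coeff (det B * Zp (- 4)) = det (inf_series B)" using det_inf_series[OF B] by simp
  have tr: "inf_coeff (?t * Zp (- 2)) = inf_series B $ 1 $ 1 + inf_series B $ 2 $ 2"
    by (simp add: distrib_right)
  show ?thesis
    unfolding inf_invariants_def formal_invariants_def T D det tr using True by auto
qed (auto simp: inf_invariants_def)

lemma formal_type_inf_iff_invariants:
  assumes B: "\<And>i j. B $ i $ j \<in> lsi 2" and n: "pord \<theta> = 2"
    and \<rho>: "rho1 \<theta> \<noteq> rho2 \<theta>" "rho1 \<theta> \<noteq> 0" "rho2 \<theta> \<noteq> 0"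
  shows "formal_type_inf \<theta> B \<longleftrightarrow> inf_invariants \<theta> B"
  unfolding formal_type_inf_iff[OF B n] inf_invariants_iff
  using formal_invariants_if_diagonalizable diagonalizable_if_formal_invariants[OF _ \<rho>] B by metis

text \<open>With all entries of order at most 1 the determinant would have order at most 2, but its
  z^4 coefficient is \<open>rho1 \<theta> * rho2 \<theta>\<close>.\<close>

lemma inf_invariants_pole:
  assumes inv: "inf_invariants \<theta> B" and \<rho>: "rho1 \<theta> \<noteq> 0" "rho2 \<theta> \<noteq> 0"
  shows "pole_inf 2 B"
proof -
  have "False" if B: "\<And>i j. B $ i $ j \<in> lsi 1"
  proof -
    have "det B \<in> lsi 2"
      unfolding det_2 using B by (intro lsi_diff lsi_mult'[of _ 1 _ 1]) auto
    then have "det B - (det B - of_pol [:0, 0, 0, rho1 \<theta> * rho2 \<theta> * (dd1 \<theta> + dd2 \<theta>), rho1 \<theta> * rho2 \<theta>:]) \<in> lsi 2"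
      using inv unfolding inf_invariants_def by (blast intro: lsi_diff)
    then have "of_pol [:0, 0, 0, rho1 \<theta> * rho2 \<theta> * (dd1 \<theta> + dd2 \<theta>), rho1 \<theta> * rho2 \<theta>:] \<in> lsi 2"
      by simp
    then show False using \<rho> by (simp add: lsi_of_pol)
  qed
  then show ?thesis using inv by (auto simp: pole_inf_def inf_invariants_def)
qed

subsection \<open>Frames\<close>

definition is_ring :: "ratfun set \<Rightarrow> bool" where
  "is_ring O' \<longleftrightarrow> 0 \<in> O' \<and> 1 \<in> O' \<and> (\<forall>r\<in>O'. \<forall>s\<in>O'. r + s \<in> O' \<and> r * s \<in> O')"

lemma is_ring_polys: "is_ring polys"
  by (simp add: is_ring_def polys_add polys_mult)

lemma is_ring_lsi: "is_ring (lsi 0)"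
  using lsi_mult[of _ 0 _ 0] by (simp add: is_ring_def lsi_add)

lemma is_ring_local_ring: "is_ring (local_ring x)"
  using local_ring_of_pol[of 1 x] by (simp add: is_ring_def local_ring_add local_ring_mult del: local_ring_of_pol)

definition unit_over :: "ratfun set \<Rightarrow> ratmat \<Rightarrow> bool" where
  "unit_over O' P \<longleftrightarrow> invertible P \<and> (\<forall>i j. P $ i $ j \<in> O') \<and> (\<forall>i j. matrix_inv P $ i $ j \<in> O')"

lemma matrix_mult_in_ring:
  fixes A B :: ratmat
  assumes "is_ring O'" "\<And>i j. A $ i $ j \<in> O'" "\<And>i j. B $ i $ j \<in> O'"
  shows "(A ** B) $ i $ j \<in> O'"
  using assms by (simp add: mult2_nth is_ring_def)

lemma matrix_inv_mult_distrib:
  fixes A B :: ratmat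
  assumes "invertible A" "invertible B"
  shows "matrix_inv (A ** B) = matrix_inv B ** matrix_inv A"
  by (rule matrix_inv_unique)
    (metis assms matrix_inv_mult(2) matrix_mul_assoc matrix_mul_rid)

lemma unit_over_mult:
  assumes "is_ring O'" "unit_over O' P" "unit_over O' Q"
  shows "unit_over O' (P ** Q)"
  using assms matrix_mult_in_ring[OF assms(1)]
  by (auto simp: unit_over_def invertible_mult matrix_inv_mult_distrib)

lemma unit_overI:
  assumes "P ** Q = mat 1" "\<And>i j. P $ i $ j \<in> O'" "\<And>i j. Q $ i $ j \<in> O'"
  shows "unit_over O' P"
  using assms matrix_inv_unique[OF assms(1)] by (simp add: unit_over_def)

lemma column_module_unit:
  assumes ring: "is_ring O'" and P: "unit_over O' P"
  shows "column_module O' (G ** P) = column_module O' G"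
proof -
  have mv: "\<forall>i. (Q *v v) $ i \<in> O'" if "\<forall>i j. Q $ i $ j \<in> O'" "\<forall>i. v $ i \<in> O'" for Q :: ratmat and v
    using that ring by (simp add: matrix_vector_mult_def sum_2 is_ring_def)
  show ?thesis
  proof
    show "column_module O' (G ** P) \<subseteq> column_module O' G"
      unfolding column_module_def using P mv[of P]
      by (auto simp: unit_over_def simp flip: matrix_vector_mul_assoc)
    show "column_module O' G \<subseteq> column_module O' (G ** P)"
    proof
      fix x assume "x \<in> column_module O' G"
      then obtain v where v: "x = G *v v" "\<forall>i. v $ i \<in> O'" by (auto simp: column_module_def)
      have "G = (G ** P) ** matrix_inv P"
        using P by (metis unit_over_def matrix_inv_mult(2) matrix_mul_assoc matrix_mul_rid)
      then have "x = (G ** P) *v (matrix_inv P *v v)"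
        using v(1) by (simp add: matrix_vector_mul_assoc)
      moreover have "\<forall>i. (matrix_inv P *v v) $ i \<in> O'" using P v mv by (simp add: unit_over_def)
      ultimately show "x \<in> column_module O' (G ** P)" by (auto simp: column_module_def)
    qed
  qed
qed

text \<open>It suffices to express the columns of H, the images of the unit vectors, in the frame
  G.\<close>

lemma column_module_eq_entries:
  assumes ring: "is_ring O'" and inv: "invertible G" and sub: "column_module O' H \<subseteq> column_module O' G"
  shows "(matrix_inv G ** H) $ i $ j \<in> O'"
proof -
  have "H *v axis j 1 \<in> column_module O' H"
    using ring by (auto simp: column_module_def is_ring_def axis_def intro!: exI[of _ "axis j 1"])
  then obtain v where v: "H *v axis j 1 = G *v v" "\<forall>i. v $ i \<in> O'"
    using sub by (smt (verit) column_module_def mem_Collect_eq subsetD)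
  have "(matrix_inv G ** H) *v axis j 1 = v"
    using v(1) inv by (metis matrix_inv_mult(1) matrix_vector_mul_assoc matrix_vector_mul_lid)
  moreover have "((matrix_inv G ** H) *v axis j 1) $ i = (matrix_inv G ** H) $ i $ j"
    by (simp add: matrix_vector_mult_def axis_def if_distrib if_distribR sum.delta cong: if_cong)
  ultimately show ?thesis using v(2) by metis
qed

lemma column_module_frame_change:
  assumes ring: "is_ring O'" and "invertible G" "invertible H" "column_module O' G = column_module O' H"
  obtains P where "unit_over O' P" "H = G ** P"
proof -
  let ?P = "matrix_inv G ** H" and ?Q = "matrix_inv H ** G"
  have "?P ** ?Q = mat 1"
    using assms by (metis matrix_inv_mult matrix_mul_assoc matrix_mul_lid)
  then have "unit_over O' ?P"
    using assms column_module_eq_entries[OF ring] by (intro unit_overI[of _ ?Q]) auto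
  moreover have "H = G ** ?P"
    using assms by (metis matrix_inv_mult(2) matrix_mul_assoc matrix_mul_lid)
  ultimately show thesis using that by blast
qed

lemma det_unit_polys:
  assumes "unit_over polys P"
  obtains c where "c \<noteq> 0" "det P = of_pol [:c:]"
proof -
  have "det P \<in> polys" "det (matrix_inv P) \<in> polys"
    using assms by (auto simp: unit_over_def det_2 polys_mult polys_add polys_uminus simp del: add_uminus_conv_diff
        simp flip: add_uminus_conv_diff)
  moreover have "det P * det (matrix_inv P) = 1"
    using assms by (metis unit_over_def det_I det_mul matrix_inv_mult(2))
  ultimately show thesis using polys_unit that by blast
qed

text \<open>A unit of the polynomial ring is a constant, so the shift fixes det P and it
  cancels.\<close>

lemma det_gauge_unit_polys:
  assumes "unit_over polys P"
  shows "det (gauge P A) = det A"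
proof -
  obtain c where c: "c \<noteq> 0" "det P = of_pol [:c:]" using det_unit_polys[OF assms] .
  have "det (gauge P A) * shift (det P) = det A * det P" using assms by (simp add: det_gauge unit_over_def)
  moreover have "shift (det P) = det P" using c by (simp add: pcompose_pCons)
  moreover have "det P \<noteq> 0" using c by simp
  ultimately show ?thesis by simp
qed

lemma gauge_in_ring:
  assumes ring: "is_ring O'" and sh: "\<And>r. r \<in> O' \<Longrightarrow> shift r \<in> O'" and P: "unit_over O' P"
    and A: "\<And>i j. A $ i $ j \<in> O'"
  shows "gauge P A $ i $ j \<in> O'"
  unfolding gauge_def using P sh A
  by (auto intro!: matrix_mult_in_ring[OF ring] simp: unit_over_def simp flip: shift_matrix_inv)

text \<open>K and its shift differ in \<open>lsi (- 2)\<close>, so K times the inverse of the shift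
  is 1 + E with E of order -2. The trace changes by tr(B E), in \<open>lsi 0\<close>, and the
  determinant by a multiple of det B in \<open>lsi 2\<close>: exactly the precision of the
  invariants.\<close>

lemma inf_invariants_gauge:
  assumes inv: "inf_invariants \<theta> B" and K: "unit_over (lsi 0) K"
  shows "inf_invariants \<theta> (gauge K B)"
proof -
  have invK: "invertible K" and Kij: "K $ i $ j \<in> lsi 0" and Lij: "matrix_inv K $ i $ j \<in> lsi 0" for i j
    using K by (auto simp: unit_over_def)
  define L where "L = map_matrix shift (matrix_inv K)"
  have L: "L $ i $ j \<in> lsi 0" for i j using Lij by (simp add: L_def)
  have B: "B $ i $ j \<in> lsi 2" for i j using inv by (simp add: inf_invariants_def)
  have g: "gauge K B = L ** B ** K" using invK by (simp add: gauge_def L_def)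
  have gij: "gauge K B $ i $ j \<in> lsi 2" for i j
    unfolding g mult2_nth using B L Kij
    by (intro lsi_add lsi_mult'[of _ 2 _ 0] lsi_mult'[of _ 0 _ 2]) auto
  have LK: "L ** map_matrix shift K = mat 1" "map_matrix shift K ** L = mat 1"
    using invK matrix_inv_mult[OF invK] by (simp_all add: L_def flip: shift_matrix_mult del: shift_matrix_inv)
  define E where "E = (K - map_matrix shift K) ** L"
  have diff: "(K - map_matrix shift K) $ i $ j \<in> lsi (- 2)" for i j
    using lsi_shift_diff_0[OF Kij[of i j]] lsi_uminus by fastforce
  have E: "E $ i $ j \<in> lsi (- 2)" for i j
    unfolding E_def mult2_nth using diff L by (intro lsi_add lsi_mult'[of _ "-2" _ 0]) auto
  have KL: "K ** L = mat 1 + E"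
    using LK(2) by (simp add: E_def mat2_eq_iff mult2_nth algebra_simps)
  have tr: "gauge K B $ 1 $ 1 + gauge K B $ 2 $ 2 = (B $ 1 $ 1 + B $ 2 $ 2) + ((B ** E) $ 1 $ 1 + (B ** E) $ 2 $ 2)"
  proof -
    have "gauge K B $ 1 $ 1 + gauge K B $ 2 $ 2 = (B ** (K ** L)) $ 1 $ 1 + (B ** (K ** L)) $ 2 $ 2"
      unfolding g by (simp add: mult2_nth algebra_simps)
    then show ?thesis unfolding KL by (simp add: mult2_nth algebra_simps)
  qed
  have "(B ** E) $ 1 $ 1 + (B ** E) $ 2 $ 2 \<in> lsi 0"
    unfolding mult2_nth using B E by (intro lsi_add lsi_mult'[of _ 2 _ "-2"]) auto
  then have T: "gauge K B $ 1 $ 1 + gauge K B $ 2 $ 2 - r \<in> lsi 0" if "B $ 1 $ 1 + B $ 2 $ 2 - r \<in> lsi 0" for r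
    using lsi_add[OF that \<open>(B ** E) $ 1 $ 1 + (B ** E) $ 2 $ 2 \<in> lsi 0\<close>] unfolding tr
    by (simp only: add_diff_eq diff_add_eq)
  have detE: "det (K ** L) - 1 \<in> lsi (- 2)"
  proof -
    have "det (K ** L) - 1 = E $ 1 $ 1 + E $ 2 $ 2 + (E $ 1 $ 1 * E $ 2 $ 2 - E $ 1 $ 2 * E $ 2 $ 1)"
      unfolding KL by (simp add: det_2 algebra_simps)
    moreover have "E $ 1 $ 1 * E $ 2 $ 2 - E $ 1 $ 2 * E $ 2 $ 1 \<in> lsi (- 2)"
      by (intro lsi_diff; rule lsi_mono[OF lsi_mult[OF E E]]) simp_all
    ultimately show ?thesis using E by (simp add: lsi_add)
  qed
  have "det B \<in> lsi 4"
    unfolding det_2 using B by (intro lsi_diff lsi_mult'[of _ 2 _ 2]) auto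
  then have x: "det B * (det (K ** L) - 1) \<in> lsi 2" by (rule lsi_mult'[OF _ detE]) simp
  have "det (gauge K B) = det B + det B * (det (K ** L) - 1)"
    unfolding g by (simp add: det_mul algebra_simps)
  then have D: "det (gauge K B) - r \<in> lsi 2" if "det B - r \<in> lsi 2" for r
    using lsi_add[OF that x] by (simp only: add_diff_eq diff_add_eq)
  show ?thesis using inv gij T D unfolding inf_invariants_def by blast
qed

subsection \<open>Splitting of rank two bundles\<close>

lemma invertible_mk2_diag [simp]: "invertible (mk2 a 0 0 b) \<longleftrightarrow> a \<noteq> 0 \<and> b \<noteq> (0 :: 'a::field)"
  by (simp add: invertible_det_nz det_2)

lemma singular_2:
  fixes a b c d :: complex
  assumes "a * d - b * c = 0"
  shows "(a = 0 \<and> c = 0) \<or> (\<exists>k. b = k * a \<and> d = k * c)"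
proof (cases "a = 0")
  case True
  then show ?thesis using assms by (cases "c = 0") (auto intro: exI[of _ "d / c"])
next
  case False
  then show ?thesis using assms by (intro disjI2 exI[of _ "b / a"]) (simp add: field_simps)
qed

lemma unit_over_elementary:
  assumes "p \<in> polys"
  shows "unit_over polys (mk2 1 p 0 1)"
proof (rule unit_overI)
  show "mk2 1 p 0 1 ** mk2 1 (- p) 0 1 = mat 1" by (simp add: mat2_eq_iff mult2_nth)
  show "mk2 1 p 0 1 $ i $ j \<in> polys" for i j
    using exhaust_2[of i] exhaust_2[of j] assms by auto
  show "mk2 1 (- p) 0 1 $ i $ j \<in> polys" for i j
    using exhaust_2[of i] exhaust_2[of j] assms by (auto intro: polys_uminus)
qed

lemma unit_over_swap: "unit_over polys (mk2 0 1 1 0)"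
proof (rule unit_overI)
  show "mk2 0 1 1 0 ** mk2 0 1 1 0 = (mat 1 :: ratmat)" by (simp add: mat2_eq_iff mult2_nth)
  show "(mk2 0 1 1 0 :: ratmat) $ i $ j \<in> polys" "(mk2 0 1 1 0 :: ratmat) $ i $ j \<in> polys" for i j
    using exhaust_2[of i] exhaust_2[of j] by auto
qed

lemma unit_over_mat_1: "is_ring O' \<Longrightarrow> unit_over O' (mat 1)"
  by (rule unit_overI[of "mat 1" "mat 1"]) (simp, auto simp: is_ring_def mat_def)

definition column_degrees :: "ratmat \<Rightarrow> int \<Rightarrow> int \<Rightarrow> bool" where
  "column_degrees W m1 m2 \<longleftrightarrow> (\<forall>i. W $ i $ 1 \<in> lsi m1 \<and> W $ i $ 2 \<in> lsi m2)"

text \<open>Reduced bases: as long as the leading coefficients of the columns are linearly dependent, a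
  column operation lowers the sum of the column degrees, which is bounded below by the order of
  the determinant.\<close>

lemma birkhoff:
  fixes W :: ratmat
  assumes W: "invertible W"
  obtains P K m1 m2 where "unit_over polys P" "unit_over (lsi 0) K" "m1 \<le> m2"
    "W ** P = K ** mk2 (Zp m1) 0 0 (Zp m2)"
proof -
  define good where "good P m1 m2 \<longleftrightarrow> unit_over polys P \<and> column_degrees (W ** P) m1 m2" for P m1 m2
  have "det W \<noteq> 0" using W by (simp add: invertible_det_nz)
  then obtain k where k: "\<And>l. det W \<in> lsi l \<Longrightarrow> k \<le> l" using lsi_lower_bound by blast
  have bound: "k \<le> m1 + m2" if "good P m1 m2" for P m1 m2
  proof -
    have "unit_over polys P" using that by (simp add: good_def)
    then obtain c where c: "c \<noteq> 0" "det P = of_pol [:c:]" using det_unit_polys by blast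
    have "det (W ** P) \<in> lsi (m1 + m2)"
      using that unfolding good_def column_degrees_def det_2
      by (intro lsi_diff lsi_mult lsi_mult'[of _ m2 _ m1]) auto
    then have "det W * of_pol [:c:] * of_pol [:inverse c:] \<in> lsi (m1 + m2)"
      unfolding det_mul c by (rule lsi_mult'[OF _ lsi_const]) simp
    then have "det W \<in> lsi (m1 + m2)" using c(1) by (simp add: mult.assoc flip: one_pCons)
    then show ?thesis by (rule k)
  qed
  have "\<exists>n::nat. \<forall>i j. W $ i $ j \<in> lsi (int n)"
  proof -
    obtain n1 n2 n3 n4 :: nat where n: "W $ 1 $ 1 \<in> lsi n1" "W $ 1 $ 2 \<in> lsi n2" "W $ 2 $ 1 \<in> lsi n3" "W $ 2 $ 2 \<in> lsi n4"
      by (meson lsi_exists)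
    show ?thesis
      by (rule exI[of _ "n1 + n2 + n3 + n4"])
        (use n in \<open>auto simp: forall_2 intro: lsi_mono\<close>)
  qed
  then obtain n where "good (mat 1) (int n) (int n)"
    using unit_over_mat_1[OF is_ring_polys] by (auto simp: good_def column_degrees_def)
  then have "(\<lambda>(P, m1, m2). good P m1 m2) (mat 1, int n, int n)" by simp
  \<comment> \<open>By \<open>bound\<close> the argument of \<open>nat\<close> is nonnegative, so
    comparing these naturals compares the sums of column degrees.\<close>
  from ex_has_least_nat[where m = "\<lambda>(P, m1, m2). nat (m1 + m2 - k)" and P = "\<lambda>(P, m1, m2). good P m1 m2", OF this]
  obtain P0 l1 l2 where P0: "good P0 l1 l2"
    and "\<And>Q n1 n2. good Q n1 n2 \<Longrightarrow> nat (l1 + l2 - k) \<le> nat (n1 + n2 - k)" by fastforce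
  then have least0: "good Q n1 n2 \<Longrightarrow> l1 + l2 \<le> n1 + n2" for Q n1 n2
    using bound by (smt (verit) nat_le_eq_zle nat_mono_iff)
  \<comment> \<open>Exchanging the columns achieves m1 <= m2, so that z^(m2 - m1) is a polynomial
    and may be used in a column operation.\<close>
  have swap: "good (P0 ** mk2 0 1 1 0) l2 l1"
    using P0 unit_over_mult[OF is_ring_polys _ unit_over_swap, of P0]
    by (simp add: good_def column_degrees_def matrix_mul_assoc mult2_nth[of _ "mk2 0 1 1 0"])
  obtain P m1 m2 where P: "good P m1 m2" and m: "m1 \<le> m2"
    and least: "\<And>Q n1 n2. good Q n1 n2 \<Longrightarrow> m1 + m2 \<le> n1 + n2"
    using P0 swap least0 that by (metis add.commute linear)
  define V where "V = W ** P"
  define K where "K = V ** mk2 (Zp (- m1)) 0 0 (Zp (- m2))"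
  have V: "V $ i $ 1 \<in> lsi m1" "V $ i $ 2 \<in> lsi m2" for i
    using P by (simp_all add: V_def good_def column_degrees_def)
  have Kij: "K $ i $ 1 = V $ i $ 1 * Zp (- m1)" "K $ i $ 2 = V $ i $ 2 * Zp (- m2)" for i
    by (simp_all add: K_def mult2_nth)
  have K: "K $ i $ j \<in> lsi 0" for i j
    using exhaust_2[of j] V[of i] by (auto simp: Kij lsi_Zp_mult)
  have Vij: "V $ i $ 1 = K $ i $ 1 * Zp m1" "V $ i $ 2 = K $ i $ 2 * Zp m2" for i
    by (simp_all add: Kij mult.assoc Zp_mult)
  obtain c11 where c11: "K $ 1 $ 1 - of_pol [:c11:] \<in> lsi (- 1)" using K lsi_leading by blast
  obtain c12 where c12: "K $ 1 $ 2 - of_pol [:c12:] \<in> lsi (- 1)" using K lsi_leading by blast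
  obtain c21 where c21: "K $ 2 $ 1 - of_pol [:c21:] \<in> lsi (- 1)" using K lsi_leading by blast
  obtain c22 where c22: "K $ 2 $ 2 - of_pol [:c22:] \<in> lsi (- 1)" using K lsi_leading by blast
  have prod: "r * s - of_pol [:c * d:] \<in> lsi (- 1)"
    if "r \<in> lsi 0" "r - of_pol [:c:] \<in> lsi (- 1)" "s - of_pol [:d:] \<in> lsi (- 1)" for r s c d
  proof -
    have "r * (s - of_pol [:d:]) \<in> lsi (0 + - 1)" "(r - of_pol [:c:]) * of_pol [:d:] \<in> lsi (- 1 + 0)"
      using that by (intro lsi_mult lsi_const; simp)+
    then have "r * (s - of_pol [:d:]) + (r - of_pol [:c:]) * of_pol [:d:] \<in> lsi (- 1)"
      by (simp add: lsi_add)
    moreover have "r * (s - C) + (r - B) * C = r * s - B * C" for B C :: ratfun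
      by (simp add: algebra_simps)
    ultimately show ?thesis by (simp add: mult.commute)
  qed
  \<comment> \<open>The constant term of det K is the determinant of the leading coefficients c_ij.
    If it vanished, either the first column could be lowered as it stands or the second after
    subtracting a multiple of the first.\<close>
  have "det K \<notin> lsi (- 1)"
  proof
    assume "det K \<in> lsi (- 1)"
    moreover have "det K - (of_pol [:c11 * c22:] - of_pol [:c12 * c21:]) \<in> lsi (- 1)"
    proof -
      have "K $ 1 $ 1 * K $ 2 $ 2 - of_pol [:c11 * c22:] - (K $ 1 $ 2 * K $ 2 $ 1 - of_pol [:c12 * c21:]) \<in> lsi (- 1)"
        by (rule lsi_diff[OF prod[OF K c11 c22] prod[OF K c12 c21]])
      moreover have "x - a - (y - b) = x - y - (a - b)" for x y a b :: ratfun by simp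
      ultimately show ?thesis by (simp only: det_2)
    qed
    ultimately have "det K - (det K - (of_pol [:c11 * c22:] - of_pol [:c12 * c21:])) \<in> lsi (- 1)"
      by (rule lsi_diff)
    then have "of_pol [:c11 * c22 - c12 * c21:] \<in> lsi (- 1)" by simp
    then have "c11 * c22 - c12 * c21 = 0" by (simp only: lsi_const_neg)
    from singular_2[OF this] show False
    proof
      assume "c11 = 0 \<and> c21 = 0"
      then have "K $ 1 $ 1 \<in> lsi (- 1)" "K $ 2 $ 1 \<in> lsi (- 1)" using c11 c21 by simp_all
      then have "V $ i $ 1 \<in> lsi (m1 - 1)" for i
        using exhaust_2[of i] by (auto simp: Vij lsi_Zp_mult)
      then have "good P (m1 - 1) m2" using P V by (simp add: good_def column_degrees_def V_def)
      from least[OF this] show False by simp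
    next
      assume "\<exists>x. c12 = x * c11 \<and> c22 = x * c21"
      then obtain x where x: "c12 = x * c11" "c22 = x * c21" by blast
      have low: "s - of_pol [:x:] * r \<in> lsi (- 1)"
        if "r - of_pol [:c:] \<in> lsi (- 1)" "s - of_pol [:x * c:] \<in> lsi (- 1)" for r s c
      proof -
        have "of_pol [:x:] * (r - of_pol [:c:]) \<in> lsi (0 + - 1)"
          using that by (intro lsi_mult lsi_const)
        then have "s - of_pol [:x * c:] - of_pol [:x:] * (r - of_pol [:c:]) \<in> lsi (- 1)"
          using that by (simp add: lsi_diff)
        moreover have "s - X * C - X * (r - C) = s - X * r" for X C :: ratfun by (simp add: algebra_simps)
        moreover have "of_pol [:x * c:] = of_pol [:x:] * of_pol [:c:]" by simp
        ultimately show ?thesis by (simp only:)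
      qed
      have Klow: "K $ i $ 2 - of_pol [:x:] * K $ i $ 1 \<in> lsi (- 1)" for i
        using exhaust_2[of i] low c11 c12 c21 c22 x by metis
      \<comment> \<open>The factor z^(m2 - m1) aligns the leading terms of the two columns, x is
        their ratio.\<close>
      define t where "t = - (of_pol [:x:] * Zp (m2 - m1))"
      have "t \<in> polys"
      proof -
        have "Zp (m2 - m1) = of_pol (monom 1 (nat (m2 - m1)))" using m by (simp add: of_pol_monom flip: one_pCons)
        then show ?thesis by (simp only: t_def polys_uminus polys_mult of_pol_in_polys)
      qed
      define P' where "P' = P ** mk2 1 t 0 1"
      have W': "(W ** P') $ i $ 1 = V $ i $ 1" "(W ** P') $ i $ 2 = V $ i $ 2 + t * V $ i $ 1" for i
        unfolding P'_def matrix_mul_assoc by (simp_all add: mult2_nth[of _ "mk2 1 t 0 1"] V_def mult.commute)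
      have "V $ i $ 2 + t * V $ i $ 1 = (K $ i $ 2 - of_pol [:x:] * K $ i $ 1) * Zp m2" for i
      proof -
        have "t * V $ i $ 1 = - (of_pol [:x:] * K $ i $ 1) * (Zp (m2 - m1) * Zp m1)"
        proof -
          have "- (a * b) * (u * v) = - (a * u) * (b * v)" for a b u v :: ratfun by simp
          then show ?thesis unfolding t_def Vij .
        qed
        then show ?thesis unfolding Zp_mult Vij(2) by (simp add: left_diff_distrib)
      qed
      then have "V $ i $ 2 + t * V $ i $ 1 \<in> lsi (m2 - 1)" for i
        using Klow by (simp add: lsi_Zp_mult)
      then have "good P' m1 (m2 - 1)"
        using P V unit_over_mult[OF is_ring_polys _ unit_over_elementary[OF \<open>t \<in> polys\<close>], of P]
        by (simp add: good_def column_degrees_def W' P'_def[symmetric])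
      from least[OF this] show False by simp
    qed
  qed
  moreover have "det K \<in> lsi 0"
    unfolding det_2 using K by (intro lsi_diff lsi_mult'[of _ 0 _ 0]) auto
  ultimately have inv: "inverse (det K) \<in> lsi 0"
    using lsi_inverse[of "det K" 0] by simp
  have invK: "invertible K"
    using \<open>det K \<notin> lsi (- 1)\<close> by (metis invertible_det_nz lsi_zero)
  have "matrix_inv K $ i $ j \<in> lsi 0" for i j
    using exhaust_2[of i] exhaust_2[of j] K inv lsi_mult'[OF _ inv, of _ 0 0]
    unfolding matrix_inv_2[OF invK] by (auto simp: divide_inverse intro!: lsi_uminus)
  then have "unit_over (lsi 0) K" using invK K by (simp add: unit_over_def)
  moreover have "W ** P = K ** mk2 (Zp m1) 0 0 (Zp m2)"
    unfolding V_def[symmetric] by (simp add: mat2_eq_iff mult2_nth Vij)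
  ultimately show thesis using that P m by (auto simp: good_def)
qed

subsection \<open>Zeros of the determinant\<close>

lemma prod_linear_dvd:
  fixes D :: "complex poly"
  assumes "finite A" "\<And>a. a \<in> A \<Longrightarrow> poly D a = 0"
  shows "(\<Prod>a\<in>A. [:- a, 1:]) dvd D"
  using assms
proof (induction A arbitrary: D rule: finite_induct)
  case (insert a A)
  then obtain E where E: "D = [:- a, 1:] * E" by (metis insertI1 poly_eq_0_iff_dvd dvdE)
  have "poly E b = 0" if "b \<in> A" for b
    using insert that by (auto simp: E)
  then have "(\<Prod>a\<in>A. [:- a, 1:]) dvd E" by (rule insert.IH)
  then show ?case using insert by (simp add: E mult_dvd_mono del: mult_pCons_left)
qed simp

text \<open>The denominator q does not vanish at x, so the whole power of z - x in the numerator
  divides D.\<close>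

lemma zero_of_order_of_pol:
  "zero_of_order (of_pol D) x m \<longleftrightarrow> (\<exists>E. D = [:- x, 1:] ^ m * E \<and> poly E x \<noteq> 0)"
proof
  assume "zero_of_order (of_pol D) x m"
  then obtain p q where pq: "poly p x \<noteq> 0" "poly q x \<noteq> 0" "of_pol D = Fract ([:- x, 1:] ^ m * p) q"
    by (auto simp: zero_of_order_def)
  then have q: "q \<noteq> 0" by auto
  with pq have eq: "D * q = [:- x, 1:] ^ m * p" by (simp add: eq_fract)
  have "order x q = 0" using pq(2) by (simp add: order_root)
  then have "[:- x, 1:] ^ m dvd D"
    using eq q order_mult[of D q x] by (metis add.right_neutral dvd_triv_left mult_eq_0_iff order_divides)
  then obtain E where E: "D = [:- x, 1:] ^ m * E" by (elim dvdE)
  have "[:- x, 1:] ^ m * (E * q) = [:- x, 1:] ^ m * p" using eq by (simp only: E mult.assoc)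
  then have "E * q = p" by simp
  then show "\<exists>E. D = [:- x, 1:] ^ m * E \<and> poly E x \<noteq> 0" using E pq(1) by auto
next
  assume "\<exists>E. D = [:- x, 1:] ^ m * E \<and> poly E x \<noteq> 0"
  then show "zero_of_order (of_pol D) x m"
    unfolding zero_of_order_def by (metis one_neq_zero poly_1)
qed

definition zero_poly :: "dtype \<Rightarrow> complex poly" where
  "zero_poly \<theta> = (\<Prod>a\<in>set (zeros \<theta>). [:- a, 1:])"

text \<open>A determinant regular everywhere is a polynomial. Divided by \<open>zero_poly\<close> it
  has no root left, neither at the simple zeros nor elsewhere, so the quotient is a
  constant.\<close>

lemma affine_type_iff:
  "affine_type \<theta> B \<longleftrightarrow> (\<forall>i j. B $ i $ j \<in> polys) \<and> (\<exists>\<kappa>. \<kappa> \<noteq> 0 \<and> det B = of_pol (smult \<kappa> (zero_poly \<theta>)))"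
proof
  assume B: "affine_type \<theta> B"
  then have entries: "B $ i $ j \<in> polys" for i j
    by (intro polys_if_regular) (auto simp: affine_type_def)
  have "det B \<in> polys"
    using entries by (simp add: det_2 polys_mult polys_add polys_uminus flip: add_uminus_conv_diff)
  then obtain D where D: "det B = of_pol D" by (rule polysE)
  have ord: "zero_of_order (of_pol D) x (if x \<in> set (zeros \<theta>) then 1 else 0)" for x
    using B D by (simp add: affine_type_def)
  have z: "poly D x = 0" if x: "x \<in> set (zeros \<theta>)" for x
    using ord[of x] x by (auto simp: zero_of_order_of_pol)
  have "zero_poly \<theta> dvd D"
    unfolding zero_poly_def by (rule prod_linear_dvd) (use z in auto)
  then obtain E where E: "D = zero_poly \<theta> * E" by (elim dvdE)
  have "poly E x \<noteq> 0" for x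
  proof
    assume Ex: "poly E x = 0"
    show False
    proof (cases "x \<in> set (zeros \<theta>)")
      case True
      then obtain F where F: "D = [:- x, 1:] * F" "poly F x \<noteq> 0"
        using ord[of x] by (auto simp: zero_of_order_of_pol)
      have "zero_poly \<theta> = [:- x, 1:] * (\<Prod>a\<in>set (zeros \<theta>) - {x}. [:- a, 1:])"
        unfolding zero_poly_def using True by (rule prod.remove[OF finite_set])
      then have "[:- x, 1:] * F = [:- x, 1:] * ((\<Prod>a\<in>set (zeros \<theta>) - {x}. [:- a, 1:]) * E)"
        using E F by (simp only: mult.assoc)
      then have "F = (\<Prod>a\<in>set (zeros \<theta>) - {x}. [:- a, 1:]) * E"
        by (subst (asm) mult_left_cancel) simp_all
      then show False using Ex F by simp
    next
      case False
      then show False using ord[of x] Ex E by (auto simp: zero_of_order_of_pol)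
    qed
  qed
  then have "degree E = 0" using fundamental_theorem_of_algebra constant_degree by blast
  then obtain \<kappa> where \<kappa>: "E = [:\<kappa>:]" using degree_eq_zeroE by blast
  then have "\<kappa> \<noteq> 0" "D = smult \<kappa> (zero_poly \<theta>)" using \<open>\<And>x. poly E x \<noteq> 0\<close> E by auto
  then show "(\<forall>i j. B $ i $ j \<in> polys) \<and> (\<exists>\<kappa>. \<kappa> \<noteq> 0 \<and> det B = of_pol (smult \<kappa> (zero_poly \<theta>)))"
    using entries D by blast
next
  assume *: "(\<forall>i j. B $ i $ j \<in> polys) \<and> (\<exists>\<kappa>. \<kappa> \<noteq> 0 \<and> det B = of_pol (smult \<kappa> (zero_poly \<theta>)))"
  then obtain \<kappa> where \<kappa>: "\<kappa> \<noteq> 0" "det B = of_pol (smult \<kappa> (zero_poly \<theta>))" by blast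
  have "zero_of_order (det B) x (if x \<in> set (zeros \<theta>) then 1 else 0)" for x
  proof (cases "x \<in> set (zeros \<theta>)")
    case True
    have "zero_poly \<theta> = [:- x, 1:] * (\<Prod>a\<in>set (zeros \<theta>) - {x}. [:- a, 1:])"
      unfolding zero_poly_def using True by (rule prod.remove[OF finite_set])
    then have "smult \<kappa> (zero_poly \<theta>) = [:- x, 1:] ^ 1 * smult \<kappa> (\<Prod>a\<in>set (zeros \<theta>) - {x}. [:- a, 1:])"
      by simp
    moreover have "poly (smult \<kappa> (\<Prod>a\<in>set (zeros \<theta>) - {x}. [:- a, 1:])) x \<noteq> 0"
      using \<kappa> by (auto simp: poly_prod)
    ultimately show ?thesis
      using True unfolding \<kappa> zero_of_order_of_pol by (simp only: if_True) blast
  next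
    case False
    then have "poly (smult \<kappa> (zero_poly \<theta>)) x \<noteq> 0"
      using \<kappa> by (auto simp: poly_prod zero_poly_def)
    then show ?thesis using False unfolding \<kappa> zero_of_order_of_pol by auto
  qed
  then show "affine_type \<theta> B" using * by (auto simp: affine_type_def polys_in_local_ring)
qed

text \<open>Each linear factor is assigned to a side on which its root occurs. This distributes the
  zeros of a triangular d-connection over its two diagonal entries.\<close>

lemma linear_factors_split:
  fixes p q :: "complex poly"
  assumes "finite A" "\<kappa> \<noteq> 0" "p * q = smult \<kappa> (\<Prod>i\<in>A. [:- f i, 1:])"
  shows "\<exists>I\<subseteq>A. \<exists>c d. c \<noteq> 0 \<and> d \<noteq> 0 \<and> p = smult c (\<Prod>i\<in>I. [:- f i, 1:]) \<and> q = smult d (\<Prod>i\<in>A-I. [:- f i, 1:])"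
  using assms(1,3)
proof (induction A arbitrary: p q rule: finite_induct)
  case empty
  then have pq: "p * q = [:\<kappa>:]" by simp
  then have "p \<noteq> 0" "q \<noteq> 0" using assms(2) by auto
  moreover have "degree (p * q) = 0" using pq by simp
  ultimately have "degree p = 0" "degree q = 0" by (simp_all add: degree_mult_eq)
  then obtain c d where "p = [:c:]" "q = [:d:]" by (meson degree_eq_zeroE)
  with \<open>p \<noteq> 0\<close> \<open>q \<noteq> 0\<close> show ?case by (intro exI[of _ "{}"]) auto
next
  case (insert a A)
  have eq: "p * q = [:- f a, 1:] * smult \<kappa> (\<Prod>i\<in>A. [:- f i, 1:])"
    using insert by (simp del: mult_pCons_left)
  then have "poly p (f a) * poly q (f a) = 0"
    by (metis poly_mult poly_eq_0_iff_dvd dvd_triv_left)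
  then consider "poly p (f a) = 0" | "poly q (f a) = 0" by auto
  then show ?case
  proof cases
    case 1
    then obtain p' where p': "p = [:- f a, 1:] * p'" by (metis poly_eq_0_iff_dvd dvdE)
    have "[:- f a, 1:] * (p' * q) = [:- f a, 1:] * smult \<kappa> (\<Prod>i\<in>A. [:- f i, 1:])"
      using eq by (simp only: p' mult.assoc)
    then have "p' * q = smult \<kappa> (\<Prod>i\<in>A. [:- f i, 1:])" by (subst (asm) mult_left_cancel) simp_all
    from insert.IH[OF this] obtain I c d where I: "I \<subseteq> A" "c \<noteq> 0" "d \<noteq> 0"
      "p' = smult c (\<Prod>i\<in>I. [:- f i, 1:])" "q = smult d (\<Prod>i\<in>A-I. [:- f i, 1:])" by blast
    have "insert a A - insert a I = A - I" using I insert by auto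
    moreover have "(\<Prod>i\<in>insert a I. [:- f i, 1:]) = [:- f a, 1:] * (\<Prod>i\<in>I. [:- f i, 1:])"
      using I insert finite_subset by (subst prod.insert) auto
    ultimately show ?thesis using I by (intro exI[of _ "insert a I"]) (auto simp: p' simp del: mult_pCons_left)
  next
    case 2
    then obtain q' where q': "q = [:- f a, 1:] * q'" by (metis poly_eq_0_iff_dvd dvdE)
    have "[:- f a, 1:] * (p * q') = [:- f a, 1:] * smult \<kappa> (\<Prod>i\<in>A. [:- f i, 1:])"
      using eq by (simp only: q' mult_ac)
    then have "p * q' = smult \<kappa> (\<Prod>i\<in>A. [:- f i, 1:])" by (subst (asm) mult_left_cancel) simp_all
    from insert.IH[OF this] obtain I c d where I: "I \<subseteq> A" "c \<noteq> 0" "d \<noteq> 0"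
      "p = smult c (\<Prod>i\<in>I. [:- f i, 1:])" "q' = smult d (\<Prod>i\<in>A-I. [:- f i, 1:])" by blast
    have "insert a A - I = insert a (A - I)" using I insert by auto
    moreover have "(\<Prod>i\<in>insert a (A - I). [:- f i, 1:]) = [:- f a, 1:] * (\<Prod>i\<in>A-I. [:- f i, 1:])"
      using I insert by (subst prod.insert) auto
    ultimately show ?thesis using I by (intro exI[of _ I]) (auto simp: q' simp del: mult_pCons_left)
  qed
qed

subsection \<open>D-connections in a global splitting\<close>

definition pv_type :: "dtype \<Rightarrow> bool" where
  "pv_type \<theta> \<longleftrightarrow> nondegenerate \<theta> \<and> deg_type \<theta> = - 1 \<and> pord \<theta> = 2"

lemma pv_type_simps:
  assumes "pv_type \<theta>"
  shows "pord \<theta> = 2" "rho1 \<theta> \<noteq> 0" "rho2 \<theta> \<noteq> 0" "rho1 \<theta> \<noteq> rho2 \<theta>" "length (zeros \<theta>) = 4" "distinct (zeros \<theta>)"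
    "sum_list (zeros \<theta>) = 1 - dd1 \<theta> - dd2 \<theta>"
proof -
  show 4: "pord \<theta> = 2" "rho1 \<theta> \<noteq> 0" "rho2 \<theta> \<noteq> 0" "rho1 \<theta> \<noteq> rho2 \<theta>" "length (zeros \<theta>) = 4"
    using assms by (auto simp: pv_type_def nondegenerate_def)
  show "sum_list (zeros \<theta>) = 1 - dd1 \<theta> - dd2 \<theta>"
    using assms by (auto simp: pv_type_def deg_type_def algebra_simps eq_neg_iff_add_eq_0)
  have "zeros \<theta> ! i \<noteq> zeros \<theta> ! j" if "i < length (zeros \<theta>)" "j < length (zeros \<theta>)" "i \<noteq> j" for i j
    using assms that unfolding pv_type_def nondegenerate_def by (metis Ints_0 diff_self)
  then show "distinct (zeros \<theta>)" by (simp add: distinct_conv_nth)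
qed

lemma pv_type_not_int:
  assumes "pv_type \<theta>" "I \<subseteq> {..<4}"
  shows "- dd1 \<theta> - (\<Sum>i\<in>I. zeros \<theta> ! i) \<notin> \<int>" "- dd2 \<theta> - (\<Sum>i\<in>I. zeros \<theta> ! i) \<notin> \<int>"
  using assms unfolding pv_type_def nondegenerate_def by auto

lemma pv_type_zeros_diff:
  assumes "pv_type \<theta>" "x \<in> set (zeros \<theta>)" "y \<in> set (zeros \<theta>)" "x - y \<in> \<int>"
  shows "x = y"
  using assms unfolding pv_type_def nondegenerate_def by (metis in_set_conv_nth)

lemma zero_poly_nth:
  assumes "pv_type \<theta>"
  shows "zero_poly \<theta> = (\<Prod>i<4. [:- (zeros \<theta> ! i), 1:])"
proof -
  have "set (zeros \<theta>) = (!) (zeros \<theta>) ` {..<4}"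
    using pv_type_simps(5)[OF assms] by (auto simp: set_conv_nth)
  moreover have "inj_on ((!) (zeros \<theta>)) {..<4}"
    using pv_type_simps(5,6)[OF assms] by (auto intro: inj_on_nth)
  ultimately show ?thesis by (simp add: zero_poly_def prod.reindex)
qed

text \<open>The z^3 coefficient is minus the sum of the zeros. The summand -1, which is deg
  \<theta>, is what fixes the degree of the bundle later.\<close>

lemma zero_poly_coeffs:
  assumes "pv_type \<theta>"
  shows "coeff (zero_poly \<theta>) 4 = 1" "coeff (zero_poly \<theta>) 3 = dd1 \<theta> + dd2 \<theta> - 1" "degree (zero_poly \<theta>) = 4"
proof -
  obtain a b c d where z: "zeros \<theta> = [a, b, c, d]"
    using pv_type_simps(5)[OF assms] by (auto simp: length_Suc_conv numeral_eq_Suc)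
  have p: "zero_poly \<theta> = [:- a, 1:] * [:- b, 1:] * [:- c, 1:] * [:- d, 1:]"
    using pv_type_simps(6)[OF assms] by (simp add: zero_poly_def z mult.assoc del: mult_pCons_left mult_pCons_right)
  show "coeff (zero_poly \<theta>) 4 = 1" by (simp add: p numeral_eq_Suc)
  have "coeff (zero_poly \<theta>) 3 = - sum_list (zeros \<theta>)" by (simp add: p z numeral_eq_Suc)
  then show "coeff (zero_poly \<theta>) 3 = dd1 \<theta> + dd2 \<theta> - 1"
    using pv_type_simps(7)[OF assms] by simp
  show "degree (zero_poly \<theta>) = 4"
    unfolding zero_poly_nth[OF assms] by (subst degree_prod_eq_sum_degree) auto
qed

section \<open>Effect of the bundle degrees on the leading coefficients at infinity\<close>

lemma inf_coeff_of_pol: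
  "fps_nth (inf_coeff (of_pol p * Zp (- int n))) k = (if k \<le> n then coeff p (n - k) else 0)"
proof -
  have "expand_inf (of_pol p * Zp (- int n)) = fls_X ^ n * expand_poly_inf p"
    by (simp add: expand_inf_Zp expand_inf_of_pol power_int_minus fls_inverse_X_inv power_inverse mult.commute
        flip: power_inverse)
  then have "fps_nth (inf_coeff (of_pol p * Zp (- int n))) k = fls_nth (expand_poly_inf p) (int k - int n)"
    by (simp add: inf_coeff_def fls_X_power_times_conv_shift)
  then show ?thesis by (simp add: expand_poly_inf_nth nat_diff_distrib)
qed

text \<open>The factor (1 + w)^m = 1 + m w + ... by which a basis vector z^m of the frame at
  infinity alters the d-connection; it mixes the integers m with the parameters d_j.\<close>

definition twist :: "int \<Rightarrow> ratfun" where
  "twist m = shift (Zp m) * Zp (- m)"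

lemma twist_in_lsi: "twist m \<in> lsi 0"
  unfolding twist_def by (rule lsi_mult'[of _ m _ "- m"]) (simp_all add: Zp_in_lsi)

lemma twist_add: "twist (m + n) = twist m * twist n"
proof -
  have "shift (Zp (m + n)) * Zp (- (m + n)) = shift (Zp m * Zp n) * (Zp (- m) * Zp (- n))"
    by (simp add: Zp_mult add.commute)
  then show ?thesis by (simp add: twist_def mult_ac)
qed

lemma twist_coeffs:
  "fps_nth (inf_coeff (twist m)) 0 = 1" "fps_nth (inf_coeff (twist m)) (Suc 0) = of_int m"
proof -
  have tw1: "twist 1 = of_pol [:1, 1:] * Zp (- int 1)"
    by (simp add: twist_def Zp_def pcompose_pCons)
  have 1: "fps_nth (inf_coeff (twist 1)) 0 = 1" "fps_nth (inf_coeff (twist 1)) (Suc 0) = 1"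
    unfolding tw1 inf_coeff_of_pol by simp_all
  have step: "inf_coeff (twist (n + 1)) = inf_coeff (twist n) * inf_coeff (twist 1)" for n
    by (simp add: twist_add inf_coeff_mult twist_in_lsi)
  have "fps_nth (inf_coeff (twist m)) 0 = 1 \<and> fps_nth (inf_coeff (twist m)) (Suc 0) = of_int m"
  proof (induction m rule: int_induct[of _ 0])
    case base
    have "inf_coeff (twist 0) = 1" using inf_coeff_const[of 1] by (simp add: twist_def flip: one_pCons)
    then show ?case by simp
  next
    case (step1 i)
    then show ?case using 1 by (simp add: step fps_mult_nth_1[simplified])
  next
    case (step2 i)
    have "inf_coeff (twist i) = inf_coeff (twist (i - 1)) * inf_coeff (twist 1)"
      using step[of "i - 1"] by simp
    then have "fps_nth (inf_coeff (twist (i - 1))) 0 = 1 \<and> fps_nth (inf_coeff (twist (i - 1))) (Suc 0) + 1 = of_int i"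
      using 1 step2 by (auto simp: fps_mult_nth_1[simplified] add.commute)
    then show ?case by (simp add: eq_diff_eq)
  qed
  then show "fps_nth (inf_coeff (twist m)) 0 = 1" "fps_nth (inf_coeff (twist m)) (Suc 0) = of_int m"
    by simp_all
qed

lemma twist_mult_coeffs:
  assumes "r \<in> lsi 0"
  shows "fps_nth (inf_coeff (twist m * r)) 0 = fps_nth (inf_coeff r) 0"
    "fps_nth (inf_coeff (twist m * r)) (Suc 0) = fps_nth (inf_coeff r) (Suc 0) + of_int m * fps_nth (inf_coeff r) 0"
  by (simp_all add: inf_coeff_mult twist_in_lsi assms fps_mult_nth_1[simplified] twist_coeffs)

text \<open>The matrix C rewritten in the frame at infinity of O(-m1) + O(-m2), see
  \<open>gauge_diag\<close>.\<close>

definition inf_twisted :: "int \<Rightarrow> int \<Rightarrow> ratmat \<Rightarrow> ratmat" where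
  "inf_twisted m1 m2 C = mk2 (shift (Zp m1) * C $ 1 $ 1 * Zp (- m1)) (shift (Zp m1) * C $ 1 $ 2 * Zp (- m2))
     (shift (Zp m2) * C $ 2 $ 1 * Zp (- m1)) (shift (Zp m2) * C $ 2 $ 2 * Zp (- m2))"

lemma gauge_diag: "gauge (mk2 (Zp (- m1)) 0 0 (Zp (- m2))) C = inf_twisted m1 m2 C"
proof -
  have "shift (Zp (- m)) * (shift (Zp m) * r) = r" for m r
    by (simp add: Zp_mult flip: mult.assoc shift_mult)
  then show ?thesis
    by (subst gauge_eq_iff) (simp_all add: inf_twisted_def mat2_eq_iff mult2_nth mult.assoc)
qed

lemma det_of_pol [simp]: "det (map_matrix of_pol B) = of_pol (det B)" for B :: "complex poly^2^2"
  by (simp add: det_2)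

lemma shift_Zp_in_lsi: "shift (Zp m) * r * Zp (- n) \<in> lsi k \<longleftrightarrow> r \<in> lsi (k + n - m)"
proof
  have *: "inverse (shift (Zp m)) * Zp n * (shift (Zp m) * r * Zp (- n)) = r"
    by (simp add: mult_ac Zp_mult_assoc)
  assume "shift (Zp m) * r * Zp (- n) \<in> lsi k"
  moreover have "inverse (shift (Zp m)) * Zp n \<in> lsi (n - m)"
    by (rule lsi_mult'[of _ "- m" _ n]) (auto intro!: lsi_inverse simp: Zp_in_lsi)
  ultimately have "inverse (shift (Zp m)) * Zp n * (shift (Zp m) * r * Zp (- n)) \<in> lsi (k + n - m)"
    by (auto intro: lsi_mult'[of _ "n - m" _ k])
  then show "r \<in> lsi (k + n - m)" by (simp only: *)
next
  assume "r \<in> lsi (k + n - m)"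
  then have "shift (Zp m) * r \<in> lsi (k + n)"
    by (intro lsi_mult'[of _ m _ "k + n - m"]) (auto simp: Zp_in_lsi)
  then show "shift (Zp m) * r * Zp (- n) \<in> lsi k" by (simp add: lsi_Zp_mult)
qed

text \<open>Each diagonal entry acquires a factor \<open>twist\<close>, which adds m times the
  leading coefficient to the next one. The determinant acquires both factors.\<close>

lemma inf_invariants_twisted:
  fixes B :: "complex poly^2^2"
  shows "inf_invariants \<theta> (inf_twisted m1 m2 (map_matrix of_pol B)) \<longleftrightarrow>
    of_pol (B $ 1 $ 1) \<in> lsi 2 \<and> of_pol (B $ 1 $ 2) \<in> lsi (2 + m2 - m1) \<and>
    of_pol (B $ 2 $ 1) \<in> lsi (2 + m1 - m2) \<and> of_pol (B $ 2 $ 2) \<in> lsi 2 \<and>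
    coeff (B $ 1 $ 1) 2 + coeff (B $ 2 $ 2) 2 = rho1 \<theta> + rho2 \<theta> \<and>
    coeff (B $ 1 $ 1) 1 + of_int m1 * coeff (B $ 1 $ 1) 2 + coeff (B $ 2 $ 2) 1 + of_int m2 * coeff (B $ 2 $ 2) 2
      = rho1 \<theta> * dd1 \<theta> + rho2 \<theta> * dd2 \<theta> \<and>
    coeff (det B) 4 = rho1 \<theta> * rho2 \<theta> \<and>
    coeff (det B) 3 + of_int (m1 + m2) * coeff (det B) 4 = rho1 \<theta> * rho2 \<theta> * (dd1 \<theta> + dd2 \<theta>)"
    (is "?L \<longleftrightarrow> ?R1 \<and> ?R2 \<and> ?R3 \<and> ?R4 \<and> ?R5")
proof -
  let ?C = "inf_twisted m1 m2 (map_matrix of_pol B)"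
  have entries: "(\<forall>i j. ?C $ i $ j \<in> lsi 2) \<longleftrightarrow> ?R1 \<and> ?R2 \<and> ?R3 \<and> ?R4"
    by (simp add: forall_2 inf_twisted_def shift_Zp_in_lsi)
  show ?thesis
  proof (cases "\<forall>i j. ?C $ i $ j \<in> lsi 2")
    case True
    then have C: "?C $ i $ j \<in> lsi 2" for i j by blast
    have R: "?R1" "?R2" "?R3" "?R4" using True entries by blast+
    have diag: "?C $ 1 $ 1 * Zp (- 2) = twist m1 * (of_pol (B $ 1 $ 1) * Zp (- int 2))"
      "?C $ 2 $ 2 * Zp (- 2) = twist m2 * (of_pol (B $ 2 $ 2) * Zp (- int 2))"
      by (simp_all add: inf_twisted_def twist_def mult_ac)
    have l: "of_pol (B $ 1 $ 1) * Zp (- int 2) \<in> lsi 0" "of_pol (B $ 2 $ 2) * Zp (- int 2) \<in> lsi 0"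
      using R by (simp_all add: lsi_Zp_mult)
    have tr: "fps_nth (inf_series ?C $ 1 $ 1 + inf_series ?C $ 2 $ 2) 0 = coeff (B $ 1 $ 1) 2 + coeff (B $ 2 $ 2) 2"
      "fps_nth (inf_series ?C $ 1 $ 1 + inf_series ?C $ 2 $ 2) (Suc 0) =
        coeff (B $ 1 $ 1) 1 + of_int m1 * coeff (B $ 1 $ 1) 2 + coeff (B $ 2 $ 2) 1 + of_int m2 * coeff (B $ 2 $ 2) 2"
      unfolding inf_series_nth diag fps_add_nth twist_mult_coeffs[OF l(1)] twist_mult_coeffs[OF l(2)] inf_coeff_of_pol
      by simp_all
    have "det ?C = twist m1 * (twist m2 * of_pol (det B))"
    proof -
      have "det (mk2 (s1 * a * z1) (s1 * b * z2) (s2 * c * z1) (s2 * d * z2)) = s1 * z1 * (s2 * z2 * (a * d - b * c))"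
        for s1 s2 z1 z2 a b c d :: ratfun by (simp add: det_2 algebra_simps)
      then show ?thesis unfolding inf_twisted_def twist_def by (simp add: det_2)
    qed
    then have detC: "det ?C * Zp (- 4) = twist m1 * (twist m2 * (of_pol (det B) * Zp (- int 4)))"
      by (simp add: mult.assoc)
    have "det ?C \<in> lsi 4"
      unfolding det_2 using C by (intro lsi_diff lsi_mult'[of _ 2 _ 2]) auto
    have "of_pol (det B) \<in> lsi 4"
    proof -
      have "of_pol (B $ 1 $ 1) * of_pol (B $ 2 $ 2) - of_pol (B $ 1 $ 2) * of_pol (B $ 2 $ 1) \<in> lsi 4"
        using R by (intro lsi_diff lsi_mult'[of _ 2 _ 2] lsi_mult'[of _ "2 + m2 - m1" _ "2 + m1 - m2"]) auto
      then show ?thesis by (simp add: det_2)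
    qed
    then have l4: "of_pol (det B) * Zp (- int 4) \<in> lsi 0" by (simp add: lsi_Zp_mult)
    then have l4': "twist m2 * (of_pol (det B) * Zp (- int 4)) \<in> lsi 0"
      using lsi_mult[OF twist_in_lsi] by fastforce
    have dt: "fps_nth (det (inf_series ?C)) 0 = coeff (det B) 4"
      "fps_nth (det (inf_series ?C)) (Suc 0) = coeff (det B) 3 + of_int (m1 + m2) * coeff (det B) 4"
      unfolding det_inf_series[OF C] detC twist_mult_coeffs[OF l4'] twist_mult_coeffs[OF l4] inf_coeff_of_pol
      by (simp_all add: algebra_simps)
    show ?thesis
      unfolding inf_invariants_iff formal_invariants_def tr dt using True entries by blast
  next
    case False
    then show ?thesis using entries unfolding inf_invariants_iff by blast
  qed
qed

subsection \<open>Independence of the frames\<close>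

text \<open>\<open>of_type\<close> asks for some frames; here arbitrary ones may be tested. Another
  affine frame differs by a unit over the polynomials, which keeps the determinant, and another
  frame at infinity keeps \<open>inf_invariants\<close>.\<close>

lemma of_type_iff:
  assumes pv: "pv_type \<theta>" and G: "affine_frame L G" and H: "inf_frame L H"
  shows "of_type \<theta> (L, A) \<longleftrightarrow> affine_type \<theta> (gauge G A) \<and> inf_invariants \<theta> (gauge H A)"
proof
  note pvs = pv_type_simps[OF pv]
  have G': "invertible G" "fst L = column_module polys G" and H': "invertible H" "snd L = column_module (lsi 0) H"
    using G H by (auto simp: affine_frame_def inf_frame_def lsi_0_eq)
  {
    assume "of_type \<theta> (L, A)"
    then obtain G1 H1 where 1: "affine_frame L G1" "affine_type \<theta> (gauge G1 A)"
      "inf_frame L H1" "pole_inf 2 (gauge H1 A)" "formal_type_inf \<theta> (gauge H1 A)"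
      using pvs by (auto simp: of_type_def)
    then have G1: "invertible G1" "fst L = column_module polys G1" and H1: "invertible H1" "snd L = column_module (lsi 0) H1"
      by (auto simp: affine_frame_def inf_frame_def lsi_0_eq)
    obtain P where P: "unit_over polys P" "G = G1 ** P"
      using column_module_frame_change[OF is_ring_polys G1(1) G'(1)] G1 G' by metis
    obtain K where K: "unit_over (lsi 0) K" "H = H1 ** K"
      using column_module_frame_change[OF is_ring_lsi H1(1) H'(1)] H1 H' by metis
    have g: "gauge G A = gauge P (gauge G1 A)" and h: "gauge H A = gauge K (gauge H1 A)"
      using P K G1 H1 by (simp_all add: gauge_mult unit_over_def)
    have "affine_type \<theta> (gauge G A)"
      using 1(2) gauge_in_ring[OF is_ring_polys shift_in_polys P(1)] det_gauge_unit_polys[OF P(1)]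
      unfolding affine_type_iff g by auto
    moreover have "inf_invariants \<theta> (gauge H1 A)"
      using formal_type_inf_iff_invariants[OF _ pvs(1) pvs(4,2,3)] 1(4,5) by (auto simp: pole_inf_def)
    then have "inf_invariants \<theta> (gauge H A)" unfolding h using K(1) by (rule inf_invariants_gauge)
    ultimately show "affine_type \<theta> (gauge G A) \<and> inf_invariants \<theta> (gauge H A)" by blast
  next
    assume *: "affine_type \<theta> (gauge G A) \<and> inf_invariants \<theta> (gauge H A)"
    then have "pole_inf 2 (gauge H A)" using inf_invariants_pole pvs by blast
    moreover have "formal_type_inf \<theta> (gauge H A)"
      using formal_type_inf_iff_invariants[OF _ pvs(1) pvs(4,2,3)] * by (auto simp: inf_invariants_def)
    ultimately show "of_type \<theta> (L, A)"
      using * G H pvs by (auto simp: of_type_def is_bundle_def)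
  }
qed

section \<open>Frames of isomorphic bundles and of split bundles\<close>

lemma image_column_module: "(*v) S ` column_module O' G = column_module O' (S ** G)"
  unfolding column_module_def by (auto simp: matrix_vector_mul_assoc image_iff)
    (metis matrix_vector_mul_assoc)

lemma bundle_iso_frames:
  assumes S: "bundle_iso S L L'"
  shows "affine_frame L G \<Longrightarrow> affine_frame L' (S ** G)" "inf_frame L H \<Longrightarrow> inf_frame L' (S ** H)"
  using S by (auto simp: bundle_iso_def affine_frame_def inf_frame_def invertible_mult simp flip: image_column_module)

lemma bundle_iso_of_frames:
  assumes "affine_frame L G" "affine_frame L' (S ** G)" "inf_frame L H" "inf_frame L' (S ** H)" "invertible S"
  shows "bundle_iso S L L'"
  using assms by (auto simp: bundle_iso_def affine_frame_def inf_frame_def simp flip: image_column_module)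

lemma affine_frame_split: "affine_frame (split_bundle k l) (mat 1)"
  by (auto simp: affine_frame_def split_bundle_def column_module_def invertible_det_nz)

lemma inf_frame_split: "inf_frame (split_bundle k l) (mk2 (Zp k) 0 0 (Zp l))"
proof -
  have mv: "(mk2 a 0 0 b *v v) $ 1 = a * v $ 1" "(mk2 a 0 0 b *v v) $ 2 = b * v $ 2" for a b :: ratfun and v
    by (simp_all add: matrix_vector_mult_def sum_2)
  have "{v. v $ 1 \<in> lsi k \<and> v $ 2 \<in> lsi l} = column_module (lsi 0) (mk2 (Zp k) 0 0 (Zp l))"
  proof (intro set_eqI iffI)
    fix v :: "ratfun^2" assume v: "v \<in> {v. v $ 1 \<in> lsi k \<and> v $ 2 \<in> lsi l}"
    let ?u = "vector [Zp (- k) * v $ 1, Zp (- l) * v $ 2] :: ratfun^2"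
    have "v = mk2 (Zp k) 0 0 (Zp l) *v ?u"
      by (simp add: vec_eq_iff forall_2 mv Zp_mult_assoc)
    moreover have "\<forall>i. ?u $ i \<in> lsi 0" using v by (simp add: forall_2 lsi_mult_Zp)
    ultimately show "v \<in> column_module (lsi 0) (mk2 (Zp k) 0 0 (Zp l))" by (auto simp: column_module_def)
  next
    fix v assume "v \<in> column_module (lsi 0) (mk2 (Zp k) 0 0 (Zp l))"
    then show "v \<in> {v. v $ 1 \<in> lsi k \<and> v $ 2 \<in> lsi l}"
      by (auto simp: column_module_def mv lsi_mult_Zp)
  qed
  then show ?thesis by (simp add: inf_frame_def split_bundle_def lsi_0_eq)
qed

lemma of_type_transport:
  assumes pv: "pv_type \<theta>" and S: "bundle_iso S L L'" and L: "is_bundle L"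
  shows "of_type \<theta> (L', A) \<longleftrightarrow> of_type \<theta> (L, gauge S A)"
proof -
  obtain G H where GH: "affine_frame L G" "inf_frame L H" using L by (auto simp: is_bundle_def)
  have "invertible S" "invertible G" "invertible H"
    using S GH by (auto simp: bundle_iso_def affine_frame_def inf_frame_def)
  then show ?thesis
    using of_type_iff[OF pv GH] of_type_iff[OF pv bundle_iso_frames(1)[OF S GH(1)] bundle_iso_frames(2)[OF S GH(2)]]
    by (simp add: gauge_mult)
qed

lemma is_bundle_split: "is_bundle (split_bundle k l)"
  using affine_frame_split inf_frame_split unfolding is_bundle_def by blast

lemma of_type_split:
  assumes "pv_type \<theta>"
  shows "of_type \<theta> (split_bundle (- m1) (- m2), C) \<longleftrightarrow> affine_type \<theta> C \<and> inf_invariants \<theta> (inf_twisted m1 m2 C)"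
  using of_type_iff[OF assms affine_frame_split inf_frame_split] by (simp add: gauge_diag)

text \<open>Comparing the coefficients of z^4 and z^3 in the determinant with
  \<open>zero_poly\<close> gives both \<kappa> = \<open>rho1 \<theta> * rho2 \<theta>\<close> and m1
  + m2 = 1, that is, bundle degree deg \<theta> = -1.\<close>

lemma of_type_split_polys:
  assumes pv: "pv_type \<theta>"
  shows "of_type \<theta> (split_bundle (- m1) (- m2), map_matrix of_pol B) \<longleftrightarrow>
    of_pol (B $ 1 $ 1) \<in> lsi 2 \<and> of_pol (B $ 1 $ 2) \<in> lsi (2 + m2 - m1) \<and>
    of_pol (B $ 2 $ 1) \<in> lsi (2 + m1 - m2) \<and> of_pol (B $ 2 $ 2) \<in> lsi 2 \<and>
    coeff (B $ 1 $ 1) 2 + coeff (B $ 2 $ 2) 2 = rho1 \<theta> + rho2 \<theta> \<and>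
    coeff (B $ 1 $ 1) 1 + of_int m1 * coeff (B $ 1 $ 1) 2 + coeff (B $ 2 $ 2) 1 + of_int m2 * coeff (B $ 2 $ 2) 2
      = rho1 \<theta> * dd1 \<theta> + rho2 \<theta> * dd2 \<theta> \<and>
    det B = smult (rho1 \<theta> * rho2 \<theta>) (zero_poly \<theta>) \<and> m1 + m2 = 1"
proof -
  note pvs = pv_type_simps[OF pv] and zp = zero_poly_coeffs[OF pv]
  have aff: "affine_type \<theta> (map_matrix of_pol B) \<longleftrightarrow> (\<exists>\<kappa>. \<kappa> \<noteq> 0 \<and> det B = smult \<kappa> (zero_poly \<theta>))"
    unfolding affine_type_iff by (simp add: det_of_pol)
  have deg: "\<kappa> \<noteq> 0 \<and> det B = smult \<kappa> (zero_poly \<theta>) \<Longrightarrow>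
     coeff (det B) 4 = rho1 \<theta> * rho2 \<theta> \<and>
     coeff (det B) 3 + of_int (m1 + m2) * coeff (det B) 4 = rho1 \<theta> * rho2 \<theta> * (dd1 \<theta> + dd2 \<theta>) \<longleftrightarrow>
     \<kappa> = rho1 \<theta> * rho2 \<theta> \<and> m1 + m2 = 1" for \<kappa>
  proof -
    assume \<kappa>: "\<kappa> \<noteq> 0 \<and> det B = smult \<kappa> (zero_poly \<theta>)"
    have c: "coeff (det B) 4 = \<kappa>" "coeff (det B) 3 = \<kappa> * (dd1 \<theta> + dd2 \<theta> - 1)" using \<kappa> zp by simp_all
    have "\<kappa> * (dd1 \<theta> + dd2 \<theta> - 1) + of_int (m1 + m2) * \<kappa> = \<kappa> * (dd1 \<theta> + dd2 \<theta>) \<longleftrightarrow> \<kappa> * of_int (m1 + m2) = \<kappa> * 1"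
      by (simp add: algebra_simps)
    also have "\<dots> \<longleftrightarrow> m1 + m2 = 1" using \<kappa> by (metis mult_left_cancel of_int_eq_1_iff)
    finally show ?thesis unfolding c by auto
  qed
  have "rho1 \<theta> * rho2 \<theta> \<noteq> 0" using pvs by simp
  then show ?thesis
    unfolding of_type_split[OF pv] inf_invariants_twisted aff using deg by blast
qed

subsection \<open>The underlying bundle\<close>

lemma lsi_of_pol_nat: "of_pol p \<in> lsi (int n) \<longleftrightarrow> degree p \<le> n"
  by (auto simp: lsi_of_pol)

text \<open>An invariant line subbundle would have a d-connection whose zeros \<open>I\<close> and leading term \<open>\<rho>\<^sub>j\<close>
  at infinity force its degree to be \<open>- d\<^sub>j - (\<Sum>i\<in>I. a\<^sub>i)\<close>, which is not an integer.\<close>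

lemma lower_left_nonzero:
  assumes pv: "pv_type \<theta>" and B: "of_type \<theta> (split_bundle (- m1) (- m2), map_matrix of_pol B)"
  shows "B $ 2 $ 1 \<noteq> 0"
proof
  assume 0: "B $ 2 $ 1 = 0"
  note pvs = pv_type_simps[OF pv]
  let ?p = "B $ 1 $ 1" and ?q = "B $ 2 $ 2" and ?f = "(!) (zeros \<theta>)"
  let ?\<kappa> = "rho1 \<theta> * rho2 \<theta>"
  note B' = B[unfolded of_type_split_polys[OF pv]]
  have deg: "degree ?p \<le> 2" "degree ?q \<le> 2"
    using B' lsi_of_pol_nat[of _ 2] by auto
  have pq: "?p * ?q = smult ?\<kappa> (\<Prod>i\<in>{..<4}. [:- ?f i, 1:])"
    using B' 0 by (simp add: det_2 zero_poly_nth[OF pv])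
  have \<kappa>: "?\<kappa> \<noteq> 0" using pvs by simp
  obtain I c d where I: "I \<subseteq> {..<4}" "c \<noteq> 0" "d \<noteq> 0" and p: "?p = smult c (\<Prod>i\<in>I. [:- ?f i, 1:])"
    and q: "?q = smult d (\<Prod>i\<in>{..<4}-I. [:- ?f i, 1:])"
    using linear_factors_split[OF finite_lessThan \<kappa> pq] by blast
  \<comment> \<open>Both diagonal entries have degree at most 2 and together they carry four zeros,
    so each has exactly two.\<close>
  have card: "card I \<le> 2" "card ({..<4} - I) \<le> 2"
    using deg I by (simp_all add: p q degree_prod_eq_sum_degree)
  have "finite I" using I finite_subset by blast
  then have "card I + card ({..<4} - I) = 4"
    using I card_Diff_subset[of I "{..<4::nat}"] card_mono[of "{..<4::nat}" I] by simp
  with card have "card I = 2" "card ({..<4} - I) = 2" by auto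
  then obtain i j k l where ij: "I = {i, j}" "i \<noteq> j" and kl: "{..<4} - I = {k, l}" "k \<noteq> l"
    by (auto simp: card_2_iff)
  have p2: "?p = smult c ([:- ?f i, 1:] * [:- ?f j, 1:])" using p ij by simp
  have q2: "?q = smult d ([:- ?f k, 1:] * [:- ?f l, 1:])" using q kl by simp
  have co: "coeff ?p 2 = c" "coeff ?p 1 = - c * (?f i + ?f j)" "coeff ?q 2 = d" "coeff ?q 1 = - d * (?f k + ?f l)"
    unfolding p2 q2 by (simp_all add: numeral_2_eq_2 algebra_simps)
  have s: "c + d = rho1 \<theta> + rho2 \<theta>" using B' co by simp
  have cd: "c * d = ?\<kappa>"
  proof -
    have "coeff (?p * ?q) 4 = ?\<kappa>"
      using pq zero_poly_coeffs(1)[OF pv] by (simp add: zero_poly_nth[OF pv])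
    moreover have "coeff (?p * ?q) 4 = c * d" unfolding p2 q2 by (simp add: numeral_eq_Suc)
    ultimately show ?thesis by simp
  qed
  \<comment> \<open>In the frame at infinity the diagonal entries are c z^2 (1 + X/z + ...) and d
    z^2 (1 + Y/z + ...).\<close>
  define X Y where "X = of_int m1 - (?f i + ?f j)" and "Y = of_int m2 - (?f k + ?f l)"
  have t: "c * X + d * Y = rho1 \<theta> * dd1 \<theta> + rho2 \<theta> * dd2 \<theta>"
  proof -
    have "coeff ?p 1 + of_int m1 * coeff ?p 2 + coeff ?q 1 + of_int m2 * coeff ?q 2
        = rho1 \<theta> * dd1 \<theta> + rho2 \<theta> * dd2 \<theta>"
      using B' by blast
    then show ?thesis unfolding co by (simp add: X_def Y_def algebra_simps)
  qed
  have zs: "sum_list (zeros \<theta>) = (\<Sum>i\<in>{..<4}. ?f i)"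
    using pvs by (simp add: sum_list_sum_nth atLeast0LessThan)
  also have "\<dots> = (\<Sum>i\<in>I. ?f i) + (\<Sum>i\<in>{..<4} - I. ?f i)"
    using I by (subst sum.subset_diff[OF I(1)]) (simp_all add: add.commute)
  also have "(\<Sum>i\<in>{..<4} - I. ?f i) = ?f k + ?f l" unfolding kl(1) using kl(2) by simp
  also have "(\<Sum>i\<in>I. ?f i) = ?f i + ?f j" unfolding ij(1) using ij(2) by simp
  finally have "?f i + ?f j + (?f k + ?f l) = 1 - dd1 \<theta> - dd2 \<theta>"
    using pvs(7) by simp
  moreover have "of_int m1 + of_int m2 = (1 :: complex)"
    using B' by (metis of_int_add of_int_1)
  ultimately have XY: "Y = dd1 \<theta> + dd2 \<theta> - X" by (simp add: X_def Y_def algebra_simps eq_diff_eq)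
  \<comment> \<open>c and d are \<open>rho1 \<theta>\<close> and \<open>rho2 \<theta>\<close> in
    some order. The value of c X + d Y and the sum X + Y = d_1 + d_2 then give X = d_j, so -d_j
    minus the sum over I equals -m1.\<close>
  have "c * c - (rho1 \<theta> + rho2 \<theta>) * c + ?\<kappa> = 0" using cd by (simp flip: s add: algebra_simps)
  then have "(c - rho1 \<theta>) * (c - rho2 \<theta>) = 0" by (simp add: algebra_simps)
  then consider "c = rho1 \<theta>" "d = rho2 \<theta>" | "c = rho2 \<theta>" "d = rho1 \<theta>" using s by auto
  then show False
  proof cases
    case 1
    then have "(rho1 \<theta> - rho2 \<theta>) * (X - dd1 \<theta>) = 0" using t by (simp add: XY algebra_simps)
    then have "X = dd1 \<theta>" using pvs(4) by simp
    then have "- dd1 \<theta> - (\<Sum>i\<in>I. ?f i) = - of_int m1" using ij by (simp add: X_def algebra_simps)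
    then show False using pv_type_not_int(1)[OF pv I(1)] by (metis Ints_minus Ints_of_int)
  next
    case 2
    then have "(rho2 \<theta> - rho1 \<theta>) * (X - dd2 \<theta>) = 0" using t by (simp add: XY algebra_simps)
    then have "X = dd2 \<theta>" using pvs(4) by simp
    then have "- dd2 \<theta> - (\<Sum>i\<in>I. ?f i) = - of_int m1" using ij by (simp add: X_def algebra_simps)
    then show False using pv_type_not_int(2)[OF pv I(1)] by (metis Ints_minus Ints_of_int)
  qed
qed

lemma std_bundle_split: "std_bundle = split_bundle (- 0) (- 1)"
  by (simp add: std_bundle_def)

lemma atlas_iff_of_type:
  assumes "pv_type \<theta>"
  shows "B \<in> atlas \<theta> \<longleftrightarrow> of_type \<theta> (std_bundle, map_matrix of_pol B)"
  unfolding atlas_def std_bundle_split of_type_split_polys[OF assms]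
  using lsi_of_pol_nat[of _ 1] lsi_of_pol_nat[of _ 2] lsi_of_pol_nat[of _ 3] by auto

lemma atlas_iff:
  assumes "pv_type \<theta>"
  shows "B \<in> atlas \<theta> \<longleftrightarrow>
    degree (B $ 1 $ 1) \<le> 2 \<and> degree (B $ 1 $ 2) \<le> 3 \<and> degree (B $ 2 $ 1) \<le> 1 \<and> degree (B $ 2 $ 2) \<le> 2 \<and>
    coeff (B $ 1 $ 1) 2 + coeff (B $ 2 $ 2) 2 = rho1 \<theta> + rho2 \<theta> \<and>
    coeff (B $ 1 $ 1) 1 + coeff (B $ 2 $ 2) 1 + coeff (B $ 2 $ 2) 2 = rho1 \<theta> * dd1 \<theta> + rho2 \<theta> * dd2 \<theta> \<and>
    det B = smult (rho1 \<theta> * rho2 \<theta>) (zero_poly \<theta>)"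
  unfolding atlas_iff_of_type[OF assms] std_bundle_split of_type_split_polys[OF assms]
  using lsi_of_pol_nat[of _ 1] lsi_of_pol_nat[of _ 2] lsi_of_pol_nat[of _ 3] by auto

lemma atlas_lower_left_nonzero: "pv_type \<theta> \<Longrightarrow> B \<in> atlas \<theta> \<Longrightarrow> B $ 2 $ 1 \<noteq> 0"
  using lower_left_nonzero unfolding atlas_iff_of_type std_bundle_split by blast

lemma polys_matrix:
  assumes "\<forall>i j. C $ i $ j \<in> polys"
  obtains B where "C = map_matrix of_pol B"
proof (rule that)
  have "C $ i $ j = of_pol (SOME p. C $ i $ j = of_pol p)" for i j
    by (rule someI_ex) (use assms in \<open>blast elim: polysE\<close>)
  then show "C = map_matrix of_pol (map_matrix (\<lambda>r. SOME p. r = of_pol p) C)"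
    by (simp add: vec_eq_iff)
qed

text \<open>Birkhoff factorization of the transition matrix between an affine frame and a frame at
  infinity splits the bundle; the type then leaves only one splitting.\<close>

lemma std_representative:
  assumes pv: "pv_type \<theta>" and LA: "of_type \<theta> (L, A)"
  obtains S B where "bundle_iso S std_bundle L" "gauge S A = map_matrix of_pol B" "B \<in> atlas \<theta>"
proof -
  obtain G H where G: "affine_frame L G" and H: "inf_frame L H"
    using LA by (auto simp: of_type_def is_bundle_def)
  have invG: "invertible G" and invH: "invertible H" using G H by (auto simp: affine_frame_def inf_frame_def)
  obtain P K m1 m2 where P: "unit_over polys P" and K: "unit_over (lsi 0) K" and m: "m1 \<le> m2"
    and WP: "matrix_inv H ** G ** P = K ** mk2 (Zp m1) 0 0 (Zp m2)"
    using birkhoff[OF invertible_mult[OF invertible_matrix_inv[OF invH] invG]] by metis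
  define S where "S = G ** P"
  have invS: "invertible S" using invG P by (simp add: S_def invertible_mult unit_over_def)
  have S: "affine_frame L S"
    using G P invS by (simp add: affine_frame_def S_def column_module_unit[OF is_ring_polys])
  have HK: "inf_frame L (H ** K)"
    using H K by (simp add: inf_frame_def column_module_unit[OF is_ring_lsi, unfolded lsi_0_eq] lsi_0_eq invertible_mult
        unit_over_def)
  have SH: "S = H ** K ** mk2 (Zp m1) 0 0 (Zp m2)"
    using arg_cong[OF WP, of "\<lambda>M. H ** M"] matrix_inv_mult(2)[OF invH]
    by (simp add: S_def matrix_mul_assoc)
  have ZZ: "mk2 (Zp m1) 0 0 (Zp m2) ** mk2 (Zp (- m1)) 0 0 (Zp (- m2)) = mat 1"
    by (simp add: mat2_eq_iff mult2_nth Zp_mult)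
  have HK': "S ** mk2 (Zp (- m1)) 0 0 (Zp (- m2)) = H ** K"
    unfolding SH by (simp add: ZZ flip: matrix_mul_assoc)
  have iso: "bundle_iso S (split_bundle (- m1) (- m2)) L"
    using bundle_iso_of_frames[OF affine_frame_split _ inf_frame_split, of L S "- m1" "- m2"] S HK invS
    by (simp add: HK')
  then have type: "of_type \<theta> (split_bundle (- m1) (- m2), gauge S A)"
    using of_type_transport[OF pv _ is_bundle_split] LA by blast
  then have "\<forall>i j. gauge S A $ i $ j \<in> polys"
    unfolding of_type_split[OF pv] affine_type_iff by blast
  then obtain B where B: "gauge S A = map_matrix of_pol B" by (rule polys_matrix)
  have type: "of_type \<theta> (split_bundle (- m1) (- m2), map_matrix of_pol B)" using type B by simp
  \<comment> \<open>A nonzero polynomial in \<open>lsi (2 + m1 - m2)\<close> bounds m2 - m1 by 2.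
    This difference is nonnegative, and odd because m1 + m2 = 1, so it equals 1.\<close>
  have "B $ 2 $ 1 \<noteq> 0" using lower_left_nonzero[OF pv type] .
  then have "0 \<le> 2 + m1 - m2" "m1 + m2 = 1"
    using type[unfolded of_type_split_polys[OF pv]] by (auto simp: lsi_of_pol)
  with m have "m1 = 0" "m2 = 1" by auto
  with iso type B that show thesis by (simp add: atlas_iff_of_type[OF pv] std_bundle_split)
qed

subsection \<open>Isomorphism classes\<close>

lemma bundle_iso_refl: "bundle_iso (mat 1) L L"
  by (auto simp: bundle_iso_def invertible_det_nz)

lemma bundle_iso_trans:
  assumes "bundle_iso S L L'" "bundle_iso T L' L''"
  shows "bundle_iso (T ** S) L L''"
proof -
  have "(*v) (T ** S) ` V = (*v) T ` ((*v) S ` V)" for V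
    by (auto simp: image_iff matrix_vector_mul_assoc)
  then show ?thesis using assms by (auto simp: bundle_iso_def invertible_mult)
qed

lemma bundle_iso_sym:
  assumes "bundle_iso S L L'"
  shows "bundle_iso (matrix_inv S) L' L"
proof -
  have inv: "invertible S" using assms by (simp add: bundle_iso_def)
  have "(*v) (matrix_inv S) ` ((*v) S ` V) = V" for V
    using matrix_inv_mult(1)[OF inv] by (simp add: image_image matrix_vector_mul_assoc)
  from this[of "fst L"] this[of "snd L"] show ?thesis
    using assms by (simp add: bundle_iso_def invertible_matrix_inv)
qed

lemma dconn_iso_gauge:
  "dconn_iso (L, C) (L', A) \<longleftrightarrow> (\<exists>S. bundle_iso S L L' \<and> gauge S A = C)"
  unfolding dconn_iso_def by (metis bundle_iso_def fst_conv gauge_eq_iff snd_conv)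

lemma dconn_iso_refl: "dconn_iso X X"
  using dconn_iso_gauge[of "fst X" "snd X"] bundle_iso_refl gauge_one by (metis prod.collapse)

lemma dconn_iso_trans: "dconn_iso X Y \<Longrightarrow> dconn_iso Y Z \<Longrightarrow> dconn_iso X Z"
proof (cases X; cases Y; cases Z)
  fix L A L' A' L'' A''
  assume eq: "X = (L, A)" "Y = (L', A')" "Z = (L'', A'')" and "dconn_iso X Y" "dconn_iso Y Z"
  then obtain S T where "bundle_iso S L L'" "gauge S A' = A" "bundle_iso T L' L''" "gauge T A'' = A'"
    by (auto simp: dconn_iso_gauge)
  then show "dconn_iso X Z"
    using bundle_iso_trans gauge_mult[of T S A''] unfolding eq dconn_iso_gauge by (metis bundle_iso_def)
qed

lemma dconn_iso_sym: "dconn_iso X Y \<Longrightarrow> dconn_iso Y X"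
proof (cases X; cases Y)
  fix L A L' A'
  assume eq: "X = (L, A)" "Y = (L', A')" and "dconn_iso X Y"
  then obtain S where S: "bundle_iso S L L'" "gauge S A' = A"
    by (auto simp: dconn_iso_gauge)
  then have "invertible S" by (simp add: bundle_iso_def)
  then have "gauge (matrix_inv S) A = A'"
    using gauge_mult[of S "matrix_inv S" A'] S by (simp add: invertible_matrix_inv matrix_inv_mult)
  then show "dconn_iso Y X" using bundle_iso_sym[OF S(1)] unfolding eq dconn_iso_gauge by blast
qed

lemma equiv_iso_rel: "equiv {X. of_type \<theta> X} (iso_rel \<theta>)"
  by (rule equivI)
    (auto simp: iso_rel_def refl_on_def sym_def trans_def intro: dconn_iso_refl dconn_iso_sym dconn_iso_trans)

lemma atlas_class_in_moduli:
  assumes "B \<in> atlas \<theta>"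
  shows "atlas_class \<theta> B \<in> moduli \<theta>" "(std_bundle, map_matrix of_pol B) \<in> atlas_class \<theta> B"
proof -
  have t: "of_type \<theta> (std_bundle, map_matrix of_pol B)" using assms by (simp add: atlas_def)
  then show "atlas_class \<theta> B \<in> moduli \<theta>" by (simp add: atlas_class_def moduli_def quotientI)
  show "(std_bundle, map_matrix of_pol B) \<in> atlas_class \<theta> B"
    using t by (simp add: atlas_class_def iso_rel_def dconn_iso_refl)
qed

lemma moduli_atlas_class:
  assumes pv: "pv_type \<theta>" and c: "c \<in> moduli \<theta>"
  obtains B where "B \<in> atlas \<theta>" "c = atlas_class \<theta> B"
proof -
  obtain L A where LA: "of_type \<theta> (L, A)" and cX: "c = iso_rel \<theta> `` {(L, A)}"
    using c by (auto simp: moduli_def elim!: quotientE)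
  obtain S B where SB: "bundle_iso S std_bundle L" "gauge S A = map_matrix of_pol B" "B \<in> atlas \<theta>"
    using std_representative[OF pv LA] .
  then have "((std_bundle, map_matrix of_pol B), (L, A)) \<in> iso_rel \<theta>"
    using LA by (auto simp: iso_rel_def dconn_iso_gauge atlas_def)
  then have "c = atlas_class \<theta> B"
    using equiv_class_eq[OF equiv_iso_rel] by (metis cX atlas_class_def)
  with SB that show thesis by blast
qed

lemma atlas_class_eq_iff:
  assumes "B \<in> atlas \<theta>" "B' \<in> atlas \<theta>"
  shows "atlas_class \<theta> B = atlas_class \<theta> B' \<longleftrightarrow>
    dconn_iso (std_bundle, map_matrix of_pol B) (std_bundle, map_matrix of_pol B')"
  using assms eq_equiv_class_iff[OF equiv_iso_rel, of "(std_bundle, map_matrix of_pol B)" \<theta> "(std_bundle, map_matrix of_pol B')"]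
  by (auto simp: atlas_class_def atlas_def iso_rel_def)

subsection \<open>Automorphisms of the standard bundle\<close>

text \<open>The automorphisms of O + O(-1): l is a section of O(1) = Hom(O(-1), O), and there is no
  nonzero map from O to O(-1).\<close>

definition upper :: "complex \<Rightarrow> complex poly \<Rightarrow> complex \<Rightarrow> complex poly^2^2" where
  "upper \<alpha> l \<beta> = mk2 [:\<alpha>:] l 0 [:\<beta>:]"

text \<open>The entries are polynomials whose order at infinity is bounded by 0 on the diagonal, by
  1 above it and by -1 below it.\<close>

lemma std_aut_upper:
  assumes S: "bundle_iso S std_bundle std_bundle"
  obtains \<alpha> \<beta> l where "\<alpha> \<noteq> 0" "\<beta> \<noteq> 0" "degree l \<le> 1" "S = map_matrix of_pol (upper \<alpha> l \<beta>)"
proof -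
  let ?H = "mk2 1 0 0 (Zp (- 1))"
  have A: "affine_frame std_bundle (mat 1)" and H: "inf_frame std_bundle ?H"
    using affine_frame_split inf_frame_split[of 0 "- 1"] by (simp_all add: std_bundle_def)
  have SA: "affine_frame std_bundle (S ** mat 1)" and SH: "inf_frame std_bundle (S ** ?H)"
    using bundle_iso_frames[OF S] A H by blast+
  have fr: "invertible (mat 1 :: ratmat)" "invertible S" "column_module polys (mat 1) = column_module polys S"
    using A SA by (auto simp: affine_frame_def)
  obtain P where P: "unit_over polys P" "S = mat 1 ** P"
    using column_module_frame_change[OF is_ring_polys fr] .
  then have S: "unit_over polys S" by simp
  have fr': "invertible ?H" "invertible (S ** ?H)" "column_module (lsi 0) ?H = column_module (lsi 0) (S ** ?H)"
    using H SH by (auto simp: inf_frame_def lsi_0_eq)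
  obtain K where K: "unit_over (lsi 0) K" "S ** ?H = ?H ** K"
    using column_module_frame_change[OF is_ring_lsi fr'] .
  obtain F where F: "S = map_matrix of_pol F"
    using S unfolding unit_over_def by (blast elim: polys_matrix)
  define f where "f i j = F $ i $ j" for i j
  have f: "S $ i $ j = of_pol (f i j)" for i j by (simp add: F f_def)
  have Kij: "K $ i $ j \<in> lsi 0" for i j using K by (simp add: unit_over_def)
  have e: "S $ 1 $ 1 = K $ 1 $ 1" "S $ 1 $ 2 * Zp (- 1) = K $ 1 $ 2"
    "S $ 2 $ 1 = Zp (- 1) * K $ 2 $ 1" "S $ 2 $ 2 * Zp (- 1) = Zp (- 1) * K $ 2 $ 2"
    using K(2) by (simp_all add: mat2_eq_iff mult2_nth)
  have "S $ 1 $ 1 \<in> lsi 0" using e(1) Kij by simp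
  then have "degree (f 1 1) = 0" by (auto simp: f lsi_of_pol)
  then obtain \<alpha> where \<alpha>: "f 1 1 = [:\<alpha>:]" by (elim degree_eq_zeroE)
  have "S $ 2 $ 2 = K $ 2 $ 2" using e(4) by (simp add: mult.commute)
  then have "S $ 2 $ 2 \<in> lsi 0" using Kij by simp
  then have "degree (f 2 2) = 0" by (auto simp: f lsi_of_pol)
  then obtain \<beta> where \<beta>: "f 2 2 = [:\<beta>:]" by (elim degree_eq_zeroE)
  have "S $ 2 $ 1 \<in> lsi (- 1)" unfolding e(3) using Kij by (simp add: lsi_mult_Zp)
  then have "f 2 1 = 0" by (simp add: f lsi_of_pol)
  have "S $ 1 $ 2 * Zp (- 1) \<in> lsi 0" unfolding e(2) by (rule Kij)
  then have "S $ 1 $ 2 \<in> lsi 1" by (simp add: lsi_Zp_mult)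
  then have l: "degree (f 1 2) \<le> 1" by (auto simp: f lsi_of_pol)
  have SU: "S = map_matrix of_pol (upper \<alpha> (f 1 2) \<beta>)"
    using \<alpha> \<beta> \<open>f 2 1 = 0\<close> by (simp add: mat2_eq_iff upper_def f)
  have "det S \<noteq> 0" using S by (simp add: unit_over_def invertible_det_nz)
  then have "\<alpha> \<noteq> 0" "\<beta> \<noteq> 0" unfolding SU by (auto simp: det_2 upper_def)
  with that l SU show thesis by blast
qed

lemma upper_std_aut:
  assumes "\<alpha> \<noteq> 0" "\<beta> \<noteq> 0" "degree l \<le> 1"
  shows "bundle_iso (map_matrix of_pol (upper \<alpha> l \<beta>)) std_bundle std_bundle"
proof -
  let ?S = "map_matrix of_pol (upper \<alpha> l \<beta>)" and ?H = "mk2 1 0 0 (Zp (- 1))"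
  let ?a = "of_pol [:\<alpha>:]" and ?b = "of_pol [:\<beta>:]" and ?a' = "of_pol [:inverse \<alpha>:]" and ?b' = "of_pol [:inverse \<beta>:]"
  have ab: "?a * ?a' = 1" "?b * ?b' = 1" using assms by (simp_all flip: one_pCons)
  have A: "affine_frame std_bundle (mat 1)" and H: "inf_frame std_bundle ?H"
    using affine_frame_split inf_frame_split[of 0 "- 1"] by (simp_all add: std_bundle_def)
  have inv: "mk2 a b 0 d ** mk2 a' (- (a' * b * d')) 0 d' = mat 1" if "a * a' = 1" "d * d' = 1" for a b d a' d' :: ratfun
    using that by (simp add: mat2_eq_iff mult2_nth flip: mult.assoc)
  have S: "?S = mk2 ?a (of_pol l) 0 ?b" by (simp add: mat2_eq_iff upper_def)
  have "unit_over polys ?S"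
    unfolding S
  proof (rule unit_overI[OF inv[OF ab]])
    show "mk2 ?a (of_pol l) 0 ?b $ i $ j \<in> polys" for i j
      using exhaust_2[of i] exhaust_2[of j] by auto
    show "mk2 ?a' (- (?a' * of_pol l * ?b')) 0 ?b' $ i $ j \<in> polys" for i j
      using exhaust_2[of i] exhaust_2[of j] by auto
  qed
  then have 1: "affine_frame std_bundle (?S ** mat 1)"
    using A column_module_unit[OF is_ring_polys, of ?S "mat 1"] by (auto simp: affine_frame_def unit_over_def)
  have invS: "invertible ?S" using \<open>unit_over polys ?S\<close> by (simp add: unit_over_def)
  let ?K = "mk2 ?a (of_pol l * Zp (- 1)) 0 ?b"
  have c: "of_pol [:x:] \<in> lsi 0" for x by (rule lsi_const)
  have lZ: "of_pol l * Zp (- 1) \<in> lsi 0" using assms by (auto simp: lsi_Zp_mult lsi_of_pol)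
  have "unit_over (lsi 0) ?K"
  proof (rule unit_overI[OF inv[OF ab]])
    show "?K $ i $ j \<in> lsi 0" for i j
      using exhaust_2[of i] exhaust_2[of j] c lZ by auto
    have "- (?a' * (of_pol l * Zp (- 1)) * ?b') \<in> lsi 0"
      using lsi_mult'[OF lsi_mult'[OF c lZ] c] by (simp add: lsi_uminus del: mult_fract)
    then show "mk2 ?a' (- (?a' * (of_pol l * Zp (- 1)) * ?b')) 0 ?b' $ i $ j \<in> lsi 0" for i j
      using exhaust_2[of i] exhaust_2[of j] c by (auto simp del: mult_fract minus_fract)
  qed
  moreover have "?S ** ?H = ?H ** ?K" unfolding S by (simp add: mat2_eq_iff mult2_nth mult.commute)
  ultimately have 2: "inf_frame std_bundle (?S ** ?H)"
    using H invS column_module_unit[OF is_ring_lsi, of ?K ?H]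
    by (auto simp: inf_frame_def lsi_0_eq unit_over_def intro: invertible_mult)
  show ?thesis by (rule bundle_iso_of_frames[OF A 1 H 2 invS])
qed

lemma of_pol_matrix_mult: "map_matrix of_pol (A ** B) = map_matrix of_pol A ** map_matrix of_pol B"
  for A B :: "complex poly^2^2"
  by (simp add: mat2_eq_iff mult2_nth)

lemma map_of_pol_inj: "map_matrix of_pol A = map_matrix of_pol B \<longleftrightarrow> A = B"
  for A B :: "complex poly^2^2"
  by (simp add: mat2_eq_iff)

abbreviation sh :: "complex poly \<Rightarrow> complex poly" where
  "sh p \<equiv> pcompose p [:1, 1:]"

lemma gauge_upper_iff:
  assumes "\<alpha> \<noteq> 0" "\<beta> \<noteq> 0"
  shows "gauge (map_matrix of_pol (upper \<alpha> l \<beta>)) (map_matrix of_pol B') = map_matrix of_pol B \<longleftrightarrow>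
    B' ** upper \<alpha> l \<beta> = upper \<alpha> (sh l) \<beta> ** B"
proof -
  have inv: "invertible (map_matrix of_pol (upper \<alpha> l \<beta>))"
    using assms by (simp add: invertible_det_nz det_2 upper_def)
  have sh: "map_matrix shift (map_matrix of_pol (upper \<alpha> l \<beta>)) = map_matrix of_pol (upper \<alpha> (sh l) \<beta>)"
    by (simp add: mat2_eq_iff upper_def pcompose_pCons)
  show ?thesis unfolding gauge_eq_iff[OF inv] sh of_pol_matrix_mult[symmetric] map_of_pol_inj ..
qed

lemma atlas_gauge_upper:
  assumes pv: "pv_type \<theta>" and B: "B \<in> atlas \<theta>" and nz: "\<alpha> \<noteq> 0" "\<beta> \<noteq> 0" "degree l \<le> 1"
    and eq: "B ** upper \<alpha> l \<beta> = upper \<alpha> (sh l) \<beta> ** B'"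
  shows "B' \<in> atlas \<theta>" "atlas_class \<theta> B' = atlas_class \<theta> B"
proof -
  let ?S = "map_matrix of_pol (upper \<alpha> l \<beta>)"
  have S: "bundle_iso ?S std_bundle std_bundle" using upper_std_aut nz .
  have g: "gauge ?S (map_matrix of_pol B) = map_matrix of_pol B'" using eq nz by (simp add: gauge_upper_iff)
  show B': "B' \<in> atlas \<theta>"
    using B of_type_transport[OF pv S, of "map_matrix of_pol B"] is_bundle_split[of 0 "- 1"]
    by (simp add: atlas_iff_of_type[OF pv] g std_bundle_def)
  show "atlas_class \<theta> B' = atlas_class \<theta> B"
    unfolding atlas_class_eq_iff[OF B' B] dconn_iso_gauge using S g by blast
qed

lemma class_matrix_upper:
  assumes B: "B \<in> atlas \<theta>" and B': "class_matrix (atlas_class \<theta> B) B'"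
  obtains \<alpha> \<beta> l where "\<alpha> \<noteq> 0" "\<beta> \<noteq> 0" "degree l \<le> 1" "B ** upper \<alpha> l \<beta> = upper \<alpha> (sh l) \<beta> ** B'"
proof -
  obtain L A S where LA: "(L, A) \<in> atlas_class \<theta> B" and S: "bundle_iso S std_bundle L" "gauge S A = map_matrix of_pol B'"
    using B' by (auto simp: class_matrix_def)
  have "dconn_iso (std_bundle, map_matrix of_pol B) (L, A)"
    using LA by (auto simp: atlas_class_def iso_rel_def)
  moreover have "dconn_iso (std_bundle, map_matrix of_pol B') (L, A)" using S dconn_iso_gauge by blast
  ultimately have "dconn_iso (std_bundle, map_matrix of_pol B') (std_bundle, map_matrix of_pol B)"
    using dconn_iso_sym dconn_iso_trans by blast
  then obtain T where T: "bundle_iso T std_bundle std_bundle" "gauge T (map_matrix of_pol B) = map_matrix of_pol B'"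
    by (auto simp: dconn_iso_gauge)
  obtain \<alpha> \<beta> l where "\<alpha> \<noteq> 0" "\<beta> \<noteq> 0" "degree l \<le> 1" "T = map_matrix of_pol (upper \<alpha> l \<beta>)"
    using std_aut_upper[OF T(1)] .
  with T(2) that show thesis by (simp add: gauge_upper_iff)
qed

section \<open>Well-definedness of the coordinates\<close>

lemma class_matrix_self:
  assumes "B \<in> atlas \<theta>" shows "class_matrix (atlas_class \<theta> B) B"
  unfolding class_matrix_def
  by (rule bexI[OF _ atlas_class_in_moduli(2)[OF assms]]) (auto intro!: exI[of _ "mat 1"] bundle_iso_refl)

text \<open>Why q and p are functions of the class: the lower left entry is only rescaled, and the
  upper left one changes by a multiple of it and so keeps its value at q.\<close>

lemma upper_gauge_entries:
  assumes nz: "\<alpha> \<noteq> 0" "\<beta> \<noteq> 0" and eq: "B ** upper \<alpha> l \<beta> = upper \<alpha> (sh l) \<beta> ** B'"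
  shows "B' $ 2 $ 1 = smult (\<alpha> / \<beta>) (B $ 2 $ 1)" "B' $ 1 $ 1 = B $ 1 $ 1 - smult (1 / \<beta>) (sh l * B $ 2 $ 1)"
proof -
  have e: "smult \<alpha> (B $ 2 $ 1) = smult \<beta> (B' $ 2 $ 1)"
    "smult \<alpha> (B $ 1 $ 1) = smult \<alpha> (B' $ 1 $ 1) + sh l * B' $ 2 $ 1"
    using eq by (simp_all add: mat2_eq_iff mult2_nth upper_def)
  have "smult (1 / \<beta>) (smult \<beta> (B' $ 2 $ 1)) = smult (1 / \<beta>) (smult \<alpha> (B $ 2 $ 1))" using e(1) by simp
  then show 1: "B' $ 2 $ 1 = smult (\<alpha> / \<beta>) (B $ 2 $ 1)" using nz by simp
  have "smult (1 / \<alpha>) (smult \<alpha> (B $ 1 $ 1)) = smult (1 / \<alpha>) (smult \<alpha> (B' $ 1 $ 1) + sh l * B' $ 2 $ 1)"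
    using e(2) by simp
  then show "B' $ 1 $ 1 = B $ 1 $ 1 - smult (1 / \<beta>) (sh l * B $ 2 $ 1)"
    using nz by (simp add: 1 smult_add_right)
qed

lemma q_coord_atlas_class:
  assumes B: "B \<in> atlas \<theta>" and B21: "B $ 2 $ 1 = smult c [:- q, 1:]" and c: "c \<noteq> 0"
  shows "q_coord (atlas_class \<theta> B) = Fin q"
  unfolding q_coord_def
proof (rule the_equality)
  show "\<exists>B'. class_matrix (atlas_class \<theta> B) B' \<and> B' $ 2 $ 1 \<noteq> 0 \<and> section_value 1 (B' $ 2 $ 1) (Fin q) = 0"
    using class_matrix_self[OF B] c by (intro exI[of _ B]) (auto simp: B21)
next
  fix x assume "\<exists>B'. class_matrix (atlas_class \<theta> B) B' \<and> B' $ 2 $ 1 \<noteq> 0 \<and> section_value 1 (B' $ 2 $ 1) x = 0"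
  then obtain B' where B': "class_matrix (atlas_class \<theta> B) B'" "section_value 1 (B' $ 2 $ 1) x = 0" by blast
  obtain \<alpha> \<beta> l where u: "\<alpha> \<noteq> 0" "\<beta> \<noteq> 0" "B ** upper \<alpha> l \<beta> = upper \<alpha> (sh l) \<beta> ** B'"
    using class_matrix_upper[OF B B'(1)] by metis
  then show "x = Fin q"
    using upper_gauge_entries(1)[OF u] B'(2) c by (cases x) (auto simp: B21)
qed

text \<open>Since q avoids both zeros in the denominator, \<open>is_ratio\<close> has exactly one
  solution.\<close>

lemma p_coord_atlas_class:
  assumes B: "B \<in> atlas \<theta>" and B21: "B $ 2 $ 1 = smult c [:- q, 1:]" and c: "c \<noteq> 0"
    and z: "q \<noteq> zeros \<theta> ! 2" "q \<noteq> zeros \<theta> ! 3"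
  shows "p_coord \<theta> (atlas_class \<theta> B) = Fin (poly (B $ 1 $ 1) q / ((q - zeros \<theta> ! 2) * (q - zeros \<theta> ! 3)))"
  unfolding p_coord_def q_coord_atlas_class[OF B B21 c]
proof (rule the_equality)
  let ?w = "[:- zeros \<theta> ! 2, 1:] * [:- zeros \<theta> ! 3, 1:]"
  have w: "poly ?w q = (q - zeros \<theta> ! 2) * (q - zeros \<theta> ! 3)" by (simp add: algebra_simps)
  show "\<exists>B'. class_matrix (atlas_class \<theta> B) B' \<and>
      is_ratio (Fin (poly (B $ 1 $ 1) q / ((q - zeros \<theta> ! 2) * (q - zeros \<theta> ! 3))))
       (section_value 2 (B' $ 1 $ 1) (Fin q)) (section_value 2 ?w (Fin q))"
    using class_matrix_self[OF B] z unfolding section_value.simps w by (intro exI[of _ B]) auto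
  fix y assume "\<exists>B'. class_matrix (atlas_class \<theta> B) B' \<and>
      is_ratio y (section_value 2 (B' $ 1 $ 1) (Fin q)) (section_value 2 ?w (Fin q))"
  then obtain B' where B': "class_matrix (atlas_class \<theta> B) B'"
    and y: "is_ratio y (poly (B' $ 1 $ 1) q) ((q - zeros \<theta> ! 2) * (q - zeros \<theta> ! 3))"
    unfolding section_value.simps w by blast
  obtain \<alpha> \<beta> l where u: "\<alpha> \<noteq> 0" "\<beta> \<noteq> 0" "B ** upper \<alpha> l \<beta> = upper \<alpha> (sh l) \<beta> ** B'"
    using class_matrix_upper[OF B B'(1)] by metis
  have "poly (B' $ 1 $ 1) q = poly (B $ 1 $ 1) q"
    unfolding upper_gauge_entries(2)[OF u] by (simp add: B21)
  then show "y = Fin (poly (B $ 1 $ 1) q / ((q - zeros \<theta> ! 2) * (q - zeros \<theta> ! 3)))"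
    using y z by (cases y) auto
qed

subsection \<open>Rational isomorphisms are isomorphisms\<close>

lemma finite_orbit_end:
  fixes S :: "complex set"
  assumes fin: "finite S" and x: "x \<in> S" and e: "e \<noteq> 0"
  obtains n :: nat where "x + of_nat n * e \<in> S" "x + of_nat n * e + e \<notin> S"
proof -
  have "\<exists>n::nat. x + of_nat n * e \<in> S \<and> x + of_nat n * e + e \<notin> S"
  proof (rule ccontr)
    assume *: "\<not> ?thesis"
    have "x + of_nat n * e \<in> S" for n :: nat
    proof (induction n)
      case (Suc n)
      then have "x + of_nat n * e + e \<in> S" using * by blast
      then show ?case by (simp add: algebra_simps)
    qed (use x in simp)
    then have "range (\<lambda>n::nat. x + of_nat n * e) \<subseteq> S" by auto
    moreover have "inj (\<lambda>n::nat. x + of_nat n * e)" using e by (auto intro: injI)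
    ultimately show False using fin finite_subset finite_imageD infinite_UNIV_nat by metis
  qed
  with that show thesis by blast
qed

lemma atlas_local_inverse:
  assumes pv: "pv_type \<theta>" and B: "B \<in> atlas \<theta>" and x: "x \<notin> set (zeros \<theta>)"
  shows "matrix_inv (map_matrix of_pol B) $ i $ j \<in> local_ring x" "invertible (map_matrix of_pol B)"
proof -
  let ?D = "smult (rho1 \<theta> * rho2 \<theta>) (zero_poly \<theta>)"
  have det: "det (map_matrix of_pol B) = of_pol ?D"
    using B by (simp add: atlas_iff[OF pv])
  have "poly ?D x \<noteq> 0"
    using x pv_type_simps[OF pv] by (auto simp: zero_poly_def poly_prod)
  then have inv: "inverse (of_pol ?D) \<in> local_ring x" and nz: "?D \<noteq> 0" by (rule local_ring_inverse_of_pol, auto)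
  show i: "invertible (map_matrix of_pol B)" using nz det by (simp add: invertible_det_nz del: det_of_pol)
  have *: "of_pol p / of_pol ?D \<in> local_ring x" for p
    unfolding divide_inverse using inv by (intro local_ring_mult) simp
  have "- of_pol p / of_pol ?D \<in> local_ring x" for p
    using *[of "- p"] by (simp flip: minus_fract)
  with * show "matrix_inv (map_matrix of_pol B) $ i $ j \<in> local_ring x"
    using exhaust_2[of i] exhaust_2[of j] unfolding matrix_inv_2[OF i] det nth_map_matrix
    by (auto simp del: divide_fract minus_fract)
qed

text \<open>A pole of \<open>R\<close> propagates along its orbit under \<open>z \<mapsto> z + 1\<close> until it meets a zero of the
  d-connections on either side; distinct zeros lie in distinct orbits.\<close>

lemma rational_iso_polys:
  assumes pv: "pv_type \<theta>" and B: "B \<in> atlas \<theta>" and B': "B' \<in> atlas \<theta>"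
    and R: "map_matrix shift R ** map_matrix of_pol B = map_matrix of_pol B' ** R"
  shows "R $ i $ j \<in> polys"
proof -
  let ?B = "map_matrix of_pol B" and ?B' = "map_matrix of_pol B'"
  define S where "S = {x. \<not> (\<forall>i j. R $ i $ j \<in> local_ring x)}"
  have ex: "\<exists>x. x \<notin> set (zeros \<theta>)" using ex_new_if_finite[OF infinite_UNIV_char_0 finite_set] by blast
  have inv: "invertible ?B" "invertible ?B'"
    using ex atlas_local_inverse(2)[OF pv] B B' by blast+
  have "S = (\<Union>i. \<Union>j. {x. R $ i $ j \<notin> local_ring x})" by (auto simp: S_def)
  then have fin: "finite S" by (simp add: finite_not_local_ring)
  \<comment> \<open>Solve for R in terms of its shift: dividing by B' at x creates no pole unless x
    is a zero. \<open>down\<close> solves for the shift instead and divides by B.\<close>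
  have up: "x \<in> set (zeros \<theta>)" if x: "x \<in> S" "x + 1 \<notin> S" for x
  proof (rule ccontr)
    assume z: "x \<notin> set (zeros \<theta>)"
    have "R = matrix_inv ?B' ** (map_matrix shift R ** ?B)"
      using matrix_inv_left_eq_iff[OF inv(2)] R by metis
    moreover have "(matrix_inv ?B' ** (map_matrix shift R ** ?B)) $ i $ j \<in> local_ring x" for i j
    proof (intro matrix_mult_in_ring[OF is_ring_local_ring])
      show "matrix_inv ?B' $ i $ j \<in> local_ring x" for i j by (rule atlas_local_inverse(1)[OF pv B' z])
      show "map_matrix shift R $ i $ j \<in> local_ring x" for i j using x by (simp add: S_def local_ring_shift_iff)
    qed simp
    ultimately have "\<forall>i j. R $ i $ j \<in> local_ring x" by metis
    then show False using x by (simp add: S_def)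
  qed
  have down: "y - 1 \<in> set (zeros \<theta>)" if y: "y \<in> S" "y - 1 \<notin> S" for y
  proof (rule ccontr)
    assume z: "y - 1 \<notin> set (zeros \<theta>)"
    have "map_matrix shift R = ?B' ** R ** matrix_inv ?B"
      using arg_cong[OF R, of "\<lambda>M. M ** matrix_inv ?B"] matrix_inv_mult(2)[OF inv(1)]
      by (simp flip: matrix_mul_assoc)
    moreover have "(?B' ** R ** matrix_inv ?B) $ i $ j \<in> local_ring (y - 1)" for i j
    proof (intro matrix_mult_in_ring[OF is_ring_local_ring])
      show "matrix_inv ?B $ i $ j \<in> local_ring (y - 1)" for i j by (rule atlas_local_inverse(1)[OF pv B z])
      show "R $ i $ j \<in> local_ring (y - 1)" for i j using y by (simp add: S_def)
    qed simp
    ultimately have "\<forall>i j. map_matrix shift R $ i $ j \<in> local_ring (y - 1)" by metis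
    then have "\<forall>i j. R $ i $ j \<in> local_ring y" by (simp add: local_ring_shift_iff)
    then show False using y by (simp add: S_def)
  qed
  have "S = {}"
  proof (rule ccontr)
    assume "S \<noteq> {}"
    then obtain x where x: "x \<in> S" by blast
    obtain n :: nat where n: "x + of_nat n * 1 \<in> S" "x + of_nat n * 1 + 1 \<notin> S"
      by (rule finite_orbit_end[OF fin x, of 1]) auto
    obtain m :: nat where m: "x + of_nat m * (- 1) \<in> S" "x + of_nat m * (- 1) + - 1 \<notin> S"
      by (rule finite_orbit_end[OF fin x, of "- 1"]) auto
    have a: "x + of_nat n \<in> set (zeros \<theta>)" using up n by simp
    have b: "x - of_nat m - 1 \<in> set (zeros \<theta>)" using down m by simp
    \<comment> \<open>The ends of the orbit give two zeros with integral difference, hence the same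
      zero; but the difference n + m + 1 is positive.\<close>
    have d: "x + of_nat n - (x - of_nat m - 1) = of_nat (n + m + 1)" by simp
    have "x + of_nat n - (x - of_nat m - 1) \<in> \<int>" unfolding d by (rule Ints_of_nat)
    then have "x + of_nat n = x - of_nat m - 1" by (rule pv_type_zeros_diff[OF pv a b])
    then have "x + of_nat n - (x - of_nat m - 1) = 0" by (simp only: diff_self)
    then have "n + m + 1 = 0" unfolding d by (simp only: of_nat_eq_0_iff)
    then show False by simp
  qed
  then show ?thesis by (intro polys_if_regular) (auto simp: S_def)
qed

section \<open>Regularity of rational isomorphisms at infinity\<close>

lemma inf_coeff_shift:
  assumes "r \<in> lsi 0"
  shows "fps_nth (inf_coeff (shift r)) 0 = fps_nth (inf_coeff r) 0"
    "fps_nth (inf_coeff (shift r)) (Suc 0) = fps_nth (inf_coeff r) (Suc 0)"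
proof -
  have "shift r - r \<in> lsi (- int 2)" using lsi_shift_diff_0[OF assms] by simp
  moreover have "shift r - r \<in> lsi 0" using assms by (intro lsi_diff) simp_all
  ultimately have *: "\<forall>k<2. fps_nth (inf_coeff (shift r - r)) k = 0"
    using inf_coeff_lsi[of "shift r - r" 2] by blast
  show "fps_nth (inf_coeff (shift r)) 0 = fps_nth (inf_coeff r) 0"
    "fps_nth (inf_coeff (shift r)) (Suc 0) = fps_nth (inf_coeff r) (Suc 0)"
    using *[rule_format, of 0] *[rule_format, of "Suc 0"] by simp_all
qed

text \<open>If \<open>Q\<close> has order \<open>N\<close> at infinity, its leading coefficient \<open>Q\<^sub>0\<close> intertwines the leading terms,
  hence is diagonal in eigenbases; the next order then gives \<open>N Q\<^sub>0 = 0\<close>.\<close>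

lemma intertwiner_regular_inf:
  assumes M: "inf_invariants \<theta> M" and M': "inf_invariants \<theta> M'"
    and \<rho>: "rho1 \<theta> \<noteq> rho2 \<theta>" "rho1 \<theta> \<noteq> 0" "rho2 \<theta> \<noteq> 0"
    and Q: "map_matrix shift Q ** M = M' ** Q"
  shows "Q $ i $ j \<in> lsi 0"
proof (cases "\<forall>i j. Q $ i $ j = 0")
  case False
  then obtain i0 j0 where "Q $ i0 $ j0 \<noteq> 0" by blast
  then obtain k where k: "\<And>l. Q $ i0 $ j0 \<in> lsi l \<Longrightarrow> k \<le> l" using lsi_lower_bound by blast
  define good where "good n \<longleftrightarrow> (\<forall>i j. Q $ i $ j \<in> lsi (k + int n))" for n
  have "\<exists>n. good n"
  proof -
    obtain n1 n2 n3 n4 :: nat where n: "Q $ 1 $ 1 \<in> lsi n1" "Q $ 1 $ 2 \<in> lsi n2" "Q $ 2 $ 1 \<in> lsi n3" "Q $ 2 $ 2 \<in> lsi n4"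
      by (meson lsi_exists)
    have "good (nat (- k) + n1 + n2 + n3 + n4)"
      using n by (auto simp: good_def forall_2 elim: lsi_mono)
    then show ?thesis ..
  qed
  \<comment> \<open>N is the exact order of Q: all entries lie in \<open>lsi N\<close> but not all
    in \<open>lsi (N - 1)\<close>.\<close>
  then obtain n where n: "good n" and least: "\<And>m. m < n \<Longrightarrow> \<not> good m"
    using exists_least_iff[of good] by blast
  define N where "N = k + int n"
  have QN: "Q $ i $ j \<in> lsi N" for i j using n by (simp add: good_def N_def)
  have notN: "\<not> (\<forall>i j. Q $ i $ j \<in> lsi (N - 1))"
  proof (cases n)
    case 0
    then show ?thesis using k[of "N - 1"] by (auto simp: N_def)
  next
    case (Suc m)
    then show ?thesis using least[of m] by (simp add: good_def N_def)
  qed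
  define Q' where "Q' = map_matrix (\<lambda>r. r * Zp (- N)) Q"
  have Q'0: "Q' $ i $ j \<in> lsi 0" for i j using QN by (simp add: Q'_def lsi_Zp_mult)
  have Mij: "M $ i $ j * Zp (- 2) \<in> lsi 0" "M' $ i $ j * Zp (- 2) \<in> lsi 0" for i j
    using M M' by (simp_all add: inf_invariants_def lsi_Zp_mult)
  \<comment> \<open>Normalizing Q by z^(-N) costs the factor \<open>twist N\<close>, whose
    coefficient N of w is the source of the contradiction for N different from 0.\<close>
  have "(M' ** Q') $ i $ j * Zp (- 2) = twist N * ((map_matrix shift Q' ** M) $ i $ j * Zp (- 2))" for i j
  proof -
    have s: "shift (Q $ a $ b) = shift (Q' $ a $ b) * shift (Zp N)" for a b
      by (simp add: Q'_def mult.assoc Zp_mult flip: shift_mult)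
    have "(M' ** Q') $ i $ j = (M' ** Q) $ i $ j * Zp (- N)"
      by (simp add: mult2_nth Q'_def algebra_simps)
    also have "\<dots> = (map_matrix shift Q ** M) $ i $ j * Zp (- N)" by (simp only: Q)
    also have "\<dots> = twist N * (map_matrix shift Q' ** M) $ i $ j"
      by (simp only: mult2_nth nth_map_matrix s twist_def) (simp add: algebra_simps)
    finally show ?thesis by simp
  qed
  note eq = this
  let ?q = "map_matrix inf_coeff Q'" and ?s = "map_matrix inf_coeff (map_matrix shift Q')"
  let ?t = "inf_coeff (twist N)"
  have series: "(inf_series M' ** ?q) $ i $ j = ?t * (?s ** inf_series M) $ i $ j" for i j
  proof -
    have sQ: "shift (Q' $ a $ b) \<in> lsi 0" for a b using Q'0 by simp
    have "inf_coeff ((M' ** Q') $ i $ j * Zp (- 2)) = (inf_series M' ** ?q) $ i $ j"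
    proof -
      have "(M' ** Q') $ i $ j * Zp (- 2) = (M' $ i $ 1 * Zp (- 2)) * Q' $ 1 $ j + (M' $ i $ 2 * Zp (- 2)) * Q' $ 2 $ j"
        by (simp add: mult2_nth algebra_simps)
      then show ?thesis by (simp add: mult2_nth inf_coeff_mult Mij Q'0)
    qed
    moreover have "inf_coeff (twist N * ((map_matrix shift Q' ** M) $ i $ j * Zp (- 2))) = ?t * (?s ** inf_series M) $ i $ j"
    proof -
      have e: "(map_matrix shift Q' ** M) $ i $ j * Zp (- 2)
         = shift (Q' $ i $ 1) * (M $ 1 $ j * Zp (- 2)) + shift (Q' $ i $ 2) * (M $ 2 $ j * Zp (- 2))"
        by (simp add: mult2_nth algebra_simps)
      have l: "shift (Q' $ i $ 1) * (M $ 1 $ j * Zp (- 2)) + shift (Q' $ i $ 2) * (M $ 2 $ j * Zp (- 2)) \<in> lsi 0"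
        by (rule lsi_add[OF lsi_mult'[OF sQ Mij(1)] lsi_mult'[OF sQ Mij(1)]]) simp_all
      show ?thesis unfolding e by (simp add: inf_coeff_mult twist_in_lsi l) (simp add: mult2_nth inf_coeff_mult Q'0 Mij)
    qed
    ultimately show ?thesis using eq by metis
  qed
  have sq: "fps_nth (?s $ a $ b) 0 = fps_nth (?q $ a $ b) 0" "fps_nth (?s $ a $ b) (Suc 0) = fps_nth (?q $ a $ b) (Suc 0)" for a b
    using inf_coeff_shift[OF Q'0] by simp_all
  obtain P :: "complex^2^2" and n0 where P: "det P \<noteq> 0" "inf_series M ** map_matrix fps_const P = map_matrix fps_const P ** n0"
    and n0: "fps_nth (n0 $ 1 $ 1) 0 = rho1 \<theta>" "fps_nth (n0 $ 1 $ 2) 0 = 0"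
    "fps_nth (n0 $ 2 $ 1) 0 = 0" "fps_nth (n0 $ 2 $ 2) 0 = rho2 \<theta>"
    "fps_nth (n0 $ 1 $ 1) (Suc 0) = rho1 \<theta> * dd1 \<theta>" "fps_nth (n0 $ 2 $ 2) (Suc 0) = rho2 \<theta> * dd2 \<theta>"
    using formal_invariants_eigenbasis[OF _ \<rho>(1)] M unfolding inf_invariants_iff by metis
  obtain P' :: "complex^2^2" and n' where P': "det P' \<noteq> 0" "inf_series M' ** map_matrix fps_const P' = map_matrix fps_const P' ** n'"
    and n': "fps_nth (n' $ 1 $ 1) 0 = rho1 \<theta>" "fps_nth (n' $ 1 $ 2) 0 = 0"
    "fps_nth (n' $ 2 $ 1) 0 = 0" "fps_nth (n' $ 2 $ 2) 0 = rho2 \<theta>"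
    "fps_nth (n' $ 1 $ 1) (Suc 0) = rho1 \<theta> * dd1 \<theta>" "fps_nth (n' $ 2 $ 2) (Suc 0) = rho2 \<theta> * dd2 \<theta>"
    using formal_invariants_eigenbasis[OF _ \<rho>(1)] M' unfolding inf_invariants_iff by metis
  have invP: "invertible P" "invertible P'" using P P' by (simp_all add: invertible_det_nz)
  let ?P = "map_matrix fps_const P" and ?P' = "map_matrix fps_const P'" and ?J = "map_matrix fps_const (matrix_inv P')"
  have J: "?J ** ?P' = mat 1" "?P' ** ?J = mat 1"
    using matrix_inv_mult[OF invP(2)] by (simp_all add: mat2_eq_iff mult2_nth)
  define z where "z = ?J ** ?q ** ?P"
  define y where "y = ?J ** ?s ** ?P"
  have "?J ** inf_series M' = ?J ** (inf_series M' ** ?P') ** ?J"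
    by (simp add: J flip: matrix_mul_assoc)
  also have "\<dots> = n' ** ?J" by (simp add: P'(2) matrix_mul_assoc J)
  finally have JM: "?J ** inf_series M' = n' ** ?J" .
  have zy: "(n' ** z) $ i $ j = ?t * (y ** n0) $ i $ j" for i j
  proof -
    have "n' ** z = ?J ** (inf_series M' ** ?q) ** ?P"
      by (simp add: z_def matrix_mul_assoc flip: JM)
    moreover have "y ** n0 = ?J ** (?s ** inf_series M) ** ?P"
      by (simp add: y_def P(2) flip: matrix_mul_assoc)
    ultimately show ?thesis by (simp add: mult2_nth[of "_ ** _" ?P] mult2_nth[of ?J] series algebra_simps)
  qed
  have yz: "fps_nth (y $ a $ b) 0 = fps_nth (z $ a $ b) 0" "fps_nth (y $ a $ b) (Suc 0) = fps_nth (z $ a $ b) (Suc 0)" for a b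
    unfolding y_def z_def mult2_nth using sq by (simp_all add: mult2_nth fps_mult_nth_1[simplified])
  have t: "fps_nth ?t 0 = 1" "fps_nth ?t (Suc 0) = of_int N" by (rule twist_coeffs)+
  have zy0: "fps_nth ((n' ** z) $ i $ j) 0 = fps_nth (?t * (y ** n0) $ i $ j) 0"
    and zy1: "fps_nth ((n' ** z) $ i $ j) (Suc 0) = fps_nth (?t * (y ** n0) $ i $ j) (Suc 0)" for i j
    by (simp_all only: zy)
  \<comment> \<open>Order zero: an off-diagonal entry of the leading coefficient is multiplied by
    \<open>rho1 \<theta>\<close> on one side and by \<open>rho2 \<theta>\<close> on the
    other.\<close>
  have z12: "fps_nth (z $ 1 $ 2) 0 = 0" and z21: "fps_nth (z $ 2 $ 1) 0 = 0"
    using zy0[of 1 2] zy0[of 2 1] \<rho>(1) t yz n' n0 by (auto simp: mult2_nth)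
  \<comment> \<open>Order one on the diagonal: the two sides have equal \<rho>_j and equal \<rho>_j
    d_j, so everything cancels except N \<rho>_j times the leading coefficient.\<close>
  have "of_int N * fps_nth (z $ 1 $ 1) 0 = 0" "of_int N * fps_nth (z $ 2 $ 2) 0 = 0"
    using zy1[of 1 1] zy1[of 2 2] \<rho>(2,3) t yz n' n0 z12 z21
    by (simp_all add: mult2_nth fps_mult_nth_1[simplified] algebra_simps)
  moreover have "\<not> (fps_nth (z $ 1 $ 1) 0 = 0 \<and> fps_nth (z $ 2 $ 2) 0 = 0)"
  proof
    assume "fps_nth (z $ 1 $ 1) 0 = 0 \<and> fps_nth (z $ 2 $ 2) 0 = 0"
    then have z0: "map_matrix (\<lambda>f. fps_nth f 0) z = 0" using z12 z21 by (simp add: mat2_eq_iff)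
    let ?q0 = "map_matrix (\<lambda>f. fps_nth f 0) ?q"
    have "map_matrix (\<lambda>f. fps_nth f 0) z = matrix_inv P' ** ?q0 ** P"
      by (simp add: mat2_eq_iff mult2_nth z_def)
    then have "matrix_inv P' ** ?q0 ** P = 0 ** P" using z0 by (simp add: mat2_eq_iff mult2_nth)
    then have "matrix_inv P' ** ?q0 = 0" by (simp only: matrix_cancel_right[OF invP(1)])
    then have "?q0 = P' ** 0" by (simp only: matrix_inv_left_eq_iff[OF invP(2)])
    then have "?q0 = 0" by (simp add: mat2_eq_iff mult2_nth)
    have "fps_nth (inf_coeff (Q' $ a $ b)) 0 = 0" for a b
      using arg_cong[OF \<open>?q0 = 0\<close>, of "\<lambda>M. M $ a $ b"] by simp
    then have "Q' $ a $ b \<in> lsi (- 1)" for a b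
      using inf_coeff_lsi[OF Q'0, of a b 1] by simp
    then have "Q $ a $ b \<in> lsi (N - 1)" for a b by (simp add: Q'_def lsi_Zp_mult)
    then show False using notN by blast
  qed
  ultimately have "N = 0" by auto
  then show ?thesis using QN by simp
qed simp

text \<open>R is regular on the affine line by \<open>rational_iso_polys\<close> and at infinity by
  \<open>intertwiner_regular_inf\<close>, applied in the frame at infinity. The resulting degree
  bounds make it triangular with a constant diagonal, and then it is an automorphism as soon as its
  determinant is nonzero.\<close>

lemma rational_iso_atlas:
  assumes pv: "pv_type \<theta>" and B: "B \<in> atlas \<theta>" and B': "B' \<in> atlas \<theta>" and inv: "invertible R"
    and R: "map_matrix shift R ** map_matrix of_pol B = map_matrix of_pol B' ** R"
  shows "bundle_iso R std_bundle std_bundle"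
proof -
  note pvs = pv_type_simps[OF pv]
  have "\<forall>i j. R $ i $ j \<in> polys" using rational_iso_polys[OF pv B B' R] by blast
  then obtain F where F: "R = map_matrix of_pol F" by (rule polys_matrix)
  let ?H = "mk2 (Zp (- 0)) 0 0 (Zp (- 1))" and ?K = "mk2 1 0 0 (Zp 1)"
  have HK: "?H ** ?K = mat 1" by (simp add: mat2_eq_iff mult2_nth Zp_mult)
  define Q where "Q = ?K ** R ** ?H"
  have HQ: "?H ** Q = R ** ?H" by (simp only: Q_def matrix_mul_assoc HK matrix_mul_lid)
  have invH: "invertible ?H" "invertible ?K" by simp_all
  have invQ: "invertible Q" unfolding Q_def using inv invH by (intro invertible_mult)
  let ?M = "inf_twisted 0 1 (map_matrix of_pol B)" and ?M' = "inf_twisted 0 1 (map_matrix of_pol B')"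
  have M: "inf_invariants \<theta> ?M" "inf_invariants \<theta> ?M'"
    using B B' unfolding atlas_iff_of_type[OF pv] std_bundle_split of_type_split[OF pv] by blast+
  have gR: "gauge R (map_matrix of_pol B') = map_matrix of_pol B" using R inv by (simp add: gauge_eq_iff)
  have "gauge Q ?M' = gauge (?H ** Q) (map_matrix of_pol B')"
    using gauge_mult[OF invH(1) invQ] by (simp only: gauge_diag)
  also have "\<dots> = ?M"
    unfolding HQ gauge_mult[OF inv invH(1)] gR by (rule gauge_diag)
  finally have "map_matrix shift Q ** ?M = ?M' ** Q" using invQ by (simp add: gauge_eq_iff)
  then have Qij: "Q $ i $ j \<in> lsi 0" for i j
    by (rule intertwiner_regular_inf[OF M pvs(4,2,3)])
  have q: "Q $ 1 $ 1 = of_pol (F $ 1 $ 1)" "Q $ 1 $ 2 = of_pol (F $ 1 $ 2) * Zp (- 1)"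
    "Q $ 2 $ 1 = Zp 1 * of_pol (F $ 2 $ 1)" "Q $ 2 $ 2 = of_pol (F $ 2 $ 2) * (Zp 1 * Zp (- 1))"
    unfolding Q_def F by (simp_all add: mult2_nth del: mult_fract)
  have "degree (F $ 1 $ 1) = 0" using Qij[of 1 1] by (auto simp: q lsi_of_pol)
  then obtain \<alpha> where \<alpha>: "F $ 1 $ 1 = [:\<alpha>:]" by (elim degree_eq_zeroE)
  have "degree (F $ 2 $ 2) = 0" using Qij[of 2 2] by (auto simp: q lsi_of_pol Zp_mult)
  then obtain \<beta> where \<beta>: "F $ 2 $ 2 = [:\<beta>:]" by (elim degree_eq_zeroE)
  have l: "degree (F $ 1 $ 2) \<le> 1" using Qij[of 1 2] by (auto simp: q lsi_Zp_mult lsi_of_pol)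
  have "F $ 2 $ 1 = 0" using Qij[of 2 1] by (auto simp: q lsi_mult_Zp lsi_of_pol)
  then have U: "F = upper \<alpha> (F $ 1 $ 2) \<beta>" using \<alpha> \<beta> by (simp add: mat2_eq_iff upper_def)
  have "det F \<noteq> 0" using inv by (simp add: invertible_det_nz F)
  then have "\<alpha> \<noteq> 0" "\<beta> \<noteq> 0" using \<alpha> \<beta> \<open>F $ 2 $ 1 = 0\<close> by (auto simp: det_2)
  from upper_std_aut[OF this l] show ?thesis using U by (simp add: F)
qed

section \<open>Uniqueness of the modified d-connection\<close>

lemma rational_iso_trans:
  assumes "rational_iso R X Y" "rational_iso S Y Z" shows "rational_iso (S ** R) X Z"
proof -
  have eq: "map_matrix shift R ** snd X = snd Y ** R" "map_matrix shift S ** snd Y = snd Z ** S"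
    using assms by (auto simp: rational_iso_def)
  have "map_matrix shift (S ** R) ** snd X = map_matrix shift S ** snd Y ** R"
    by (simp add: eq(1) flip: matrix_mul_assoc)
  also have "\<dots> = snd Z ** (S ** R)" by (simp add: eq(2) flip: matrix_mul_assoc)
  finally show ?thesis using assms by (auto simp: rational_iso_def invertible_mult)
qed

lemma rational_iso_sym:
  assumes "rational_iso R X Y" shows "rational_iso (matrix_inv R) Y X"
proof -
  have R: "invertible R" and eq: "map_matrix shift R ** snd X = snd Y ** R"
    using assms by (auto simp: rational_iso_def)
  have "map_matrix shift (matrix_inv R) ** (snd Y ** R) = snd X"
    using R eq by (simp add: matrix_inv_left_eq_iff flip: eq)
  from arg_cong[OF this, of "\<lambda>M. M ** matrix_inv R"]
  have "map_matrix shift (matrix_inv R) ** snd Y = snd X ** matrix_inv R"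
    using matrix_inv_mult(2)[OF R] by (simp flip: matrix_mul_assoc)
  then show ?thesis using R by (simp add: rational_iso_def invertible_matrix_inv)
qed

lemma dconn_iso_rational_iso:
  assumes "dconn_iso X Y" obtains R where "rational_iso R X Y"
  using assms by (auto simp: dconn_iso_def rational_iso_def bundle_iso_def)

text \<open>Two candidates for the image are rationally isomorphic through the original
  d-connection. Being of the same type, they are then isomorphic, so an explicit modification
  determines \<open>dPV\<close>.\<close>

lemma dPV_atlas_class:
  assumes pv': "pv_type \<theta>'" and B: "B \<in> atlas \<theta>" and B': "B' \<in> atlas \<theta>'"
    and R: "rational_iso R (std_bundle, map_matrix of_pol B') (std_bundle, map_matrix of_pol B)"
  shows "dPV \<theta> \<theta>' (atlas_class \<theta> B) = atlas_class \<theta>' B'"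
  unfolding dPV_def
proof (rule the_equality)
  show "atlas_class \<theta>' B' \<in> moduli \<theta>' \<and>
      (\<exists>X\<in>atlas_class \<theta> B. \<exists>X'\<in>atlas_class \<theta>' B'. \<exists>R. rational_iso R X' X)"
    using R atlas_class_in_moduli[OF B] atlas_class_in_moduli[OF B'] by blast
next
  fix c assume c: "c \<in> moduli \<theta>' \<and> (\<exists>X\<in>atlas_class \<theta> B. \<exists>X'\<in>c. \<exists>R. rational_iso R X' X)"
  then obtain B'' where B'': "B'' \<in> atlas \<theta>'" "c = atlas_class \<theta>' B''"
    using moduli_atlas_class[OF pv'] by metis
  let ?X = "(std_bundle, map_matrix of_pol B)" and ?X' = "(std_bundle, map_matrix of_pol B')"
    and ?X'' = "(std_bundle, map_matrix of_pol B'')"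
  obtain Y Y'' R0 where Y: "Y \<in> atlas_class \<theta> B" "Y'' \<in> atlas_class \<theta>' B''" "rational_iso R0 Y'' Y"
    using c B'' by blast
  then have "dconn_iso ?X Y" "dconn_iso ?X'' Y''"
    by (auto simp: atlas_class_def iso_rel_def)
  then obtain T T'' where T: "rational_iso T ?X Y" "rational_iso T'' ?X'' Y''"
    using dconn_iso_rational_iso by metis
  obtain V where "rational_iso V ?X'' ?X'"
    using rational_iso_trans[OF rational_iso_trans[OF rational_iso_trans[OF T(2) Y(3)] rational_iso_sym[OF T(1)]]
        rational_iso_sym[OF R]] by blast
  then have V: "invertible V" "map_matrix shift V ** map_matrix of_pol B'' = map_matrix of_pol B' ** V"
    by (simp_all add: rational_iso_def)
  have "bundle_iso V std_bundle std_bundle" by (rule rational_iso_atlas[OF pv' B''(1) B' V])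
  then have "dconn_iso ?X'' ?X'" using V by (auto simp: dconn_iso_def)
  then show "c = atlas_class \<theta>' B'" using B'' B' by (simp add: atlas_class_eq_iff)
qed

subsection \<open>The Zariski topology\<close>

lemma coeff_functions_uminus: "f \<in> coeff_functions \<Longrightarrow> (\<lambda>B. - f B) \<in> coeff_functions"
  using coeff_functions.mult[OF coeff_functions.const[of "- 1"]] by fastforce

lemma coeff_functions_diff:
  "f \<in> coeff_functions \<Longrightarrow> g \<in> coeff_functions \<Longrightarrow> (\<lambda>B. f B - g B) \<in> coeff_functions"
  using coeff_functions.add[OF _ coeff_functions_uminus] by fastforce

lemma coeff_functions_tendsto:
  assumes "f \<in> coeff_functions" "\<And>i j k. ((\<lambda>t. coeff (B t $ i $ j) k) \<longlongrightarrow> coeff (B0 $ i $ j) k) F"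
  shows "((\<lambda>t. f (B t)) \<longlongrightarrow> f B0) F"
  using assms by (induction rule: coeff_functions.induct) (auto intro: tendsto_intros)

text \<open>The classical topology on the coefficients is finer than the Zariski topology, so density may be
  checked along continuous curves.\<close>

lemma atlas_open_eventually:
  assumes W: "openin (atlas_top \<theta>) W" and B0: "B 0 \<in> W"
    and cont: "\<And>i j k. isCont (\<lambda>t::complex. coeff (B t $ i $ j) k) 0"
    and atlas: "\<forall>\<^sub>F t in at 0. B t \<in> atlas \<theta>"
  shows "\<forall>\<^sub>F t in at 0. B t \<in> W"
proof -
  let ?S = "{{B. f B \<noteq> 0} | f. f \<in> coeff_functions}"
  obtain T where T: "generate_topology_on ?S T" "W = T \<inter> atlas \<theta>"
    using W by (auto simp: atlas_top_def openin_subtopology openin_topology_generated_by_iff)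
  have "B 0 \<in> T \<Longrightarrow> \<forall>\<^sub>F t in at 0. B t \<in> T"
    using T(1)
  proof (induction rule: generate_topology_on.induct)
    case (Int a b)
    then show ?case by (auto intro: eventually_conj)
  next
    case (UN K)
    then obtain k where "k \<in> K" "B 0 \<in> k" "\<forall>\<^sub>F t in at 0. B t \<in> k" by blast
    then show ?case by (auto elim: eventually_mono)
  next
    case (Basis s)
    then obtain f where f: "f \<in> coeff_functions" "s = {B. f B \<noteq> 0}" by blast
    have "((\<lambda>t. f (B t)) \<longlongrightarrow> f (B 0)) (at 0)"
      using coeff_functions_tendsto[OF f(1), of B "B 0" "at 0"] cont by (simp add: isCont_def)
    then show ?case using Basis f tendsto_imp_eventually_ne by fastforce
  qed simp
  then show ?thesis using T(2) B0 atlas by (auto elim: eventually_elim2)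
qed

lemma isCont_coeff_pCons:
  assumes "isCont a x" "\<And>k. isCont (\<lambda>t. coeff (p t) k) x"
  shows "isCont (\<lambda>t. coeff (pCons (a t) (p t)) k) x"
  using assms by (cases k) simp_all

lemma isCont_coeff_const: "isCont (\<lambda>t. coeff p k) x"
  by simp

lemma isCont_coeff_mk2:
  assumes "\<And>k. isCont (\<lambda>t. coeff (a t) k) x" "\<And>k. isCont (\<lambda>t. coeff (b t) k) x"
    "\<And>k. isCont (\<lambda>t. coeff (c t) k) x" "\<And>k. isCont (\<lambda>t. coeff (d t) k) x"
  shows "isCont (\<lambda>t. coeff (mk2 (a t) (b t) (c t) (d t) $ i $ j) k) x"
  using assms exhaust_2[of i] exhaust_2[of j] by auto

lemma eventually_avoid_finite:
  fixes S :: "complex set"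
  assumes "finite S"
  shows "\<forall>\<^sub>F t in at 0. t \<notin> S"
proof -
  have "\<forall>\<^sub>F t in at 0. t \<noteq> s" for s :: complex
  proof (cases "s = 0")
    case False
    then show ?thesis by (intro tendsto_imp_eventually_ne[OF tendsto_ident_at]) simp
  qed (simp add: eventually_at_filter)
  then have "\<forall>\<^sub>F t in at 0. \<forall>s\<in>S. t \<noteq> s" using assms by (intro eventually_ball_finite) auto
  then show ?thesis by (rule eventually_mono) auto
qed

subsection \<open>Normal forms\<close>

lemma gauge_upper_exists:
  assumes "\<alpha> \<noteq> 0" "\<beta> \<noteq> 0"
  obtains B' where "B ** upper \<alpha> l \<beta> = upper \<alpha> (sh l) \<beta> ** B'"
proof
  have inv: "upper \<alpha> (sh l) \<beta> ** mk2 [:1 / \<alpha>:] (- smult (1 / (\<alpha> * \<beta>)) (sh l)) 0 [:1 / \<beta>:] = mat 1"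
    using assms by (simp add: mat2_eq_iff mult2_nth upper_def flip: one_pCons)
  show "B ** upper \<alpha> l \<beta> = upper \<alpha> (sh l) \<beta> **
      (mk2 [:1 / \<alpha>:] (- smult (1 / (\<alpha> * \<beta>)) (sh l)) 0 [:1 / \<beta>:] ** (B ** upper \<alpha> l \<beta>))"
    by (simp add: matrix_mul_assoc inv)
qed

lemma sh_surj:
  fixes g :: "complex poly"
  obtains l where "sh l = g" "degree l = degree g"
proof
  show "sh (pcompose g [:- 1, 1:]) = g" by (simp add: pcompose_pCons flip: pcompose_assoc)
  show "degree (pcompose g [:- 1, 1:]) = degree g" by (simp add: degree_pcompose)
qed

lemma degree_le_1_cases:
  fixes p :: "complex poly"
  assumes "degree p \<le> 1" shows "p = [:coeff p 0, coeff p 1:]"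
  using assms by (auto simp: poly_eq_iff coeff_pCons coeff_eq_0 split: nat.split)

lemma degree_le_2_cases:
  fixes p :: "complex poly"
  assumes "degree p \<le> 2" shows "p = [:coeff p 0, coeff p 1, coeff p 2:]"
  using assms by (auto simp: poly_eq_iff coeff_pCons coeff_eq_0 numeral_2_eq_2 split: nat.split)

lemma degree_le_4_cases:
  fixes p :: "complex poly"
  assumes "degree p \<le> 4" shows "p = [:coeff p 0, coeff p 1, coeff p 2, coeff p 3, coeff p 4:]"
  using assms by (auto simp: poly_eq_iff coeff_pCons coeff_eq_0 numeral_eq_Suc split: nat.split)

lemma const_mult: "[:c:] * p = smult c p"
  by simp

section \<open>Coordinates on the surface u y = P(q)\<close>

locale pv_moduli =
  fixes \<theta> :: dtype and a1 a2 a3 a4 :: complex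
  assumes pv: "pv_type \<theta>" and zeros: "zeros \<theta> = [a1, a2, a3, a4]"
begin

abbreviation "\<rho>1 \<equiv> rho1 \<theta>"
abbreviation "\<rho>2 \<equiv> rho2 \<theta>"
abbreviation "d1 \<equiv> dd1 \<theta>"
abbreviation "d2 \<equiv> dd2 \<theta>"

definition P :: "complex poly" where "P = smult (\<rho>1 * \<rho>2) (zero_poly \<theta>)"

text \<open>The right-hand side of the subleading trace condition in
  \<open>atlas_iff\<close>.\<close>

definition \<tau> :: complex where "\<tau> = \<rho>1 * d1 + \<rho>2 * d2"

lemmas pvs = pv_type_simps[OF pv]

lemma P_prod: "P = smult (\<rho>1 * \<rho>2) ([:- a1, 1:] * [:- a2, 1:] * [:- a3, 1:] * [:- a4, 1:])"
  using pvs(6) unfolding P_def zero_poly_def zeros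
  by (simp add: mult.assoc del: mult_pCons_left mult_pCons_right)

lemma P4: "coeff P 4 = \<rho>1 * \<rho>2" "degree P \<le> 4"
  using zero_poly_coeffs[OF pv] by (simp_all add: P_def degree_smult_le)

lemma poly_P: "poly P q = \<rho>1 * \<rho>2 * (q - a1) * (q - a2) * (q - a3) * (q - a4)"
  by (simp add: P_prod algebra_simps)

text \<open>Once the upper left entry is the constant u, the trace conditions fix the two upper
  coefficients of the lower right entry; the subtraction of \<rho>1 + \<rho>2 reflects the twist of
  O(-1). The constant term is then chosen to give the value y at q.\<close>

definition s22 :: "complex \<Rightarrow> complex \<Rightarrow> complex" where
  "s22 q y = y - (\<rho>1 + \<rho>2) * q\<^sup>2 - (\<tau> - \<rho>1 - \<rho>2) * q"

definition nf22 :: "complex \<Rightarrow> complex \<Rightarrow> complex poly" where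
  "nf22 q y = [:s22 q y, \<tau> - \<rho>1 - \<rho>2, \<rho>1 + \<rho>2:]"

text \<open>The coefficients of \<open>(u b\<^sub>2\<^sub>2 - P) / (z - q)\<close> by synthetic division.\<close>

definition nf12 :: "complex \<Rightarrow> complex \<Rightarrow> complex \<Rightarrow> complex poly" where
  "nf12 q u y =
    (let h3 = - coeff P 4; h2 = - coeff P 3 + q * h3; h1 = u * (\<rho>1 + \<rho>2) - coeff P 2 + q * h2;
         h0 = u * (\<tau> - \<rho>1 - \<rho>2) - coeff P 1 + q * h1
     in [:h0, h1, h2, h3:])"

definition nf :: "complex \<Rightarrow> complex \<Rightarrow> complex \<Rightarrow> complex poly^2^2" where
  "nf q u y = mk2 [:u:] (nf12 q u y) [:- q, 1:] (nf22 q y)"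

lemma nf12_mult:
  assumes "u * y = poly P q"
  shows "nf12 q u y * [:- q, 1:] = smult u (nf22 q y) - P"
proof -
  obtain p0 p1 p2 p3 p4 where P: "P = [:p0, p1, p2, p3, p4:]"
    using degree_le_4_cases[OF P4(2)] by blast
  have c: "coeff P 0 = p0" "coeff P 1 = p1" "coeff P 2 = p2" "coeff P 3 = p3" "coeff P 4 = p4"
    by (simp_all add: P numeral_eq_Suc)
  have "u * s22 q y = p0 + q * (p1 + q * (p2 + q * (p3 + q * p4))) - u * ((\<rho>1 + \<rho>2) * q\<^sup>2 + (\<tau> - \<rho>1 - \<rho>2) * q)"
    using assms unfolding P by (simp add: s22_def algebra_simps)
  then show ?thesis
    unfolding nf12_def c Let_def nf22_def by (simp add: P power2_eq_square algebra_simps)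
qed

lemma degree_nf: "degree (nf12 q u y) \<le> 3" "degree (nf22 q y) \<le> 2"
  by (simp_all add: nf12_def Let_def nf22_def)

lemma nf_atlas:
  assumes "u * y = poly P q" shows "nf q u y \<in> atlas \<theta>"
proof -
  have "det (nf q u y) = P"
    using nf12_mult[OF assms] by (simp add: det_2 nf_def const_mult del: mult_pCons_left mult_pCons_right)
  moreover have "coeff (nf22 q y) 1 = \<tau> - \<rho>1 - \<rho>2" "coeff (nf22 q y) 2 = \<rho>1 + \<rho>2"
    by (simp_all add: nf22_def numeral_2_eq_2)
  ultimately show ?thesis
    unfolding atlas_iff[OF pv] using degree_nf
    by (simp add: nf_def P_def[symmetric] \<tau>_def coeff_eq_0)
qed

lemma atlas_class_nf:
  assumes B: "B \<in> atlas \<theta>" and B21: "B $ 2 $ 1 = smult c [:- q, 1:]" and c: "c \<noteq> 0"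
  obtains y where "poly (B $ 1 $ 1) q * y = poly P q"
    "atlas_class \<theta> (nf q (poly (B $ 1 $ 1) q) y) = atlas_class \<theta> B"
proof -
  let ?u = "poly (B $ 1 $ 1) q"
  note B' = B[unfolded atlas_iff[OF pv]]
  define g where "g = synthetic_div (B $ 1 $ 1) q"
  have g: "B $ 1 $ 1 = [:- q, 1:] * g + [:?u:]"
    using synthetic_div_correct'[of q "B $ 1 $ 1"] by (simp add: g_def)
  have "degree (B $ 1 $ 1) \<le> 2" using B' by blast
  then have "degree g \<le> 1" by (simp add: g_def degree_synthetic_div)
  \<comment> \<open>The automorphism removes the multiple of z - q from the upper left entry,
    leaving its remainder u = b_11(q); the scaling by c makes the lower left entry monic.\<close>
  then obtain l where l: "sh l = g" "degree l \<le> 1" using sh_surj[of g] by metis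
  obtain C where C: "B ** upper 1 l c = upper 1 (sh l) c ** C" using gauge_upper_exists[of 1 c] c by auto
  note CB = atlas_gauge_upper[OF pv B _ c l(2) C, simplified]
  have C21: "C $ 2 $ 1 = [:- q, 1:]"
    using upper_gauge_entries(1)[OF _ c C] c by (simp add: B21)
  have "smult (1 / c) (sh l * B $ 2 $ 1) = [:- q, 1:] * g"
    unfolding B21 l(1) mult_smult_right smult_smult using c by simp
  then have C11: "C $ 1 $ 1 = [:?u:]"
    using upper_gauge_entries(2)[OF _ c C] g by (metis add_diff_cancel_left' one_neq_zero)
  note C' = CB(1)[unfolded atlas_iff[OF pv]]
  define y where "y = poly (C $ 2 $ 2) q"
  have det: "smult ?u (C $ 2 $ 2) - C $ 1 $ 2 * [:- q, 1:] = P"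
    using C' by (simp add: det_2 C11 C21 P_def const_mult del: mult_pCons_left mult_pCons_right)
  then have "poly (smult ?u (C $ 2 $ 2) - C $ 1 $ 2 * [:- q, 1:]) q = poly P q" by simp
  then have uy: "?u * y = poly P q" by (simp add: y_def)
  have C22: "C $ 2 $ 2 = nf22 q y"
  proof -
    have "coeff (C $ 2 $ 2) 2 = \<rho>1 + \<rho>2" "coeff (C $ 2 $ 2) 1 = \<tau> - \<rho>1 - \<rho>2"
      using C' by (auto simp: C11 \<tau>_def numeral_2_eq_2 coeff_pCons algebra_simps)
    then obtain s where s: "C $ 2 $ 2 = [:s, \<tau> - \<rho>1 - \<rho>2, \<rho>1 + \<rho>2:]"
      using degree_le_2_cases[of "C $ 2 $ 2"] C' by metis
    then have "s = s22 q y" by (simp add: y_def s22_def power2_eq_square algebra_simps)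
    then show ?thesis using s by (simp add: nf22_def)
  qed
  \<comment> \<open>The remaining entry is forced by the determinant, since z - q may be
    cancelled.\<close>
  have "C $ 1 $ 2 * [:- q, 1:] = nf12 q ?u y * [:- q, 1:]"
    using det unfolding nf12_mult[OF uy] by (simp add: C22 algebra_simps del: mult_pCons_right)
  then have "C $ 1 $ 2 = nf12 q ?u y" by (subst (asm) mult_right_cancel) simp_all
  then have "C = nf q ?u y" using C11 C21 C22 by (simp add: mat2_eq_iff nf_def)
  with uy CB(2) that show thesis by blast
qed

lemma isCont_nf:
  assumes "isCont q x" "isCont u x" "isCont y x"
  shows "isCont (\<lambda>t. coeff (nf (q t) (u t) (y t) $ i $ j) k) x"
  unfolding nf_def nf12_def nf22_def s22_def Let_def
  by (intro isCont_coeff_mk2 isCont_coeff_pCons isCont_coeff_const continuous_intros assms)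

subsection \<open>Density\<close>

text \<open>A point at \<open>q = \<infinity>\<close> is approached along \<open>b\<^sub>2\<^sub>1 = 1 + t z\<close>; the jet of \<open>x\<close> is chosen so that
  the constant term of \<open>b\<^sub>2\<^sub>2\<close> stays finite.\<close>

lemma finite_q_dense:
  assumes W: "openin (atlas_top \<theta>) W" and B: "B \<in> W"
    and sat: "\<And>B B'. B \<in> W \<Longrightarrow> B' \<in> atlas \<theta> \<Longrightarrow> atlas_class \<theta> B' = atlas_class \<theta> B \<Longrightarrow> B' \<in> W"
  obtains B' where "B' \<in> W" "coeff (B' $ 2 $ 1) 1 \<noteq> 0"
proof (cases "coeff (B $ 2 $ 1) 1 = 0")
  case True
  have BA: "B \<in> atlas \<theta>" using W B openin_subset by (fastforce simp: atlas_top_def)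
  note BA' = BA[unfolded atlas_iff[OF pv]]
  define c where "c = coeff (B $ 2 $ 1) 0"
  have B21: "B $ 2 $ 1 = [:c:]" using degree_le_1_cases[of "B $ 2 $ 1"] BA' True by (simp add: c_def)
  then have c: "c \<noteq> 0" using atlas_lower_left_nonzero[OF pv BA] by auto
  define \<rho> where "\<rho> = coeff (B $ 1 $ 1) 2"
  let ?g = "[:coeff (B $ 1 $ 1) 0, coeff (B $ 1 $ 1) 1:]"
  \<comment> \<open>Reduces the matrix at q = infinity to lower left entry 1 and upper left entry
    \<rho> z^2.\<close>
  obtain l where l: "sh l = ?g" "degree l = degree ?g" using sh_surj .
  have "degree l \<le> 1" unfolding l(2) by simp
  obtain C where C: "B ** upper 1 l c = upper 1 (sh l) c ** C" using gauge_upper_exists[of 1 c] c by auto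
  note CB = atlas_gauge_upper[OF pv BA _ c \<open>degree l \<le> 1\<close> C, simplified]
  have C21: "C $ 2 $ 1 = 1"
    using upper_gauge_entries(1)[OF _ c C] c by (simp add: B21 one_pCons)
  have B11: "B $ 1 $ 1 = [:coeff (B $ 1 $ 1) 0, coeff (B $ 1 $ 1) 1, \<rho>:]"
    using degree_le_2_cases BA' \<rho>_def by blast
  have "C $ 1 $ 1 = B $ 1 $ 1 - smult (1 / c) (?g * [:c:])"
    using upper_gauge_entries(2)[OF _ c C] unfolding l(1) B21 by simp
  also have "\<dots> = [:0, 0, \<rho>:]" using c by (subst B11) simp
  finally have C11: "C $ 1 $ 1 = [:0, 0, \<rho>:]" .
  note C' = CB(1)[unfolded atlas_iff[OF pv]]
  define \<sigma> where "\<sigma> = coeff (C $ 2 $ 2) 2"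
  define s where "s = coeff (C $ 2 $ 2) 0"
  define v where "v = \<tau> - \<sigma>"
  have sum: "\<rho> + \<sigma> = \<rho>1 + \<rho>2" using C' by (simp add: C11 \<sigma>_def numeral_2_eq_2)
  have "coeff (C $ 2 $ 2) 1 = v" using C' by (auto simp: C11 v_def \<sigma>_def \<tau>_def algebra_simps)
  then have C22: "C $ 2 $ 2 = [:s, v, \<sigma>:]"
    using degree_le_2_cases[of "C $ 2 $ 2"] C' by (simp add: s_def \<sigma>_def)
  have C12: "C $ 1 $ 2 = C $ 1 $ 1 * C $ 2 $ 2 - P"
    using C' by (simp add: det_2 C21 P_def algebra_simps)
  obtain p0 p1 p2 p3 p4 where P: "P = [:p0, p1, p2, p3, p4:]"
    using degree_le_4_cases[OF P4(2)] by blast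
  have p4: "p4 = \<rho>1 * \<rho>2" using P4(1) by (simp add: P numeral_eq_Suc)
  have "coeff (C $ 1 $ 2) 4 = 0" using C' by (simp add: coeff_eq_0)
  then have prod: "\<rho> * \<sigma> = \<rho>1 * \<rho>2" unfolding C12 by (simp add: C11 C22 P p4 numeral_eq_Suc mult.commute)
  have \<rho>0: "\<rho> \<noteq> 0" using prod pvs by auto
  \<comment> \<open>\<rho> and \<sigma> have the sum and the product of \<rho>1 and \<rho>2; if they
    were equal the discriminant would vanish.\<close>
  have "\<rho> \<noteq> \<sigma>"
  proof
    assume "\<rho> = \<sigma>"
    have "(\<rho>1 - \<rho>2)\<^sup>2 = (\<rho>1 + \<rho>2)\<^sup>2 - 4 * (\<rho>1 * \<rho>2)"
      by (simp add: power2_eq_square algebra_simps)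
    also have "\<dots> = 0"
      unfolding sum[symmetric] prod[symmetric] \<open>\<rho> = \<sigma>\<close> by (simp add: power2_eq_square algebra_simps)
    finally have "(\<rho>1 - \<rho>2)\<^sup>2 = 0" .
    then show False using pvs by simp
  qed
  then have \<delta>: "\<sigma> - \<rho> \<noteq> 0" by simp
  \<comment> \<open>The curve must satisfy \<open>key\<close> below, which is solved for S. There S
    occurs with the factor t^2, so x1 cancels the terms of order t and x2 makes those of order t^2
    yield S 0 = s.\<close>
  define x1 where "x1 = (\<rho> * v - p3) / (\<sigma> - \<rho>)"
  define x2 where "x2 = (x1\<^sup>2 + x1 * (\<rho> + v) + p2 - s * \<rho>) / (\<sigma> - \<rho>)"
  have x1: "x1 * (\<sigma> - \<rho>) = \<rho> * v - p3" and x2: "x2 * (\<sigma> - \<rho>) = x1\<^sup>2 + x1 * (\<rho> + v) + p2 - s * \<rho>"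
    using \<delta> by (simp_all add: x1_def x2_def)
  define x where "x t = x1 * t + x2 * t\<^sup>2" for t
  define S where "S t = (s * \<rho> + t * (2 * x1 * x2 + x2\<^sup>2 * t + x2 * (\<rho> + v) + (x1 + x2 * t)\<^sup>2 - p1 + p0 * t)) / (\<rho> + x t)" for t
  define N2 where "N2 t = (\<rho> + x t) * S t - p2" for t
  define N3 where "N3 t = (\<rho> + x t) * (v + x t) - p3" for t
  \<comment> \<open>Ascending division by 1 + t z, so that the coefficients of z^0 to z^3 in the
    determinant are right; that of z^4 is the condition \<open>key\<close>.\<close>
  define b12 where "b12 t = [:- p0, - p1 + t * p0, N2 t + t * p1 - t\<^sup>2 * p0, N3 t - t * N2 t - t\<^sup>2 * p1 + t ^ 3 * p0:]" for t
  define D where "D t = mk2 [:0, 0, \<rho> + x t:] (b12 t) [:1, t:] [:S t, v + x t, \<sigma> - x t:]" for t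
  have D0: "D 0 = C"
    using \<rho>0 by (simp add: D_def x_def S_def b12_def N2_def N3_def mat2_eq_iff C11 C21 C22 C12 P p4 prod mult.commute[of \<sigma> \<rho>] one_pCons)
  have x0: "x 0 = 0" by (simp add: x_def)
  have xc: "isCont x 0" unfolding x_def by (intro continuous_intros)
  have nz: "\<rho> + x 0 \<noteq> 0" using \<rho>0 x0 by simp
  have Sc: "isCont S 0" unfolding S_def by (intro continuous_intros xc nz)
  have cont: "isCont (\<lambda>t. coeff (D t $ i $ j) k) 0" for i j k
    unfolding D_def b12_def N2_def N3_def
    by (intro isCont_coeff_mk2 isCont_coeff_pCons isCont_coeff_const continuous_intros xc Sc)
  have "D t \<in> atlas \<theta>" if t: "\<rho> + x t \<noteq> 0" for t
  proof -
    have S: "(\<rho> + x t) * S t = s * \<rho> + t * (2 * x1 * x2 + x2\<^sup>2 * t + x2 * (\<rho> + v) + (x1 + x2 * t)\<^sup>2 - p1 + p0 * t)"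
      using t by (simp add: S_def)
    have key: "(\<rho> + x t) * (\<sigma> - x t) - p4 = t * (N3 t - t * N2 t - t\<^sup>2 * p1 + t ^ 3 * p0)"
    proof -
      have e1: "\<rho> * \<sigma> = p4" using prod p4 by simp
      have "(\<rho> + x t) * (\<sigma> - x t) - p4 = x t * (\<sigma> - \<rho>) - (x t)\<^sup>2"
        unfolding e1[symmetric] by (simp add: power2_eq_square algebra_simps)
      also have "x t * (\<sigma> - \<rho>) = (\<rho> * v - p3) * t + (x1\<^sup>2 + x1 * (\<rho> + v) + p2 - s * \<rho>) * t\<^sup>2"
        unfolding x1[symmetric] x2[symmetric] x_def by (simp add: algebra_simps)
      finally show ?thesis
        unfolding N2_def N3_def S by (simp add: x_def power2_eq_square power3_eq_cube algebra_simps)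
    qed
    have "det (D t) = P"
      using key by (simp add: det_2 D_def b12_def P N2_def N3_def algebra_simps power2_eq_square power3_eq_cube)
    moreover have "degree (b12 t) \<le> 3" by (simp add: b12_def)
    ultimately show ?thesis
      unfolding atlas_iff[OF pv] using sum
      by (simp add: D_def P_def[symmetric] numeral_2_eq_2 v_def \<tau>_def)
  qed
  moreover have "\<forall>\<^sub>F t in at 0. \<rho> + x t \<noteq> 0"
  proof -
    have "isCont (\<lambda>t. \<rho> + x t) 0" by (intro continuous_intros xc)
    then show ?thesis using nz unfolding isCont_def by (rule tendsto_imp_eventually_ne)
  qed
  ultimately have atlas: "\<forall>\<^sub>F t in at 0. D t \<in> atlas \<theta>" by (auto elim: eventually_mono)
  have "D 0 \<in> W" unfolding D0 using sat[OF B CB(1)] CB(2) by simp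
  from atlas_open_eventually[OF W this cont atlas] eventually_avoid_finite[of "{0}"]
  have "\<forall>\<^sub>F t in at 0. D t \<in> W \<and> t \<noteq> 0" by (auto elim: eventually_elim2)
  then obtain t where "D t \<in> W" "t \<noteq> 0" using eventually_happens[of _ "at (0::complex)"] by auto
  then show thesis using that[of "D t"] by (simp add: D_def)
qed (use B that in blast)

text \<open>If u = 0 then q is a root of P, and a simple one, so the surface u y = P(q) is smooth
  there and u can serve as parameter of a curve through the point.\<close>

lemma nonzero_u_dense:
  assumes W: "openin (atlas_top \<theta>) W" and B: "nf q u y \<in> W" "u * y = poly P q"
  obtains q' u' y' where "nf q' u' y' \<in> W" "u' * y' = poly P q'" "u' \<noteq> 0"
proof (cases "u = 0")
  case u: True
  then have Pq: "poly P q = 0" using B by simp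
  then have q: "q \<in> set (zeros \<theta>)" using pvs by (auto simp: poly_P zeros)
  define P1 where "P1 = smult (\<rho>1 * \<rho>2) (\<Prod>a\<in>set (zeros \<theta>) - {q}. [:- a, 1:])"
  have "zero_poly \<theta> = [:- q, 1:] * (\<Prod>a\<in>set (zeros \<theta>) - {q}. [:- a, 1:])"
    unfolding zero_poly_def using q by (rule prod.remove[OF finite_set])
  then have P: "P = [:- q, 1:] * P1" by (simp add: P_def P1_def)
  have nz: "poly P1 q \<noteq> 0" using pvs by (auto simp: P1_def poly_prod)
  \<comment> \<open>With P = (z - q) P1 the second factor on the curve is h P1(q + t h); this choice
    of h makes it y at t = 0.\<close>
  define h where "h = y / poly P1 q"
  define D where "D t = nf (q + t * h) t (h * poly P1 (q + t * h))" for t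
  have curve: "t * (h * poly P1 (q + t * h)) = poly P (q + t * h)" for t
    unfolding P poly_mult by (simp add: algebra_simps)
  have "D 0 \<in> W" using B nz u by (simp add: D_def h_def)
  moreover have "isCont (\<lambda>t. coeff (D t $ i $ j) k) 0" for i j k
    unfolding D_def by (intro isCont_nf continuous_intros)
  moreover have "\<forall>\<^sub>F t in at 0. D t \<in> atlas \<theta>"
    unfolding D_def using nf_atlas[OF curve] by simp
  ultimately have "\<forall>\<^sub>F t in at 0. D t \<in> W" using atlas_open_eventually[OF W] by blast
  with eventually_avoid_finite[of "{0}"] have "\<forall>\<^sub>F t in at 0. D t \<in> W \<and> t \<noteq> 0" by (auto elim: eventually_elim2)
  then obtain t where "D t \<in> W" "t \<noteq> 0" using eventually_happens[of _ "at (0::complex)"] by auto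
  then show thesis using that curve unfolding D_def by blast
qed (use B that in blast)

text \<open>By the formula to be proved, this is (p - \<rho>1)(p - \<rho>2)(a + q' - a3 - a4). Hence
  its nonvanishing at a = a3 and a = a4 expresses that q' avoids a4 and a3, before q' is
  available.\<close>

definition K :: "complex \<Rightarrow> complex \<Rightarrow> complex \<Rightarrow> complex" where
  "K a q p = (a - q) * ((p - \<rho>1) * (p - \<rho>2)) + \<rho>1 * (d1 + a3 + a4) * (p - \<rho>2) + \<rho>2 * (d2 + a3 + a4) * (p - \<rho>1)"

definition good_point :: "complex \<Rightarrow> complex \<Rightarrow> bool" where
  "good_point q p \<longleftrightarrow> q \<noteq> a3 \<and> q \<noteq> a4 \<and> p \<noteq> 0 \<and> p \<noteq> \<rho>1 \<and> p \<noteq> \<rho>2 \<and> K a3 q p \<noteq> 0 \<and> K a4 q p \<noteq> 0"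

text \<open>Two moves: with u fixed, q leaves a3 and a4; with q fixed, u varies and moves p off the
  finitely many roots of a polynomial.\<close>

lemma good_dense:
  assumes W: "openin (atlas_top \<theta>) W" and B: "nf q u y \<in> W" "u * y = poly P q" and u: "u \<noteq> 0"
  obtains q' u' where "nf q' u' (poly P q' / u') \<in> W" "u' \<noteq> 0" "good_point q' (u' / ((q' - a3) * (q' - a4)))"
proof -
  have y: "y = poly P q / u" using B(2) u by (simp add: field_simps)
  define D where "D t = nf (q + t) u (poly P (q + t) / u)" for t
  have "D 0 \<in> W" using B y by (simp add: D_def)
  moreover have "isCont (\<lambda>t. coeff (D t $ i $ j) k) 0" for i j k
    unfolding D_def using u by (intro isCont_nf continuous_intros)
  moreover have "\<forall>\<^sub>F t in at 0. D t \<in> atlas \<theta>"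
    unfolding D_def using u by (intro always_eventually allI nf_atlas) simp
  ultimately have "\<forall>\<^sub>F t in at 0. D t \<in> W" using atlas_open_eventually[OF W] by blast
  with eventually_avoid_finite[of "{a3 - q, a4 - q}"]
  have "\<forall>\<^sub>F t in at 0. D t \<in> W \<and> t \<notin> {a3 - q, a4 - q}" by (auto elim: eventually_elim2)
  then obtain t where "D t \<in> W" "t \<notin> {a3 - q, a4 - q}" using eventually_happens[of _ "at (0::complex)"] by auto
  then obtain q' where q': "nf q' u (poly P q' / u) \<in> W" "q' \<noteq> a3" "q' \<noteq> a4"
    unfolding D_def by (auto simp: algebra_simps)
  let ?w = "(q' - a3) * (q' - a4)"
  have w: "?w \<noteq> 0" using q' by simp
  \<comment> \<open>K as a polynomial in p. Its leading coefficient a - q' is nonzero for a = a3, a4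
    by the first move.\<close>
  define KK where "KK a = smult (a - q') ([:- \<rho>1, 1:] * [:- \<rho>2, 1:]) + smult (\<rho>1 * (d1 + a3 + a4)) [:- \<rho>2, 1:]
    + smult (\<rho>2 * (d2 + a3 + a4)) [:- \<rho>1, 1:]" for a
  have KK: "poly (KK a) p = K a q' p" for a p by (simp add: KK_def K_def algebra_simps)
  have "coeff (KK a) 2 = a - q'" for a by (simp add: KK_def numeral_2_eq_2)
  then have KKnz: "KK a \<noteq> 0" if "q' \<noteq> a" for a using that by (metis coeff_0 eq_iff_diff_eq_0)
  define G where "G = [:0, 1:] * [:- \<rho>1, 1:] * [:- \<rho>2, 1:] * KK a3 * KK a4"
  have "G \<noteq> 0" using KKnz q' by (simp add: G_def del: mult_pCons_left mult_pCons_right)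
  \<comment> \<open>Rewrites the conditions on p in the curve parameter t, as p = (u + t) /
    w.\<close>
  define G' where "G' = pcompose G [:u / ?w, 1 / ?w:]"
  have "G' \<noteq> 0" using \<open>G \<noteq> 0\<close> w by (auto simp: G'_def pcompose_eq_0_iff)
  then have fin: "finite {t. poly G' t = 0}" by (rule poly_roots_finite)
  have polyG': "poly G' t = poly G ((u + t) / ?w)" for t
    by (simp add: G'_def poly_pcompose add_divide_distrib)
  define E where "E t = nf q' (u + t) (poly P q' / (u + t))" for t
  have "E 0 \<in> W" using q' by (simp add: E_def)
  moreover have "isCont (\<lambda>t. coeff (E t $ i $ j) k) 0" for i j k
    unfolding E_def using u by (intro isCont_nf continuous_intros) simp
  moreover have "\<forall>\<^sub>F t in at 0. E t \<in> atlas \<theta>"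
    using eventually_avoid_finite[of "{- u}"]
    by (auto simp: E_def eq_neg_iff_add_eq_0 add.commute intro!: nf_atlas elim!: eventually_mono)
  ultimately have "\<forall>\<^sub>F t in at 0. E t \<in> W" using atlas_open_eventually[OF W] by blast
  with eventually_avoid_finite[OF fin] have "\<forall>\<^sub>F t in at 0. E t \<in> W \<and> poly G' t \<noteq> 0" by (auto elim: eventually_elim2)
  then obtain t where t: "E t \<in> W" "poly G' t \<noteq> 0" using eventually_happens[of _ "at (0::complex)"] by auto
  then have "poly G ((u + t) / ?w) \<noteq> 0" by (simp add: polyG')
  then have "(u + t) / ?w \<noteq> 0" "(u + t) / ?w \<noteq> \<rho>1" "(u + t) / ?w \<noteq> \<rho>2"
    "K a3 q' ((u + t) / ?w) \<noteq> 0" "K a4 q' ((u + t) / ?w) \<noteq> 0"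
    unfolding G_def poly_mult KK by auto
  then show thesis using that[of q' "u + t"] t(1) q' by (auto simp: E_def good_point_def)
qed

end

subsection \<open>The open set\<close>

lemma openin_atlas_basic:
  assumes "f \<in> coeff_functions"
  shows "openin (atlas_top \<theta>) {B \<in> atlas \<theta>. f B \<noteq> 0}"
  unfolding atlas_top_def openin_subtopology
proof (intro exI conjI)
  show "openin (topology_generated_by {{B. f B \<noteq> 0} | f. f \<in> coeff_functions}) {B. f B \<noteq> 0}"
    using assms by (auto simp: openin_topology_generated_by_iff intro!: generate_topology_on.Basis)
qed auto

lemma openin_atlas: "openin (atlas_top \<theta>) (atlas \<theta>)"
  using openin_atlas_basic[OF coeff_functions.const[of 1]] by simp

lemma topspace_moduli_top: "topspace (moduli_top \<theta>) = moduli \<theta>"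
proof -
  have "{B \<in> atlas \<theta>. atlas_class \<theta> B \<in> moduli \<theta>} = atlas \<theta>" using atlas_class_in_moduli(1) by blast
  then have "openin (moduli_top \<theta>) (moduli \<theta>)" by (simp add: openin_moduli_top openin_atlas)
  then have "moduli \<theta> \<subseteq> topspace (moduli_top \<theta>)" by (rule openin_subset)
  moreover have "topspace (moduli_top \<theta>) \<subseteq> moduli \<theta>"
    using openin_topspace[of "moduli_top \<theta>"] unfolding openin_moduli_top by blast
  ultimately show ?thesis by blast
qed

context pv_moduli
begin

definition good :: "complex poly^2^2 \<Rightarrow> bool" where
  "good B \<longleftrightarrow> coeff (B $ 2 $ 1) 1 \<noteq> 0 \<and>
    (let q = - coeff (B $ 2 $ 1) 0 / coeff (B $ 2 $ 1) 1
     in good_point q (poly (B $ 1 $ 1) q / ((q - a3) * (q - a4))))"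

lemma good_iff:
  assumes "B $ 2 $ 1 = smult c [:- q, 1:]" "c \<noteq> 0"
  shows "good B \<longleftrightarrow> good_point q (poly (B $ 1 $ 1) q / ((q - a3) * (q - a4)))"
  using assms by (simp add: good_def)

lemma good_gauge:
  assumes B: "B \<in> atlas \<theta>" "good B" and B': "B' \<in> atlas \<theta>" "atlas_class \<theta> B' = atlas_class \<theta> B"
  shows "good B'"
proof -
  define c where "c = coeff (B $ 2 $ 1) 1"
  define q where "q = - coeff (B $ 2 $ 1) 0 / c"
  have c: "c \<noteq> 0" using B by (simp add: good_def c_def)
  have "degree (B $ 2 $ 1) \<le> 1" using B by (simp add: atlas_iff[OF pv])
  then have B21: "B $ 2 $ 1 = smult c [:- q, 1:]"
    using degree_le_1_cases[of "B $ 2 $ 1"] c by (simp add: q_def c_def)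
  have "class_matrix (atlas_class \<theta> B) B'" using class_matrix_self[OF B'(1)] B'(2) by simp
  then obtain \<alpha> \<beta> l where u: "\<alpha> \<noteq> 0" "\<beta> \<noteq> 0" "B ** upper \<alpha> l \<beta> = upper \<alpha> (sh l) \<beta> ** B'"
    using class_matrix_upper[OF B(1)] by metis
  have B'21: "B' $ 2 $ 1 = smult (\<alpha> / \<beta> * c) [:- q, 1:]"
    using upper_gauge_entries(1)[OF u] by (simp add: B21)
  have "poly (B' $ 1 $ 1) q = poly (B $ 1 $ 1) q"
    unfolding upper_gauge_entries(2)[OF u] by (simp add: B21)
  then show ?thesis
    using B(2) good_iff[OF B21 c] good_iff[OF B'21] u c by simp
qed

text \<open>Clearing the denominators of q and p merges all the conditions into the nonvanishing of
  one polynomial in the coefficients.\<close>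

lemma openin_good: "openin (atlas_top \<theta>) {B \<in> atlas \<theta>. good B}"
proof -
  define c e b0 b1 b2 :: "complex poly^2^2 \<Rightarrow> complex"
    where "c B = coeff (B $ 2 $ 1) 1" and "e B = - coeff (B $ 2 $ 1) 0"
      and "b0 B = coeff (B $ 1 $ 1) 0" and "b1 B = coeff (B $ 1 $ 1) 1" and "b2 B = coeff (B $ 1 $ 1) 2" for B
  \<comment> \<open>With q = e / c these are c^2 b_11(q) and c^2 (q - a3)(q - a4), so p = v / w; H
    below is K multiplied by c w^2.\<close>
  define v w where "v B = b0 B * (c B * c B) + b1 B * (c B * e B) + b2 B * (e B * e B)"
    and "w B = (e B - a3 * c B) * (e B - a4 * c B)" for B
  define H where "H a B = (a * c B - e B) * ((v B - \<rho>1 * w B) * (v B - \<rho>2 * w B))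
      + c B * (w B * (\<rho>1 * (d1 + a3 + a4) * (v B - \<rho>2 * w B) + \<rho>2 * (d2 + a3 + a4) * (v B - \<rho>1 * w B)))" for a B
  define g where "g B = c B * w B * v B * ((v B - \<rho>1 * w B) * (v B - \<rho>2 * w B)) * (H a3 B * H a4 B)" for B
  note cf = coeff_functions.const coeff_functions.coeff coeff_functions.add coeff_functions.mult
    coeff_functions_uminus coeff_functions_diff
  have "(\<lambda>B. g B) \<in> coeff_functions"
    unfolding g_def H_def v_def w_def c_def e_def b0_def b1_def b2_def by (intro cf)
  moreover have "good B \<longleftrightarrow> g B \<noteq> 0" if B: "B \<in> atlas \<theta>" for B
  proof (cases "c B = 0")
    case True
    then show ?thesis by (simp add: good_def g_def c_def)
  next
    case c: False
    define q u where "q = e B / c B" and "u = poly (B $ 1 $ 1) q"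
    have "degree (B $ 2 $ 1) \<le> 1" "degree (B $ 1 $ 1) \<le> 2" using B by (simp_all add: atlas_iff[OF pv])
    then have B21: "B $ 2 $ 1 = smult (c B) [:- q, 1:]" and B11: "B $ 1 $ 1 = [:b0 B, b1 B, b2 B:]"
      using degree_le_1_cases[of "B $ 2 $ 1"] degree_le_2_cases[of "B $ 1 $ 1"] c
      by (simp_all add: q_def c_def e_def b0_def b1_def b2_def)
    have e: "e B = c B * q" using c by (simp add: q_def)
    have v: "v B = (c B * c B) * u"
      by (simp add: v_def u_def B11 e algebra_simps)
    define w0 where "w0 = (q - a3) * (q - a4)"
    have w: "w B = (c B * c B) * w0" by (simp add: w_def e w0_def algebra_simps)
    show ?thesis
    proof (cases "w0 = 0")
      case True
      then show ?thesis
        using good_iff[OF B21 c] w by (auto simp: good_point_def g_def w0_def)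
    next
      case False
      define p where "p = u / w0"
      have u: "u = p * w0" using False by (simp add: p_def)
      have vw: "v B - r * w B = (c B * c B * w0) * (p - r)" for r by (simp add: v w u algebra_simps)
      have H: "H a B = c B * (c B * c B * w0) * (c B * c B * w0) * K a q p" for a
        unfolding H_def vw unfolding e w K_def by (simp add: algebra_simps)
      have "good B \<longleftrightarrow> good_point q p" using good_iff[OF B21 c] by (simp add: p_def u_def w0_def)
      also have "\<dots> \<longleftrightarrow> g B \<noteq> 0"
        using False c unfolding g_def vw H unfolding w v u good_point_def by (auto simp: w0_def)
      finally show ?thesis .
    qed
  qed
  ultimately show ?thesis using openin_atlas_basic[of g] by (simp cong: conj_cong)
qed

definition U :: "dconn set set" where
  "U = atlas_class \<theta> ` {B \<in> atlas \<theta>. good B}"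

lemma openin_U: "openin (moduli_top \<theta>) U"
proof -
  have "{B \<in> atlas \<theta>. atlas_class \<theta> B \<in> U} = {B \<in> atlas \<theta>. good B}"
    using good_gauge by (auto simp: U_def)
  moreover have "U \<subseteq> moduli \<theta>" using atlas_class_in_moduli(1) by (auto simp: U_def)
  ultimately show ?thesis by (simp add: openin_moduli_top openin_good)
qed

text \<open>The preimage W of an open set is a union of classes, so representatives may be exchanged
  between the moves that make q finite, make u nonzero and reach a good point.\<close>

lemma dense_U: "moduli_top \<theta> closure_of U = moduli \<theta>"
proof
  show "moduli_top \<theta> closure_of U \<subseteq> moduli \<theta>"
    using closure_of_subset_topspace topspace_moduli_top by metis
  show "moduli \<theta> \<subseteq> moduli_top \<theta> closure_of U"
  proof
    fix x assume x: "x \<in> moduli \<theta>"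
    have "\<exists>y. y \<in> U \<and> y \<in> T" if T: "x \<in> T" "openin (moduli_top \<theta>) T" for T
    proof -
      define W where "W = {B \<in> atlas \<theta>. atlas_class \<theta> B \<in> T}"
      have W: "openin (atlas_top \<theta>) W" using T(2) by (simp add: openin_moduli_top W_def)
      have sat: "B' \<in> W" if "B \<in> W" "B' \<in> atlas \<theta>" "atlas_class \<theta> B' = atlas_class \<theta> B" for B B'
        using that by (simp add: W_def)
      obtain B where "B \<in> W" using moduli_atlas_class[OF pv x] T(1) W_def by blast
      then have "\<exists>B1. B1 \<in> W \<and> coeff (B1 $ 2 $ 1) 1 \<noteq> 0"
      proof (rule finite_q_dense[OF W])
        show "B' \<in> W" if "B \<in> W" "B' \<in> atlas \<theta>" "atlas_class \<theta> B' = atlas_class \<theta> B" for B B'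
          using that by (rule sat)
      qed blast
      then obtain B1 where B1: "B1 \<in> W" "coeff (B1 $ 2 $ 1) 1 \<noteq> 0" by blast
      define c where "c = coeff (B1 $ 2 $ 1) 1"
      define q where "q = - coeff (B1 $ 2 $ 1) 0 / c"
      have "degree (B1 $ 2 $ 1) \<le> 1" using B1 by (simp add: W_def atlas_iff[OF pv])
      then have B21: "B1 $ 2 $ 1 = smult c [:- q, 1:]"
        using degree_le_1_cases[of "B1 $ 2 $ 1"] B1 by (simp add: q_def c_def)
      have "B1 \<in> atlas \<theta>" "c \<noteq> 0" using B1 by (simp_all add: W_def c_def)
      then obtain u y where uy: "u * y = poly P q" "atlas_class \<theta> (nf q u y) = atlas_class \<theta> B1"
        using atlas_class_nf[OF _ B21] by metis
      then have "nf q u y \<in> W" using sat[OF B1(1) nf_atlas] by blast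
      then obtain q1 u1 y1 where 1: "nf q1 u1 y1 \<in> W" "u1 * y1 = poly P q1" "u1 \<noteq> 0"
        using nonzero_u_dense[OF W _ uy(1)] by blast
      obtain q2 u2 where 2: "nf q2 u2 (poly P q2 / u2) \<in> W" "u2 \<noteq> 0" "good_point q2 (u2 / ((q2 - a3) * (q2 - a4)))"
        using good_dense[OF W 1] by blast
      have "good (nf q2 u2 (poly P q2 / u2))"
        using good_iff[of _ 1 q2] 2(3) by (simp add: nf_def)
      then show ?thesis using 2(1) by (auto simp: W_def U_def)
    qed
    then show "x \<in> moduli_top \<theta> closure_of U"
      using x by (simp add: in_closure_of topspace_moduli_top)
  qed
qed

end

subsection \<open>The modification\<close>

locale pv_modification = pv_moduli +
  fixes \<theta>' :: dtype
  assumes \<theta>': "zeros \<theta>' = [a1 - 1, a2 - 1, a3, a4]" "rho1 \<theta>' = rho1 \<theta>" "rho2 \<theta>' = rho2 \<theta>"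
    "dd1 \<theta>' = dd1 \<theta> + 1" "dd2 \<theta>' = dd2 \<theta> + 1" "pord \<theta>' = 2"
begin

lemma zeros_nth: "i < 4 \<Longrightarrow> zeros \<theta>' ! i = zeros \<theta> ! i - (if i < 2 then 1 else 0)"
  using zeros \<theta>' by (auto simp: less_Suc_eq numeral_eq_Suc)

lemma not_int_shift:
  assumes "x \<notin> \<int>" "y - x \<in> \<int>" shows "y \<notin> (\<int> :: complex set)"
  using assms Ints_diff[of y "y - x"] by auto

text \<open>All parameters change by integers, so the conditions modulo the integers persist. The
  degree is kept because the zeros lose 2 in total and the d_j gain 2.\<close>

lemma pv': "pv_type \<theta>'"
proof -
  have nd: "nondegenerate \<theta>" "deg_type \<theta> = - 1" using pv by (auto simp: pv_type_def)
  have deg: "deg_type \<theta>' = - 1" using nd(2) by (simp add: deg_type_def zeros \<theta>' algebra_simps)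
  have sum: "(\<Sum>i\<in>I. zeros \<theta> ! i) - (\<Sum>i\<in>I. zeros \<theta>' ! i) \<in> \<int>" if "I \<subseteq> {..<4}" for I
  proof -
    have "(\<Sum>i\<in>I. zeros \<theta> ! i) - (\<Sum>i\<in>I. zeros \<theta>' ! i) = (\<Sum>i\<in>I. zeros \<theta> ! i - zeros \<theta>' ! i)"
      by (simp add: sum_subtractf)
    also have "\<dots> \<in> \<int>" using that by (intro Ints_sum) (auto simp: zeros_nth subset_iff)
    finally show ?thesis .
  qed
  have ds: "- dd1 \<theta>' - (\<Sum>i\<in>I. zeros \<theta>' ! i) \<notin> \<int>" "- dd2 \<theta>' - (\<Sum>i\<in>I. zeros \<theta>' ! i) \<notin> \<int>" if I: "I \<subseteq> {..<4}" for I
  proof -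
    have "- dd1 \<theta>' - (\<Sum>i\<in>I. zeros \<theta>' ! i) - (- dd1 \<theta> - (\<Sum>i\<in>I. zeros \<theta> ! i)) \<in> \<int>"
      "- dd2 \<theta>' - (\<Sum>i\<in>I. zeros \<theta>' ! i) - (- dd2 \<theta> - (\<Sum>i\<in>I. zeros \<theta> ! i)) \<in> \<int>"
      using Ints_diff[OF sum[OF I] Ints_1] by (simp_all add: \<theta>' algebra_simps)
    then show "- dd1 \<theta>' - (\<Sum>i\<in>I. zeros \<theta>' ! i) \<notin> \<int>" "- dd2 \<theta>' - (\<Sum>i\<in>I. zeros \<theta>' ! i) \<notin> \<int>"
      using not_int_shift pv_type_not_int[OF pv I] by blast+
  qed
  have diffs: "zeros \<theta>' ! i - zeros \<theta>' ! j \<notin> \<int>" if "i < 4" "j < 4" "i \<noteq> j" for i j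
  proof (rule not_int_shift)
    show "zeros \<theta> ! i - zeros \<theta> ! j \<notin> \<int>" using nd that pvs(5) by (simp add: nondegenerate_def)
    show "zeros \<theta>' ! i - zeros \<theta>' ! j - (zeros \<theta> ! i - zeros \<theta> ! j) \<in> \<int>" using that by (simp add: zeros_nth)
  qed
  have "length (zeros \<theta>') = 4" by (simp add: \<theta>')
  then have "nondegenerate \<theta>'"
    unfolding nondegenerate_def using ds diffs pvs deg by (simp add: \<theta>'(2,3,6))
  with deg show ?thesis by (simp add: pv_type_def \<theta>')
qed

lemma zero_poly': "zero_poly \<theta>' = [:1 - a1, 1:] * [:1 - a2, 1:] * [:- a3, 1:] * [:- a4, 1:]"
  using pv_type_simps(6)[OF pv'] unfolding zero_poly_def \<theta>'(1)
  by (simp add: mult.assoc del: mult_pCons_left mult_pCons_right)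

text \<open>In the normal form, \<open>T = [[0, m], [1, l]]\<close> with \<open>m = (z - a\<^sub>1) (z - a\<^sub>2)\<close> has the same kernels at
  \<open>a\<^sub>1\<close> and \<open>a\<^sub>2\<close> as the d-connection, so that \<open>T(z + 1) A(z) T(z)\<inverse>\<close> moves these zeros to
  \<open>a\<^sub>1 - 1\<close> and \<open>a\<^sub>2 - 1\<close>; the condition on \<open>l\<close> is \<open>b\<^sub>2\<^sub>2 = \<gamma> m + (z - q) l\<close>.\<close>

lemma modification:
  assumes uy: "u * y = poly P q" and u: "u = p * ((q - a3) * (q - a4))" and gp: "good_point q p"
  obtains q' p' where "dPV \<theta> \<theta>' (atlas_class \<theta> (nf q u y)) \<in> moduli \<theta>'"
    "q_coord (dPV \<theta> \<theta>' (atlas_class \<theta> (nf q u y))) = Fin q'"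
    "p_coord \<theta>' (dPV \<theta> \<theta>' (atlas_class \<theta> (nf q u y))) = Fin p'"
    "q' \<noteq> a3" "q' \<noteq> a4"
    "q' + q = a3 + a4 + \<rho>1 * (d1 + a3 + a4) / (p - \<rho>1) + \<rho>2 * (d2 + a3 + a4) / (p - \<rho>2)"
    "p' * p = (q' - a1 + 1) * (q' - a2 + 1) / ((q' - a3) * (q' - a4)) * (\<rho>1 * \<rho>2)"
proof -
  define w0 where "w0 = (q - a3) * (q - a4)"
  define \<kappa> where "\<kappa> = \<rho>1 * \<rho>2"
  \<comment> \<open>Evaluating \<open>b_22 = \<gamma> m + (z - q) l\<close> at q requires y =
    \<gamma> m(q); since u y = P(q), \<gamma> = \<kappa> / p does this, also where m(q) = 0.\<close>
  define \<gamma> where "\<gamma> = \<kappa> / p"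
  have nz: "p \<noteq> 0" "w0 \<noteq> 0" "\<kappa> \<noteq> 0" using gp pvs by (auto simp: good_point_def w0_def \<kappa>_def)
  have \<gamma>p: "p * \<gamma> = \<kappa>" using nz by (simp add: \<gamma>_def)
  have u': "u = p * w0" using u by (simp add: w0_def)
  have u\<gamma>: "u * \<gamma> = \<kappa> * w0" using \<gamma>p by (simp add: u' mult.commute mult.left_commute)
  \<comment> \<open>The coefficients of l, from comparing z^2 and z in the same identity.\<close>
  define t1 where "t1 = \<rho>1 + \<rho>2 - \<gamma>"
  define t2 where "t2 = \<tau> - \<rho>1 - \<rho>2 + \<gamma> * (a1 + a2) + q * t1"
  define m m' l l' X C :: "complex poly" where "m = [:- a1, 1:] * [:- a2, 1:]" and "m' = [:1 - a1, 1:] * [:1 - a2, 1:]"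
    and "l = [:t2, t1:]" and "l' = [:t1 + t2, t1:]" and "X = [:- q, 1:]" and "C = [:q - a3 - a4, 1:]"
  have shm: "sh m = m'" and shl: "sh l = l'"
    by (simp_all add: m_def m'_def l_def l'_def pcompose_mult pcompose_pCons algebra_simps)
  \<comment> \<open>Division of (z - a3)(z - a4) by z - q, with remainder w0.\<close>
  have CX: "C * X = [:- a3, 1:] * [:- a4, 1:] - [:w0:]"
    by (simp add: C_def X_def w0_def algebra_simps)
  have Pm: "P = smult \<kappa> (m * ([:- a3, 1:] * [:- a4, 1:]))"
    unfolding P_prod m_def \<kappa>_def by (simp only: mult.assoc)
  have "u * y = u * (\<gamma> * ((q - a1) * (q - a2)))"
  proof -
    have "u * y = \<kappa> * w0 * ((q - a1) * (q - a2))" using uy by (simp add: poly_P \<kappa>_def w0_def)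
    then show ?thesis by (simp add: u\<gamma>[symmetric])
  qed
  then have y: "y = \<gamma> * ((q - a1) * (q - a2))" using nz by (simp add: u')
  have nf22: "nf22 q y = smult \<gamma> m + X * l"
    by (simp add: nf22_def s22_def y m_def X_def l_def t2_def t1_def power2_eq_square algebra_simps)
  have "(smult u l - smult \<kappa> (m * C)) * X = smult u (nf22 q y) - P"
  proof -
    have "(smult u l - smult \<kappa> (m * C)) * X = smult u (X * l) - smult \<kappa> (m * (C * X))"
      by (simp only: left_diff_distrib mult_smult_left mult.assoc mult.commute[of l X])
    also have "m * (C * X) = m * ([:- a3, 1:] * [:- a4, 1:]) - smult w0 m"
      unfolding CX right_diff_distrib by (simp only: const_mult mult.commute[of m "[:w0:]"])
    also have "smult \<kappa> \<dots> = P - smult (u * \<gamma>) m"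
      unfolding Pm u\<gamma> by (simp only: smult_diff_right smult_smult)
    finally show ?thesis by (simp add: nf22 smult_add_right)
  qed
  then have "nf12 q u y * X = (smult u l - smult \<kappa> (m * C)) * X"
    using nf12_mult[OF uy] by (simp only: X_def)
  then have nf12: "nf12 q u y = smult u l - smult \<kappa> (m * C)" by (subst (asm) mult_right_cancel) (simp_all add: X_def)
  \<comment> \<open>Solves T(z + 1) A = B' T. The first column of T makes the second column of B'
    immediate; in the other column m divides out by \<open>nf22\<close> and
    \<open>nf12\<close>.\<close>
  define B' where "B' = mk2 (smult \<gamma> m') (m' * X) (smult \<gamma> l' - smult \<kappa> C) ([:u:] + X * l')"
  define T where "T = mk2 0 m 1 l"
  have TB: "mk2 0 m' 1 l' ** nf q u y = B' ** T"
    by (simp add: mat2_eq_iff mult2_nth B'_def T_def nf_def nf22 nf12 X_def[symmetric] const_mult)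
      (simp add: algebra_simps smult_add_right smult_diff_right)
  have detB': "det B' = smult \<kappa> (zero_poly \<theta>')"
  proof -
    have "det B' = m' * (smult \<gamma> [:u:] + smult \<kappa> (C * X))"
      unfolding det_2 B'_def mk2_nth by (simp add: algebra_simps smult_add_right smult_diff_right)
    \<comment> \<open>u \<gamma> = \<kappa> w0 is exactly the remainder missing from \<kappa> C X to
      complete \<kappa> (z - a3)(z - a4).\<close>
    also have "smult \<gamma> [:u:] = smult \<kappa> [:w0:]" using u\<gamma> by (simp add: mult.commute)
    also have "smult \<kappa> [:w0:] + smult \<kappa> (C * X) = smult \<kappa> ([:- a3, 1:] * [:- a4, 1:])"
      unfolding CX smult_diff_right by (simp only: add_diff_cancel_left' add_diff_eq add.commute)
    also have "m' * smult \<kappa> ([:- a3, 1:] * [:- a4, 1:]) = smult \<kappa> (zero_poly \<theta>')"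
      unfolding zero_poly' m'_def by (simp only: mult_smult_right mult.assoc)
    finally show ?thesis .
  qed
  have e: "B' $ 1 $ 1 = [:\<gamma> * ((1 - a1) * (1 - a2)), \<gamma> * (2 - a1 - a2), \<gamma>:]"
    "B' $ 1 $ 2 = [:- q * ((1 - a1) * (1 - a2)), (1 - a1) * (1 - a2) - q * (2 - a1 - a2), 2 - a1 - a2 - q, 1:]"
    "B' $ 2 $ 1 = [:\<gamma> * (t1 + t2) - \<kappa> * (q - a3 - a4), \<gamma> * t1 - \<kappa>:]"
    "B' $ 2 $ 2 = [:u - q * (t1 + t2), t1 + t2 - q * t1, t1:]"
    by (simp_all add: B'_def m'_def X_def l'_def C_def algebra_simps)
  have B': "B' \<in> atlas \<theta>'"
  proof -
    have "degree (B' $ 1 $ 1) \<le> 2" "degree (B' $ 1 $ 2) \<le> 3" "degree (B' $ 2 $ 1) \<le> 1" "degree (B' $ 2 $ 2) \<le> 2"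
      unfolding e by simp_all
    moreover have "coeff (B' $ 1 $ 1) 2 + coeff (B' $ 2 $ 2) 2 = rho1 \<theta>' + rho2 \<theta>'"
      unfolding e by (simp add: numeral_2_eq_2 t1_def \<theta>')
    moreover have "coeff (B' $ 1 $ 1) 1 + coeff (B' $ 2 $ 2) 1 + coeff (B' $ 2 $ 2) 2
        = rho1 \<theta>' * dd1 \<theta>' + rho2 \<theta>' * dd2 \<theta>'"
      unfolding e by (simp add: numeral_2_eq_2 t1_def t2_def \<tau>_def \<theta>' algebra_simps)
    ultimately show ?thesis
      unfolding atlas_iff[OF pv'] using detB' by (simp only: \<theta>' \<kappa>_def)
  qed
  have nfA: "nf q u y \<in> atlas \<theta>" by (rule nf_atlas[OF uy])
  have "rational_iso (map_matrix of_pol T) (std_bundle, map_matrix of_pol (nf q u y)) (std_bundle, map_matrix of_pol B')"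
  proof -
    have "det T \<noteq> 0" by (simp add: det_2 T_def m_def)
    moreover have "map_matrix shift (map_matrix of_pol T) = map_matrix of_pol (mk2 0 m' 1 l')"
      by (simp add: mat2_eq_iff T_def shm shl pcompose_1)
    ultimately show ?thesis
      by (simp add: rational_iso_def invertible_det_nz TB flip: of_pol_matrix_mult)
  qed
  then have dPV: "dPV \<theta> \<theta>' (atlas_class \<theta> (nf q u y)) = atlas_class \<theta>' B'"
    using dPV_atlas_class[OF pv' nfA B'] rational_iso_sym by blast
  define c' where "c' = \<gamma> * t1 - \<kappa>"
  define q' where "q' = (\<kappa> * (q - a3 - a4) - \<gamma> * (t1 + t2)) / c'"
  \<comment> \<open>The leading coefficient of the lower left entry vanishes exactly at p = \<rho>1
    and p = \<rho>2, which explains the poles of the first formula.\<close>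
  have "p * p * c' = (p * \<gamma>) * (p * (\<rho>1 + \<rho>2) - p * \<gamma>) - \<kappa> * p * p"
    by (simp add: c'_def t1_def algebra_simps)
  also have "\<dots> = - \<kappa> * ((p - \<rho>1) * (p - \<rho>2))" unfolding \<gamma>p by (simp add: \<kappa>_def algebra_simps)
  finally have ppc: "p * p * c' = - \<kappa> * ((p - \<rho>1) * (p - \<rho>2))" .
  have c': "c' \<noteq> 0" using ppc nz gp by (auto simp: good_point_def)
  define N where "N = \<rho>1 * (d1 + a3 + a4) * (p - \<rho>2) + \<rho>2 * (d2 + a3 + a4) * (p - \<rho>1)"
  \<comment> \<open>The condition on the degree eliminates a1, and with it a2, from the formula for
    q'.\<close>
  have ds: "a1 = 1 - d1 - d2 - a2 - a3 - a4" using pvs(7) by (simp add: zeros algebra_simps eq_diff_eq)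
  have "c' * q' = \<kappa> * (q - a3 - a4) - \<gamma> * (t1 + t2)" using c' by (simp add: q'_def)
  then have "c' * (q' + q - a3 - a4) = - \<gamma> * (t1 + t2 - q * t1 + (a3 + a4) * t1)"
    by (simp add: c'_def algebra_simps)
  then have "p * p * (c' * (q' + q - a3 - a4)) = p * p * (- \<gamma> * (t1 + t2 - q * t1 + (a3 + a4) * t1))"
    by (simp only:)
  also have "\<dots> = - (p * \<gamma>) * ((p * (\<rho>1 + \<rho>2) - p * \<gamma>) * (1 + a3 + a4) + p * (\<tau> - \<rho>1 - \<rho>2) + p * \<gamma> * (a1 + a2))"
    by (simp add: t2_def t1_def algebra_simps)
  also have "\<dots> = - \<kappa> * N"
    unfolding \<gamma>p N_def by (simp add: \<kappa>_def ds \<tau>_def algebra_simps)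
  finally have "- \<kappa> * ((p - \<rho>1) * (p - \<rho>2)) * (q' + q - a3 - a4) = - \<kappa> * N"
    unfolding ppc[symmetric] by (simp only: mult.assoc)
  then have "\<kappa> * ((p - \<rho>1) * (p - \<rho>2) * (q' + q - a3 - a4)) = \<kappa> * N"
    by (simp only: mult_minus_left neg_equal_iff_equal mult.assoc)
  then have key: "(p - \<rho>1) * (p - \<rho>2) * (q' + q - a3 - a4) = N" using nz by simp
  have K: "K a q p = (p - \<rho>1) * (p - \<rho>2) * (a + q' - a3 - a4)" for a
    using key by (simp add: K_def N_def algebra_simps)
  have q': "q' \<noteq> a3" "q' \<noteq> a4" using gp K[of a3] K[of a4] by (auto simp: good_point_def)
  have B'21: "B' $ 2 $ 1 = smult c' [:- q', 1:]"
    using \<open>c' * q' = _\<close> by (simp add: B'_def l'_def C_def c'_def algebra_simps)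
  show thesis
  proof (rule that)
    show "dPV \<theta> \<theta>' (atlas_class \<theta> (nf q u y)) \<in> moduli \<theta>'"
      unfolding dPV by (rule atlas_class_in_moduli(1)[OF B'])
    show "q_coord (dPV \<theta> \<theta>' (atlas_class \<theta> (nf q u y))) = Fin q'"
      unfolding dPV by (rule q_coord_atlas_class[OF B' B'21 c'])
    show "p_coord \<theta>' (dPV \<theta> \<theta>' (atlas_class \<theta> (nf q u y))) = Fin (poly (B' $ 1 $ 1) q' / ((q' - a3) * (q' - a4)))"
      unfolding dPV using p_coord_atlas_class[OF B' B'21 c'] q' by (simp add: \<theta>'(1))
    show "q' \<noteq> a3" "q' \<noteq> a4" by (rule q')+
    have "p - \<rho>1 \<noteq> 0" "p - \<rho>2 \<noteq> 0" using gp by (auto simp: good_point_def)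
    then have "N / ((p - \<rho>1) * (p - \<rho>2)) = \<rho>1 * (d1 + a3 + a4) / (p - \<rho>1) + \<rho>2 * (d2 + a3 + a4) / (p - \<rho>2)"
      by (simp add: N_def add_divide_distrib)
    moreover have "N / ((p - \<rho>1) * (p - \<rho>2)) = q' + q - a3 - a4"
      using key \<open>p - \<rho>1 \<noteq> 0\<close> \<open>p - \<rho>2 \<noteq> 0\<close> by (simp flip: key)
    ultimately show "q' + q = a3 + a4 + \<rho>1 * (d1 + a3 + a4) / (p - \<rho>1) + \<rho>2 * (d2 + a3 + a4) / (p - \<rho>2)"
      by (simp add: algebra_simps)
    \<comment> \<open>The upper left entry is \<gamma> m(z + 1), so together with p \<gamma> =
      \<kappa> its value at q' is the second formula.\<close>
    have "poly (B' $ 1 $ 1) q' = \<gamma> * ((q' - a1 + 1) * (q' - a2 + 1))"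
      by (simp add: B'_def m'_def algebra_simps)
    then show "poly (B' $ 1 $ 1) q' / ((q' - a3) * (q' - a4)) * p =
        (q' - a1 + 1) * (q' - a2 + 1) / ((q' - a3) * (q' - a4)) * (\<rho>1 * \<rho>2)"
      using \<gamma>p by (simp add: \<kappa>_def[symmetric] flip: \<gamma>p)
  qed
qed

lemma coordinates_on_U:
  assumes "x \<in> U"
  shows "\<exists>q p q' p'. dPV \<theta> \<theta>' x \<in> moduli \<theta>' \<and> q_coord x = Fin q \<and> p_coord \<theta> x = Fin p \<and>
      q_coord (dPV \<theta> \<theta>' x) = Fin q' \<and> p_coord \<theta>' (dPV \<theta> \<theta>' x) = Fin p' \<and>
      p \<noteq> \<rho>1 \<and> p \<noteq> \<rho>2 \<and> q' \<noteq> a3 \<and> q' \<noteq> a4 \<and>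
      q' + q = a3 + a4 + \<rho>1 * (d1 + a3 + a4) / (p - \<rho>1) + \<rho>2 * (d2 + a3 + a4) / (p - \<rho>2) \<and>
      p' * p = (q' - a1 + 1) * (q' - a2 + 1) / ((q' - a3) * (q' - a4)) * (\<rho>1 * \<rho>2)"
proof -
  obtain B where B: "B \<in> atlas \<theta>" "good B" and x: "x = atlas_class \<theta> B" using assms by (auto simp: U_def)
  define c where "c = coeff (B $ 2 $ 1) 1"
  define q where "q = - coeff (B $ 2 $ 1) 0 / c"
  have c: "c \<noteq> 0" using B by (simp add: good_def c_def)
  have "degree (B $ 2 $ 1) \<le> 1" using B by (simp add: atlas_iff[OF pv])
  then have B21: "B $ 2 $ 1 = smult c [:- q, 1:]"
    using degree_le_1_cases[of "B $ 2 $ 1"] c by (simp add: q_def c_def)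
  define p where "p = poly (B $ 1 $ 1) q / ((q - a3) * (q - a4))"
  have gp: "good_point q p" using good_iff[OF B21 c] B by (simp add: p_def)
  then have u: "poly (B $ 1 $ 1) q = p * ((q - a3) * (q - a4))" by (simp add: p_def good_point_def)
  have qc: "q_coord x = Fin q" unfolding x by (rule q_coord_atlas_class[OF B(1) B21 c])
  have pc: "p_coord \<theta> x = Fin p"
    using p_coord_atlas_class[OF B(1) B21 c] gp by (simp add: x p_def zeros good_point_def)
  obtain y where y: "poly (B $ 1 $ 1) q * y = poly P q"
    "atlas_class \<theta> (nf q (poly (B $ 1 $ 1) q) y) = x"
    using atlas_class_nf[OF B(1) B21 c] x by metis
  obtain q' p' where "dPV \<theta> \<theta>' x \<in> moduli \<theta>'" "q_coord (dPV \<theta> \<theta>' x) = Fin q'" "p_coord \<theta>' (dPV \<theta> \<theta>' x) = Fin p'"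
    "q' \<noteq> a3" "q' \<noteq> a4"
    "q' + q = a3 + a4 + \<rho>1 * (d1 + a3 + a4) / (p - \<rho>1) + \<rho>2 * (d2 + a3 + a4) / (p - \<rho>2)"
    "p' * p = (q' - a1 + 1) * (q' - a2 + 1) / ((q' - a3) * (q' - a4)) * (\<rho>1 * \<rho>2)"
    using modification[OF y(1) u gp] unfolding y(2) by metis
  with qc pc gp show ?thesis unfolding good_point_def by blast
qed

end

theorem theorem2:
  fixes a1 a2 a3 a4 \<rho>1 \<rho>2 d1 d2 :: complex
    and \<theta> \<theta>' :: dtype
  assumes "\<theta> = \<lparr>zeros = [a1, a2, a3, a4], rho1 = \<rho>1, rho2 = \<rho>2, dd1 = d1, dd2 = d2, pord = 2\<rparr>"
    and "nondegenerate \<theta>"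
    and "deg_type \<theta> = - 1"
    and "\<theta>' = \<lparr>zeros = [a1 - 1, a2 - 1, a3, a4], rho1 = \<rho>1, rho2 = \<rho>2,
                dd1 = d1 + 1, dd2 = d2 + 1, pord = 2\<rparr>"
  shows "\<exists>U. openin (moduli_top \<theta>) U \<and> moduli_top \<theta> closure_of U = moduli \<theta> \<and>
           (\<forall>x\<in>U. \<exists>q p q' p'.
              dPV \<theta> \<theta>' x \<in> moduli \<theta>' \<and>
              q_coord x = Fin q \<and> p_coord \<theta> x = Fin p \<and>
              q_coord (dPV \<theta> \<theta>' x) = Fin q' \<and> p_coord \<theta>' (dPV \<theta> \<theta>' x) = Fin p' \<and>
              p \<noteq> \<rho>1 \<and> p \<noteq> \<rho>2 \<and> q' \<noteq> a3 \<and> q' \<noteq> a4 \<and>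
              q' + q = a3 + a4 + \<rho>1 * (d1 + a3 + a4) / (p - \<rho>1) + \<rho>2 * (d2 + a3 + a4) / (p - \<rho>2) \<and>
              p' * p = (q' - a1 + 1) * (q' - a2 + 1) / ((q' - a3) * (q' - a4)) * (\<rho>1 * \<rho>2))"
proof -
  interpret pv_modification \<theta> a1 a2 a3 a4 \<theta>'
    by unfold_locales (use assms in \<open>simp_all add: pv_type_def\<close>)
  have "rho1 \<theta> = \<rho>1" "rho2 \<theta> = \<rho>2" "dd1 \<theta> = d1" "dd2 \<theta> = d2" using assms(1) by simp_all
  with openin_U dense_U coordinates_on_U show ?thesis by metis
qed

end
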